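(* Let $G$ be the set-valued map on $[0,1)^2$ given by $G(x)=\Gamma^{-1}\circ\gamma(x)$, which sends a point $x$ to the $12$ points of $\mathbb{S}^2$ obtained by placing scaled and rotated copies of $x$ in the $12$ base squares of the planar HEALPix domain and applying the inverse HEALPix projection $\Gamma^{-1}$. Let $\mathscr{Z}$ be the set of all sequences $G(S^\Box_{2,2})$, where $S^\Box_{2,2}$ runs through all $S^\Box_{2,2}$-sequences. Then there is a constant $C'$ such that for every $Z\in\mathscr{Z}$ and every $N=12K+k$ with $K\in\mathbb{N}$, $0\le k<12$, with $\kappa=\lfloor\log(K)/\log(4)\rfloor$ and $K=\sum_{j=0}^{\kappa}\epsilon_j2^{2j}$ the $4$-adic expansion of $K$ ($\epsilon_j\in\{0,1,2,3\}$), $$\mathcal{D}_\infty(Z_N)\ \le\ 4\,\frac{5+\sqrt2}{N}\min\Big\{\sum_{j=0}^\kappa\epsilon_j2^j,\ 2^{\kappa+3}-\sum_{j=0}^\kappa\epsilon_j2^j\Big\}+\frac{C'}{N}\log(N)\ \le\ \frac{8}{\sqrt3}\,\frac{5+\sqrt2}{\sqrt N}+\frac{C'}{N}\log(N).$$ The constant $C'$ is independent of $N$.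
   Context: $\mathbb{N}=\{1,2,\dots\}$. $\mathbb{S}^2\subset\mathbb{R}^3$ is the unit sphere, $\mu$ its normalized surface measure. **$L^\infty$-discrepancy (spherical cap discrepancy).** For a multiset $X=\{x_1,\dots,x_N\}$ in $\mathbb{S}^2$, $\mathcal{D}_\infty(X)=\frac1N\sup_A\big|\sum_{j=1}^N\chi_A(x_j)-N\mu(A)\big|$, where $\chi_A$ is the indicator function of $A$ and the supremum is over all spherical caps, i.e. metric balls $A=\{x\in\mathbb{S}^2:\mathrm{dist}(w,x)\le t\}$ with $w\in\mathbb{S}^2$ and $t\in(0,r)$, $r$ the diameter of $\mathbb{S}^2$. $Z_N$ denotes the multiset of the first $N$ elements of $Z$. **Inverse HEALPix projection.** The planar domain consists of $12$ squares of side length $\sqrt2/2$, rotated by $45$ degrees, with lowest vertices $(k+\frac12,0)$, $(k,-\frac12)$, $(k+\frac12,-1)$ for $k=0,1,2,3$ (the first coordinate is understood modulo $4$). $\Gamma^{-1}(x,y)=(\sqrt{1-z^2}\cos\varphi,\sqrt{1-z^2}\sin\varphi,z)$, where: if $|y|\le\frac12$, then $z=\frac43y$ and $\varphi=\frac\pi2x$; if $\frac12<|y|<1$, then $z=\mathrm{sgn}(y)\big(1-\frac43(1-|y|)^2\big)$ and $\varphi=\frac\pi2\big(x_c+\frac{x-x_c}{2(1-|y|)}\big)$ with $x_c=\lfloor x\rfloor+\frac12$; if $|y|=1$, then $z=y$ (a pole). **The map $\gamma$.** For $x=(x_1,x_2)\in[0,1)^2$, $\gamma(x)$ is the collection of the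 $12$ points $\big(\frac{x_1-x_2}{2},\frac{x_1+x_2}{2}\big)+a$, with $a$ ranging over the $12$ lowest vertices above (i.e. $x$ is scaled by $\sqrt2/2$, rotated by $45$ degrees and placed in each of the $12$ squares). **The sequence $G(S)$.** For $S=(s_0,s_1,\dots)$ write $G(s_{n-1})=\{q^n_1,\dots,q^n_{12}\}$ ($n\in\mathbb{N}$). Then $Z=G(S)=(z_1,z_2,\dots)=(q^1_1,\dots,q^1_{12},q^2_1,\dots,q^2_{12},q^3_1,\dots)$, where within each block of $12$ points the order is arbitrary. **$S^\Box_{2,2}$-sequences.** Fix an enumeration $\{H_1,H_2,H_3\}=\{0,1\}^2\setminus\{\vec0\}$ and a sequence $\pi_0,\pi_1,\dots$ of permutations of $\{1,2,3\}$. Define recursively $s_0=\vec0$ and, once $s_0,\dots,s_{4^m-1}$ are defined ($m\ge0$), $s_{k\cdot4^m+i}=2^{-m-1}H_{\pi_m(k)}+s_i$ for $1\le k\le3$, $0\le i<4^m$. Any sequence in $[0,1)^2$ obtained this way is an $S^\Box_{2,2}$-sequence. *)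

theory Defs
  imports
    "HOL-Analysis.Analysis"
    "HOL-Library.Multiset"
    "HOL-Combinatorics.Permutations"
begin

section \<open>Spherical cap discrepancy\<close>

abbreviation sphere2 :: "(real ^ 3) set" where
  "sphere2 \<equiv> sphere 0 1"

text \<open>
  Normalized surface measure: the law of the direction \<open>x / norm x\<close> of a uniformly distributed
  point of the punctured unit ball. The surface area of a Borel set \<open>A\<close> on the sphere is three
  times the volume of the cone over \<open>A\<close> with apex 0, so this is area divided by \<open>4 * pi\<close>.
  It is a Borel measure on the whole space that is concentrated on the sphere.
\<close>

definition sphere_measure :: "(real ^ 3) measure" where
  "sphere_measure = distr (uniform_measure lborel (cball 0 1 - {0})) borel (\<lambda>x. x /\<^sub>R norm x)"

text \<open>
  The metric is the Euclidean one, so the diameter is 2; geodesic balls of radius in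
  \<open>(0, pi)\<close> are the same sets.
\<close>

definition spherical_caps :: "(real ^ 3) set set" where
  "spherical_caps =
     {{x \<in> sphere2. dist w x \<le> t} | w t. w \<in> sphere2 \<and> 0 < t \<and> t < diameter sphere2}"

definition cap_discrepancy :: "(real ^ 3) multiset \<Rightarrow> real" where
  "cap_discrepancy X =
     1 / real (size X) *
     (SUP A\<in>spherical_caps.
        \<bar>(\<Sum>x\<in>#X. indicator A x) - real (size X) * measure sphere_measure A\<bar>)"


section \<open>HEALPix\<close>

text \<open>
  For \<open>|y| \<le> 1\<close> this is well defined for \<open>x\<close> modulo 4, since the longitude only changes by a
  multiple of \<open>2 * pi\<close>. At the poles the longitude is irrelevant; values at \<open>|y| > 1\<close> are never used.
\<close>

definition healpix_z :: "real \<Rightarrow> real" where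
  "healpix_z y =
     (if \<bar>y\<bar> \<le> 1/2 then 4/3 * y
      else if \<bar>y\<bar> < 1 then sgn y * (1 - 4/3 * (1 - \<bar>y\<bar>)\<^sup>2)
      else y)"

definition healpix_phi :: "real \<Rightarrow> real \<Rightarrow> real" where
  "healpix_phi x y =
     (if \<bar>y\<bar> \<le> 1/2 then pi/2 * x
      else if \<bar>y\<bar> < 1 then
        (let xc = of_int \<lfloor>x\<rfloor> + 1/2 in pi/2 * (xc + (x - xc) / (2 * (1 - \<bar>y\<bar>))))
      else 0)"

definition inv_healpix :: "real \<times> real \<Rightarrow> real ^ 3" where
  "inv_healpix = (\<lambda>(x, y).
     let z = healpix_z y; \<phi> = healpix_phi x y
     in vector [sqrt (1 - z\<^sup>2) * cos \<phi>, sqrt (1 - z\<^sup>2) * sin \<phi>, z])"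

definition lowest_vertices :: "(real \<times> real) set" where
  "lowest_vertices =
     (\<Union>k<4::nat. {(real k + 1/2, 0), (real k, - 1/2), (real k + 1/2, - 1)})"

definition healpix_gamma :: "real \<times> real \<Rightarrow> (real \<times> real) multiset" where
  "healpix_gamma x =
     {# ((fst x - snd x) / 2, (fst x + snd x) / 2) + a. a \<in># mset_set lowest_vertices #}"

text \<open>
  The twelve points are counted with multiplicity: at \<open>x = (0, 0)\<close>, four of them are the south pole.
\<close>

definition healpix_G :: "real \<times> real \<Rightarrow> (real ^ 3) multiset" where
  "healpix_G x = image_mset inv_healpix (healpix_gamma x)"


section \<open>The sequences\<close>

definition S22_sequence :: "(nat \<Rightarrow> real \<times> real) \<Rightarrow> bool" where
  "S22_sequence s \<longleftrightarrow>
     (\<exists>(H :: nat \<Rightarrow> real \<times> real) (\<pi> :: nat \<Rightarrow> nat \<Rightarrow> nat).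
        bij_betw H {1..3} ({0, 1} \<times> {0, 1} - {(0, 0)}) \<and>
        (\<forall>m. \<pi> m permutes {1..3}) \<and>
        s 0 = (0, 0) \<and>
        (\<forall>m. \<forall>k\<in>{1..3}. \<forall>i<4 ^ m.
           s (k * 4 ^ m + i) = (1 / 2 ^ (m + 1)) *\<^sub>R H (\<pi> m k) + s i))"

text \<open>
  All sequences listing the blocks \<open>G(s 0), G(s 1), \<dots>\<close> one after the other, with any order inside
  each block. Sequences are indexed from 0, so that \<open>Z i\<close> is the element \<open>z\<^sub>i\<^sub>+\<^sub>1\<close>.
\<close>

definition G_sequences :: "(nat \<Rightarrow> real \<times> real) \<Rightarrow> (nat \<Rightarrow> real ^ 3) set" where
  "G_sequences s =
     {Z. \<forall>n. image_mset Z (mset_set {12 * n..<12 * n + 12}) = healpix_G (s n)}"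

definition GS22_sequences :: "(nat \<Rightarrow> real ^ 3) set" where
  "GS22_sequences = (\<Union>s\<in>{s. S22_sequence s}. G_sequences s)"

definition initial_mset :: "(nat \<Rightarrow> 'a) \<Rightarrow> nat \<Rightarrow> 'a multiset" where
  "initial_mset Z N = image_mset Z (mset_set {..<N})"

end

theory Submission
  imports Defs "HOL-Library.Periodic_Fun"
begin

text \<open>
  The points \<open>s i\<close> with \<open>b * 4 ^ m \<le> i < (b + 1) * 4 ^ m\<close> hit every cell of the \<open>2 ^ m\<close> by \<open>2 ^ m\<close> grid of the unit
  square exactly once (\<open>S22_block_cells\<close>), so their images under \<open>healpix_G\<close> hit each of the \<open>12 * 4 ^ m\<close> curved
  pixels on the sphere exactly once. Since the HEALPix projection preserves areas, all these pixels have the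
  same measure. A pixel inside a cap, or outside of it, therefore contributes nothing to the discrepancy of
  the cap, and the discrepancy of the block is at most the number of pixels cut by the boundary circle
  (\<open>block_discrepancy\<close>).

  With \<open>n = 2 ^ m\<close>, at most \<open>24 * n + 108\<close> pixels are cut (\<open>card_cut_pixels\<close>); the slope is below \<open>4 * (5 + sqrt 2)\<close>.
  A small perturbation of the cap makes the circle \<open>w \<bullet> x = c\<close> pass through the interior of all cut pixels,
  and moves its axis \<open>w\<close> away from the poles. The circle is described, in terms of the height \<open>z\<close> and the longitude, by
  \<open>cos (longitude - t) = g z\<close>, where the derivative of \<open>g\<close> changes sign at most once. So the circle consists of two
  branches \<open>longitude = t \<plusminus> arccos (g z)\<close> with at most two monotone pieces each, and the longitude varies by at
  most \<open>pi\<close> on a branch. In the plane the pixels are the squares of a grid turned by 45 degrees, so along a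
  monotone piece one of the two grid coordinates \<open>y + x\<close> and \<open>y - x\<close> is monotone. Consider the strips of width \<open>1 / n\<close> in
  that coordinate. In the equatorial band the other coordinate cannot vary by \<open>1 / n\<close> within a strip, because
  \<open>x\<close> and \<open>y\<close> are both monotone; so a strip contains at most two visited pixels. In the polar triangles, where
  parallels are contracted towards the poles, the extra pixels are paid for by the variation of \<open>y\<close>.
  With longitudes measured in right angles, this gives \<open>n * (2 * (variation of longitude) + (variation of lat_weight))\<close> plus a constant for
  each piece (\<open>card_cells_piece\<close>), where \<open>lat_weight\<close> grows by 8 from pole to pole; a branch thus
  costs \<open>(2 * 2 + 8) * n = 12 * n\<close> up to a constant.

  Equality of areas comes from the change of variables formula for the cone over a pixel
  (\<open>cone_map_derivative\<close>, \<open>measure_cone_over_cell\<close>). The open pixels are disjoint and their measures add up to 1,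
  which bounds the measure of a cap by the pixels inside it from below and by those it misses from above.

  Finally \<open>{..<K}\<close> is split along the base 4 digits of \<open>K\<close> into \<open>\<epsilon> j\<close> blocks of length \<open>4 ^ j\<close>, which gives the first entry
  of the minimum; the second one comes from subtracting \<open>{K..<4 ^ (\<kappa> + 1)}\<close>, split in the same way, from a full block of length
  \<open>4 ^ (\<kappa> + 1)\<close> (\<open>abs_sum_digits_le_min\<close>). There are \<open>O(\<kappa>)\<close> blocks, and the constants they carry make up the
  logarithmic term.
\<close>

section \<open>Cells visited by monotone chains\<close>

text \<open>
  The classes of a monotone label are consecutive stretches of the chain, so the increments of a monotone
  function over the classes add up to at most its increment over the whole chain.
\<close>

lemma sum_oscillation_le:
  fixes F :: "'a::linorder set" and lab :: "'a \<Rightarrow> int" and s :: "'a \<Rightarrow> real"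
  assumes "finite F" "F \<noteq> {}" "mono_on F lab" "mono_on F s"
  shows "(\<Sum>k\<in>lab ` F. s (Max {x\<in>F. lab x = k}) - s (Min {x\<in>F. lab x = k}))
           \<le> s (Max F) - s (Min F)"
  using assms
proof (induction F rule: finite_linorder_max_induct)
  case empty
  then show ?case by simp
next
  case (insert b F)
  show ?case
  proof (cases "F = {}")
    case True
    then have "{x. x = b \<and> lab x = lab b} = {b}" by auto
    with True show ?thesis by simp
  next
    case False
    define f where "f = (\<lambda>G k. s (Max {x\<in>G. lab x = k}) - s (Min {x\<in>G. lab x = k}))"
    have mono: "mono_on F lab" "mono_on F s"
      using insert.prems by (auto intro: mono_on_subset)
    have IH: "sum (f F) (lab ` F) \<le> s (Max F) - s (Min F)"
      using insert.IH[OF False mono] by (simp add: f_def)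
    have MF: "Max F \<in> F" "Min F \<in> F" using insert.hyps False by auto
    have Mb: "Max F < b" using insert.hyps MF by blast
    have Max_ins: "Max (insert b F) = b"
      using insert.hyps by (intro Max_eqI) auto
    have Min_ins: "Min (insert b F) = Min F"
    proof -
      have "Min F < b" using insert.hyps MF by blast
      then show ?thesis using insert.hyps(1) False by (simp add: min_absorb2)
    qed
    have sb: "s (Max F) \<le> s b"
      using mono_onD[OF insert.prems(3)] MF Mb by (auto simp: less_imp_le)
    have other: "f (insert b F) k = f F k" if "k \<noteq> lab b" for k
    proof -
      have "{x \<in> insert b F. lab x = k} = {x \<in> F. lab x = k}" using that by auto
      then show ?thesis by (simp add: f_def)
    qed
    have "sum (f (insert b F)) (lab ` insert b F) \<le> s b - s (Min F)"
    proof (cases "lab b \<in> lab ` F")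
      case True
      then obtain x where x: "x \<in> F" "lab x = lab b" by auto
      have "x \<le> Max F" using x insert.hyps by simp
      then have "lab x \<le> lab (Max F)" "lab (Max F) \<le> lab b"
        using mono_onD[OF insert.prems(2), of x "Max F"] mono_onD[OF insert.prems(2), of "Max F" b]
          x(1) MF(1) Mb by (auto simp: less_imp_le)
      then have lM: "lab (Max F) = lab b" using x by simp
      define G where "G = {x\<in>F. lab x = lab b}"
      have G: "finite G" "Max F \<in> G" "G \<noteq> {}" "G \<subseteq> F"
        using insert.hyps lM MF by (auto simp: G_def)
      have MG: "Max G = Max F"
        using G insert.hyps(1) by (intro Max_eqI) auto
      have bG: "\<forall>x\<in>G. x < b" using G insert.hyps by auto
      have MinG: "Min G < b" using G bG Min_in by blast
      have eq: "{x \<in> insert b F. lab x = lab b} = insert b G" by (auto simp: G_def)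
      have "Max (insert b G) = b" using G(1) bG by (intro Max_eqI) auto
      moreover have "Min (insert b G) = Min G" using G(1,3) MinG by (simp add: min_absorb2)
      ultimately have fb: "f (insert b F) (lab b) = f F (lab b) + (s b - s (Max F))"
        using eq MG unfolding f_def G_def by simp
      have "sum (f (insert b F)) (lab ` insert b F) = sum (f (insert b F)) (lab ` F)"
        using True by (simp add: insert_absorb)
      also have "\<dots> = f (insert b F) (lab b) + sum (f (insert b F)) (lab ` F - {lab b})"
        using True insert.hyps by (simp add: sum.remove)
      also have "sum (f (insert b F)) (lab ` F - {lab b}) = sum (f F) (lab ` F - {lab b})"
        by (intro sum.cong) (auto simp: other)
      also have "f (insert b F) (lab b) + \<dots> = sum (f F) (lab ` F) + (s b - s (Max F))"
        using True insert.hyps fb by (simp add: sum.remove)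
      finally show ?thesis using IH by simp
    next
      case notin: False
      have eq: "{x \<in> insert b F. lab x = lab b} = {b}" using notin by (auto simp: image_iff)
      have "sum (f (insert b F)) (lab ` insert b F) = f (insert b F) (lab b) + sum (f (insert b F)) (lab ` F)"
        using notin insert.hyps by simp
      also have "sum (f (insert b F)) (lab ` F) = sum (f F) (lab ` F)"
        using notin by (intro sum.cong refl other) (auto simp: image_iff)
      also have "f (insert b F) (lab b) = 0" using eq by (simp add: f_def)
      finally show ?thesis using IH sb by simp
    qed
    then show ?thesis unfolding f_def Max_ins Min_ins .
  qed
qed

text \<open>
  Local counts of the form \<open>A\<close> plus an increment of \<open>s\<close> telescope. This serves twice below: with the strips of a grid as
  classes, and with the parts of an arc in the various bands and sectors of the sphere.
\<close>

lemma card_le_labels_plus_oscillation: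
  fixes F :: "'a::linorder set" and lab :: "'a \<Rightarrow> int" and s :: "'a \<Rightarrow> real"
  assumes F: "finite F" "F \<noteq> {}" and mono: "mono_on F lab" "mono_on F s"
    and "A \<ge> 0"
    and cls: "\<And>G. G \<subseteq> F \<Longrightarrow> G \<noteq> {} \<Longrightarrow> (\<And>x y. x \<in> G \<Longrightarrow> y \<in> G \<Longrightarrow> lab x = lab y) \<Longrightarrow>
                 real (card G) \<le> A + (s (Max G) - s (Min G))"
  shows "real (card F) \<le> A * (of_int (lab (Max F) - lab (Min F)) + 1) + (s (Max F) - s (Min F))"
proof -
  define G where "G = (\<lambda>k. {x\<in>F. lab x = k})"
  have MF: "Max F \<in> F" "Min F \<in> F" using F by auto
  have "lab ` F \<subseteq> {lab (Min F)..lab (Max F)}"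
  proof
    fix k assume "k \<in> lab ` F"
    then obtain x where x: "x \<in> F" "k = lab x" by auto
    then have "Min F \<le> x" "x \<le> Max F" using F by auto
    then show "k \<in> {lab (Min F)..lab (Max F)}"
      using mono_onD[OF mono(1)] x MF by auto
  qed
  moreover have "lab (Min F) \<le> lab (Max F)"
    using mono_onD[OF mono(1)] MF F by auto
  ultimately have cl: "real (card (lab ` F)) \<le> of_int (lab (Max F) - lab (Min F)) + 1"
    using card_mono[of "{lab (Min F)..lab (Max F)}" "lab ` F"] by simp
  have "F = (\<Union>k\<in>lab ` F. G k)" by (auto simp: G_def)
  then have "card F = card (\<Union>k\<in>lab ` F. G k)" by simp
  also have "\<dots> = (\<Sum>k\<in>lab ` F. card (G k))"
    using F by (intro card_UN_disjoint) (auto simp: G_def)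
  finally have "real (card F) = (\<Sum>k\<in>lab ` F. real (card (G k)))" by simp
  also have "\<dots> \<le> (\<Sum>k\<in>lab ` F. A + (s (Max (G k)) - s (Min (G k))))"
    by (intro sum_mono cls) (auto simp: G_def)
  also have "\<dots> = A * real (card (lab ` F)) + (\<Sum>k\<in>lab ` F. s (Max (G k)) - s (Min (G k)))"
    by (simp add: sum.distrib)
  also have "\<dots> \<le> A * (of_int (lab (Max F) - lab (Min F)) + 1) + (s (Max F) - s (Min F))"
    using sum_oscillation_le[OF F mono] cl \<open>A \<ge> 0\<close>
    by (intro add_mono mult_left_mono) (auto simp: G_def)
  finally show ?thesis .
qed

text \<open>
  Unit strips in the monotone coordinate \<open>P\<close> are the classes. Within a strip \<open>P\<close> varies by less than 1, so \<open>Q\<close>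
  varies by less than 1 (and meets two unit intervals at most) or by no more than \<open>s\<close> does.
\<close>

lemma card_cells_of_chain_le:
  fixes F :: "real set" and P Q s :: "real \<Rightarrow> real"
  assumes F: "finite F" "F \<noteq> {}"
    and mono: "mono_on F P" "mono_on F s"
    and Q_ge: "\<And>x y. x \<in> F \<Longrightarrow> y \<in> F \<Longrightarrow> x \<le> y \<Longrightarrow> Q y - Q x \<ge> - (P y - P x)"
    and Q_le: "\<And>x y. x \<in> F \<Longrightarrow> y \<in> F \<Longrightarrow> x \<le> y \<Longrightarrow> Q y - Q x \<le> max (P y - P x) (s y - s x)"
    and inj: "inj_on (\<lambda>x. (\<lfloor>P x\<rfloor>, \<lfloor>Q x\<rfloor>)) F"
  shows "real (card F) \<le> 2 * (P (Max F) - P (Min F)) + (s (Max F) - s (Min F)) + 4"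
proof -
  have MF: "Max F \<in> F" "Min F \<in> F" using F by auto
  have Pm: "mono_on F (\<lambda>x. \<lfloor>P x\<rfloor>)" using mono(1) by (auto simp: mono_on_def intro: floor_mono)
  have "real (card F) \<le> 2 * (of_int (\<lfloor>P (Max F)\<rfloor> - \<lfloor>P (Min F)\<rfloor>) + 1) + (s (Max F) - s (Min F))"
  proof (rule card_le_labels_plus_oscillation[OF F Pm mono(2)])
    show "0 \<le> (2::real)" by simp
    fix G assume G: "G \<subseteq> F" "G \<noteq> {}" "\<And>x y. x \<in> G \<Longrightarrow> y \<in> G \<Longrightarrow> \<lfloor>P x\<rfloor> = \<lfloor>P y\<rfloor>"
    have fin: "finite G" using G(1) F(1) by (rule finite_subset)
    have injG: "inj_on (\<lambda>x. \<lfloor>Q x\<rfloor>) G"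
    proof (rule inj_onI)
      fix x y assume xy: "x \<in> G" "y \<in> G" "\<lfloor>Q x\<rfloor> = \<lfloor>Q y\<rfloor>"
      then have "\<lfloor>P x\<rfloor> = \<lfloor>P y\<rfloor>" using G(3) by blast
      moreover have "x \<in> F" "y \<in> F" using xy G(1) by auto
      ultimately show "x = y" using inj_onD[OF inj, of x y] xy(3) by simp
    qed
    define D where "D = s (Max G) - s (Min G)"
    have D: "s y - s x \<le> D" if "x \<in> G" "y \<in> G" for x y
    proof -
      have "Max G \<in> G" "Min G \<in> G" using fin G by auto
      then have "s y \<le> s (Max G)" "s (Min G) \<le> s x"
        using that mono_onD[OF mono(2)] G(1) fin by (auto simp: subset_iff)
      then show ?thesis by (simp add: D_def)
    qed
    have D0: "D \<ge> 0" using D G by fastforce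
    have Pd: "\<bar>P y - P x\<bar> < 1" if "x \<in> G" "y \<in> G" for x y
      using G(3)[OF that] by linarith
    have osc: "Q y - Q x < 1 \<or> Q y - Q x \<le> D" if xy: "x \<in> G" "y \<in> G" for x y
    proof (cases "x \<le> y")
      case True
      then show ?thesis using Q_le[of x y] Pd[OF xy] D[OF xy] xy G by force
    next
      case False
      then show ?thesis using Q_ge[of y x] Pd[OF xy] xy G by force
    qed
    define I where "I = (\<lambda>x. \<lfloor>Q x\<rfloor>) ` G"
    have I: "finite I" "I \<noteq> {}" using fin G by (auto simp: I_def)
    obtain x y where xy: "x \<in> G" "y \<in> G" "Min I = \<lfloor>Q x\<rfloor>" "Max I = \<lfloor>Q y\<rfloor>"
      using Min_in[OF I] Max_in[OF I] unfolding I_def by blast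
    have "I \<subseteq> {Min I..Max I}" using I by auto
    then have "card I \<le> nat (Max I - Min I + 1)"
      using card_mono[of "{Min I..Max I}" I] by simp
    then have cI: "card G \<le> nat (Max I - Min I + 1)"
      using injG by (simp add: I_def card_image)
    have "Min I \<le> Max I" using I by simp
    have "real (card G) \<le> real_of_int (Max I - Min I + 1)"
      using cI \<open>Min I \<le> Max I\<close> by linarith
    also have "\<dots> \<le> 2 + D"
      using osc[OF xy(1,2)]
    proof
      assume "Q y - Q x < 1"
      then have "\<lfloor>Q y\<rfloor> - \<lfloor>Q x\<rfloor> < 2" by linarith
      then show ?thesis using D0 xy by linarith
    next
      assume "Q y - Q x \<le> D"
      then show ?thesis using xy by linarith
    qed
    finally show "real (card G) \<le> 2 + (s (Max G) - s (Min G))" by (simp add: D_def)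
  qed
  moreover have "of_int (\<lfloor>P (Max F)\<rfloor> - \<lfloor>P (Min F)\<rfloor>) \<le> P (Max F) - P (Min F) + 1"
    by linarith
  ultimately show ?thesis by argo
qed

section \<open>Monotone arcs in the HEALPix plane\<close>

text \<open>
  In the plane, the quarter of a parallel of latitude at ordinate \<open>y\<close> that belongs to one sector is a segment of this length.
\<close>

definition shrink :: "real \<Rightarrow> real" where
  "shrink y = min 1 (2 * (1 - \<bar>y\<bar>))"

text \<open>
  The planar abscissa of the point with ordinate \<open>y\<close> and longitude \<open>pi/2 * h\<close>. The longitude is not
  reduced modulo a full turn, so that an arc stays monotone when it winds around the axis.
\<close>

definition fold_lon :: "real \<Rightarrow> real \<Rightarrow> real" where
  "fold_lon y h = of_int \<lfloor>h\<rfloor> + 1/2 + shrink y * (h - (of_int \<lfloor>h\<rfloor> + 1/2))"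

lemma shrink_equator: "\<bar>y\<bar> \<le> 1/2 \<Longrightarrow> shrink y = 1"
  by (simp add: shrink_def)

lemma shrink_polar: "\<bar>y\<bar> \<ge> 1/2 \<Longrightarrow> shrink y = 2 * (1 - \<bar>y\<bar>)"
  by (simp add: shrink_def)

lemma fold_lon_equator: "\<bar>y\<bar> \<le> 1/2 \<Longrightarrow> fold_lon y h = h"
  by (simp add: fold_lon_def shrink_equator)

lemma fold_lon_minus:
  assumes "\<bar>y\<bar> > 1/2 \<Longrightarrow> h \<notin> \<int>"
  shows "fold_lon y (- h) = - fold_lon y h"
proof (cases "\<bar>y\<bar> \<le> 1/2")
  case False
  then have "h \<notin> \<int>" using assms by simp
  then have "\<lfloor>- h\<rfloor> = - \<lfloor>h\<rfloor> - 1"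
    using ceiling_altdef[of h] by (simp add: floor_minus) (metis Ints_of_int)
  then have "fold_lon y (- h) = - of_int \<lfloor>h\<rfloor> - 1/2 + shrink y * (- (h - (of_int \<lfloor>h\<rfloor> + 1/2)))"
    unfolding fold_lon_def by simp
  then show ?thesis unfolding fold_lon_def by (simp only: mult_minus_right)
qed (simp add: fold_lon_equator)

text \<open>
  The price, in visited pixels, of moving in latitude: slope 2 in the equatorial band and slope 6 in the
  polar caps.
\<close>

definition lat_weight :: "real \<Rightarrow> real" where
  "lat_weight y = 6 * y - 4 * max (- (1/2)) (min (1/2) y)"

lemma mono_lat_weight: "mono lat_weight"
  by (auto simp: mono_def lat_weight_def max_def min_def)

definition band :: "real \<Rightarrow> int" where
  "band y = (if y < - (1/2) then 0 else if y \<le> 1/2 then 1 else 2)"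

lemma mono_band: "mono band"
  by (auto simp: mono_def band_def)

text \<open>
  In a polar triangle a step that increases ordinate and longitude also increases the grid coordinate \<open>y + x\<close>;
  the contraction of the parallels shifts the abscissa by at most the change of the ordinate.
\<close>

lemma polar_step:
  fixes x y t u k :: real
  assumes "\<bar>x\<bar> \<le> 1" "\<bar>y\<bar> \<le> 1" "1/2 \<le> \<bar>x\<bar>" "1/2 \<le> \<bar>y\<bar>" "0 < x \<longleftrightarrow> 0 < y" "x \<le> y"
    "t \<le> u" "\<bar>t\<bar> \<le> 1/2" "\<bar>u\<bar> \<le> 1/2"
  defines "D \<equiv> (y + shrink y * u) - (x + shrink x * t)"
  shows "0 \<le> D" "D \<le> 2 * (y - x) + (u - t)"
proof -
  have "0 \<le> D \<and> D \<le> 2 * (y - x) + (u - t)"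
  proof (cases "0 < y")
    case True
    then have D: "D = (y - x) * (1 - 2 * t) + 2 * (1 - y) * (u - t)"
      using assms(1-6) by (simp add: D_def shrink_polar) (simp add: algebra_simps)
    have "0 \<le> 1 - 2 * t" "1 - 2 * t \<le> 2" "0 \<le> y - x" using assms by auto
    then have "0 \<le> (y - x) * (1 - 2 * t)" and "(y - x) * (1 - 2 * t) \<le> (y - x) * 2"
      using mult_nonneg_nonneg mult_left_mono by blast+
    moreover have "0 \<le> 2 * (1 - y) * (u - t)" "2 * (1 - y) * (u - t) \<le> 1 * (u - t)"
    proof -
      have "0 \<le> 2 * (1 - y)" "2 * (1 - y) \<le> 1" "0 \<le> u - t" using assms True by auto
      then show "0 \<le> 2 * (1 - y) * (u - t)" "2 * (1 - y) * (u - t) \<le> 1 * (u - t)"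
        using mult_nonneg_nonneg mult_right_mono by blast+
    qed
    ultimately have "0 \<le> D" "D \<le> (y - x) * 2 + 1 * (u - t)"
      unfolding D by (auto intro: add_mono add_nonneg_nonneg simp del: mult_1)
    then show ?thesis by simp
  next
    case False
    then have D: "D = (y - x) * (1 + 2 * t) + 2 * (1 + y) * (u - t)"
      using assms(1-6) by (simp add: D_def shrink_polar) (simp add: algebra_simps)
    have "0 \<le> 1 + 2 * t" "1 + 2 * t \<le> 2" "0 \<le> y - x" using assms by auto
    then have "0 \<le> (y - x) * (1 + 2 * t)" and "(y - x) * (1 + 2 * t) \<le> (y - x) * 2"
      using mult_nonneg_nonneg mult_left_mono by blast+
    moreover have "0 \<le> 2 * (1 + y) * (u - t)" "2 * (1 + y) * (u - t) \<le> 1 * (u - t)"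
    proof -
      have "0 \<le> 2 * (1 + y)" "2 * (1 + y) \<le> 1" "0 \<le> u - t" using assms False by auto
      then show "0 \<le> 2 * (1 + y) * (u - t)" "2 * (1 + y) * (u - t) \<le> 1 * (u - t)"
        using mult_nonneg_nonneg mult_right_mono by blast+
    qed
    ultimately have "0 \<le> D" "D \<le> (y - x) * 2 + 1 * (u - t)"
      unfolding D by (auto intro: add_mono add_nonneg_nonneg simp del: mult_1)
    then show ?thesis by simp
  qed
  then show "0 \<le> D" "D \<le> 2 * (y - x) + (u - t)" by auto
qed

text \<open>
  In the equatorial band the two grid coordinates satisfy \<open>\<bar>Q y - Q x\<bar> \<le> P y - P x\<close>, since abscissa and ordinate both
  increase. In a polar triangle only \<open>P + Q\<close>, a multiple of the ordinate, is known to increase, and the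
  variation of the ordinate takes the place of the missing bound.
\<close>

lemma card_cells_one_band:
  fixes F :: "real set" and h :: "real \<Rightarrow> real" and n :: nat
  assumes F: "finite F" "F \<noteq> {}" "F \<subseteq> {-1..1}" and h: "mono_on F h"
    and band: "\<And>x y. x \<in> F \<Longrightarrow> y \<in> F \<Longrightarrow> band x = band y"
    and sector: "\<And>x y. x \<in> F \<Longrightarrow> y \<in> F \<Longrightarrow> \<lfloor>h x\<rfloor> = \<lfloor>h y\<rfloor>"
    and inj: "inj_on (\<lambda>y. (\<lfloor>n * (y + fold_lon y (h y) + 1/2)\<rfloor>, \<lfloor>n * (y - fold_lon y (h y) + 1/2)\<rfloor>)) F"
  defines "S \<equiv> \<lambda>y. n * (2 * h y + lat_weight y)"
  shows "real (card F) \<le> 4 + (S (Max F) - S (Min F))"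
proof -
  define P where "P = (\<lambda>y. n * (y + fold_lon y (h y) + 1/2))"
  define Q where "Q = (\<lambda>y. n * (y - fold_lon y (h y) + 1/2))"
  have MF: "Max F \<in> F" "Min F \<in> F" "Min F \<le> Max F" using F by auto
  have Q: "Q y - Q x = real n * (2 * (y - x)) - (P y - P x)" for x y
    by (simp add: P_def Q_def algebra_simps)
  have injPQ: "inj_on (\<lambda>x. (\<lfloor>P x\<rfloor>, \<lfloor>Q x\<rfloor>)) F"
    using inj by (simp add: P_def Q_def)
  have hm: "h x \<le> h y" if "x \<in> F" "y \<in> F" "x \<le> y" for x y
    using mono_onD[OF h] that by auto
  show ?thesis
  proof (cases "band (Max F) = 1")
    case True
    have eq: "\<bar>y\<bar> \<le> 1/2" if "y \<in> F" for y
      using band[OF that MF(1)] True by (auto simp: band_def split: if_splits)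
    have P: "P y - P x = n * ((y - x) + (h y - h x))" if "x \<in> F" "y \<in> F" for x y
      using eq[OF that(1)] eq[OF that(2)] by (simp add: P_def fold_lon_equator algebra_simps)
    have nn: "0 \<le> real n * (y - x)" "0 \<le> real n * (h y - h x)" if "x \<in> F" "y \<in> F" "x \<le> y" for x y
      using hm[OF that] that by simp_all
    have "real (card F) \<le> 2 * (P (Max F) - P (Min F)) + ((\<lambda>_. 0) (Max F) - (\<lambda>_. 0) (Min F)) + 4"
    proof (rule card_cells_of_chain_le[OF F(1,2) _ _ _ _ injPQ])
      show "mono_on F P"
      proof (rule mono_onI)
        fix x y assume xy: "x \<in> F" "y \<in> F" "x \<le> y"
        show "P x \<le> P y" using P[OF xy(1,2)] nn[OF xy] by (simp add: distrib_left)
      qed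
      show "mono_on F (\<lambda>_. 0::real)" by (simp add: mono_on_def)
      fix x y assume xy: "x \<in> F" "y \<in> F" "x \<le> y"
      show "Q y - Q x \<ge> - (P y - P x)" using Q[of y x] nn[OF xy] by (simp add: algebra_simps)
      have "Q y - Q x = n * (y - x) - n * (h y - h x)"
        using Q[of y x] P[OF xy(1,2)] by (simp add: algebra_simps)
      then show "Q y - Q x \<le> max (P y - P x) (0 - 0)"
        using P[OF xy(1,2)] nn[OF xy] by (simp add: distrib_left)
    qed
    moreover have "lat_weight y = 2 * y" if "y \<in> F" for y
      using eq[OF that] by (simp add: lat_weight_def)
    then have "S (Max F) - S (Min F) = 2 * (P (Max F) - P (Min F))"
      using P[OF MF(2,1)] MF by (simp add: S_def algebra_simps)
    ultimately show ?thesis by simp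
  next
    case False
    define k where "k = \<lfloor>h (Max F)\<rfloor>"
    define s where "s = (\<lambda>y. real n * (2 * y))"
    have hk: "\<lfloor>h y\<rfloor> = k" if "y \<in> F" for y
      using sector[OF that MF(1)] by (simp add: k_def)
    define th where "th = (\<lambda>y. h y - (of_int k + 1/2))"
    have th: "\<bar>th y\<bar> \<le> 1/2" if "y \<in> F" for y
      using hk[OF that] unfolding th_def by linarith
    have pol: "1/2 \<le> \<bar>y\<bar>" "\<bar>y\<bar> \<le> 1" "0 < y \<longleftrightarrow> band (Max F) = 2" if "y \<in> F" for y
      using band[OF that MF(1)] False subsetD[OF F(3) that] by (auto simp: band_def split: if_splits)
    have P: "P y - P x = n * ((y + shrink y * th y) - (x + shrink x * th x))"
      if "x \<in> F" "y \<in> F" for x y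
      using hk[OF that(1)] hk[OF that(2)]
      by (simp add: P_def th_def fold_lon_def algebra_simps)
    have step: "0 \<le> P y - P x" "P y - P x \<le> n * (2 * (y - x) + (h y - h x))"
      if xy: "x \<in> F" "y \<in> F" "x \<le> y" for x y
    proof -
      have 1: "th x \<le> th y" using hm[OF xy] by (simp add: th_def)
      have 2: "0 < x \<longleftrightarrow> 0 < y" using pol(3)[OF xy(1)] pol(3)[OF xy(2)] by simp
      note st = polar_step[OF pol(2)[OF xy(1)] pol(2)[OF xy(2)] pol(1)[OF xy(1)] pol(1)[OF xy(2)]
          2 xy(3) 1 th[OF xy(1)] th[OF xy(2)]]
      have "th y - th x = h y - h x" by (simp add: th_def)
      with st show "0 \<le> P y - P x" "P y - P x \<le> n * (2 * (y - x) + (h y - h x))"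
        unfolding P[OF xy(1,2)] by (auto intro!: mult_left_mono)
    qed
    have "real (card F) \<le> 2 * (P (Max F) - P (Min F)) + (s (Max F) - s (Min F)) + 4"
    proof (rule card_cells_of_chain_le[OF F(1,2) _ _ _ _ injPQ])
      show "mono_on F P" using step(1) by (auto simp: mono_on_def)
      show "mono_on F s" unfolding s_def by (intro mono_onI mult_left_mono) auto
      fix x y assume xy: "x \<in> F" "y \<in> F" "x \<le> y"
      show "Q y - Q x \<ge> - (P y - P x)"
        using Q[of y x] mult_left_mono[OF xy(3), of "real n"] by (simp add: algebra_simps)
      show "Q y - Q x \<le> max (P y - P x) (s y - s x)"
        using Q[of y x] step(1)[OF xy] by (simp add: s_def algebra_simps)
    qed
    also have "\<dots> \<le> 2 * (n * (2 * (Max F - Min F) + (h (Max F) - h (Min F)))) + (s (Max F) - s (Min F)) + 4"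
      using step(2)[OF MF(2,1,3)] by simp
    also have "2 * (n * (2 * (Max F - Min F) + (h (Max F) - h (Min F)))) + (s (Max F) - s (Min F)) + 4
        = 4 + (S (Max F) - S (Min F))"
    proof -
      have w: "lat_weight (Max F) - lat_weight (Min F) = 6 * (Max F - Min F)"
        using pol[OF MF(1)] pol[OF MF(2)] by (auto simp: lat_weight_def)
      have "S (Max F) - S (Min F)
          = n * (2 * (h (Max F) - h (Min F)) + (lat_weight (Max F) - lat_weight (Min F)))"
        by (simp add: S_def algebra_simps)
      then show ?thesis unfolding w by (simp add: s_def algebra_simps)
    qed
    finally show ?thesis .
  qed
qed

text \<open>
  The label \<open>band y + \<lfloor>h y\<rfloor>\<close> separates bands and sectors: both summands are monotone along the chain, so their
  sum determines each of them. At most six labels occur, which gives the constant \<open>6 * 4\<close>.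
\<close>

lemma card_cells_monotone_piece:
  fixes F :: "real set" and h :: "real \<Rightarrow> real" and n :: nat
  assumes F: "finite F" "F \<noteq> {}" "F \<subseteq> {-1..1}" and h: "mono_on F h"
    and inj: "inj_on (\<lambda>y. (\<lfloor>n * (y + fold_lon y (h y) + 1/2)\<rfloor>, \<lfloor>n * (y - fold_lon y (h y) + 1/2)\<rfloor>)) F"
    and len: "h (Max F) - h (Min F) \<le> 2"
  defines "S \<equiv> \<lambda>y. n * (2 * h y + lat_weight y)"
  shows "real (card F) \<le> S (Max F) - S (Min F) + 24"
proof -
  define lab where "lab = (\<lambda>y. band y + \<lfloor>h y\<rfloor>)"
  have lab: "mono_on F lab"
  proof (rule mono_onI)
    fix x y assume xy: "x \<in> F" "y \<in> F" "x \<le> y"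
    show "lab x \<le> lab y"
      unfolding lab_def using mono_onD[OF h xy] monoD[OF mono_band xy(3)]
      by (intro add_mono floor_mono)
  qed
  have S: "mono_on F S"
  proof (rule mono_onI)
    fix x y assume xy: "x \<in> F" "y \<in> F" "x \<le> y"
    show "S x \<le> S y"
      unfolding S_def using mono_onD[OF h xy] monoD[OF mono_lat_weight xy(3)]
      by (intro mult_left_mono add_mono) auto
  qed
  have "real (card F) \<le> 4 * (of_int (lab (Max F) - lab (Min F)) + 1) + (S (Max F) - S (Min F))"
  proof (rule card_le_labels_plus_oscillation[OF F(1,2) lab S])
    show "0 \<le> (4::real)" by simp
    fix G assume G: "G \<subseteq> F" "G \<noteq> {}" "\<And>x y. x \<in> G \<Longrightarrow> y \<in> G \<Longrightarrow> lab x = lab y"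
    have both: "band x = band y \<and> \<lfloor>h x\<rfloor> = \<lfloor>h y\<rfloor>" if "x \<in> G" "y \<in> G" "x \<le> y" for x y
    proof -
      have "band x \<le> band y" using monoD[OF mono_band] that by auto
      moreover have "\<lfloor>h x\<rfloor> \<le> \<lfloor>h y\<rfloor>" using mono_onD[OF h] that G(1) by (auto intro!: floor_mono)
      ultimately show ?thesis using G(3)[OF that(1,2)] by (simp add: lab_def)
    qed
    show "real (card G) \<le> 4 + (S (Max G) - S (Min G))"
      unfolding S_def
    proof (rule card_cells_one_band)
      show "finite G" using G(1) F(1) by (rule finite_subset)
      show "mono_on G h" using h G(1) by (rule mono_on_subset)
      show "inj_on (\<lambda>y. (\<lfloor>real n * (y + fold_lon y (h y) + 1/2)\<rfloor>, \<lfloor>real n * (y - fold_lon y (h y) + 1/2)\<rfloor>)) G"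
        using inj G(1) by (rule inj_on_subset)
      show "band x = band y" "\<lfloor>h x\<rfloor> = \<lfloor>h y\<rfloor>" if "x \<in> G" "y \<in> G" for x y
        using both[of x y] both[of y x] that by (metis linear)+
    qed (use G F in auto)
  qed
  moreover have "lab (Max F) - lab (Min F) \<le> 5"
  proof -
    have "band (Max F) \<le> 2" "band (Min F) \<ge> 0" by (auto simp: band_def)
    moreover have "\<lfloor>h (Max F)\<rfloor> - \<lfloor>h (Min F)\<rfloor> \<le> 3" using len by linarith
    ultimately show ?thesis by (simp add: lab_def)
  qed
  then have "real_of_int (lab (Max F) - lab (Min F)) \<le> 5" by linarith
  ultimately show ?thesis by argo
qed

text \<open>
  Reflection \<open>h \<mapsto> - h\<close> exchanges the two grid coordinates. On the seams between polar triangles it does not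
  commute with \<open>fold_lon\<close>, which is why integer values of \<open>h\<close> are excluded there.
\<close>

lemma card_cells_antimonotone_piece:
  fixes F :: "real set" and h :: "real \<Rightarrow> real" and n :: nat
  assumes F: "finite F" "F \<noteq> {}" "F \<subseteq> {-1..1}" and h: "antimono_on F h"
    and int: "\<And>y. y \<in> F \<Longrightarrow> \<bar>y\<bar> > 1/2 \<Longrightarrow> h y \<notin> \<int>"
    and inj: "inj_on (\<lambda>y. (\<lfloor>n * (y + fold_lon y (h y) + 1/2)\<rfloor>, \<lfloor>n * (y - fold_lon y (h y) + 1/2)\<rfloor>)) F"
    and len: "h (Min F) - h (Max F) \<le> 2"
  shows "real (card F) \<le> n * (2 * (h (Min F) - h (Max F)) + (lat_weight (Max F) - lat_weight (Min F))) + 24"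
proof -
  have "inj_on (\<lambda>y. (\<lfloor>n * (y + fold_lon y (- h y) + 1/2)\<rfloor>, \<lfloor>n * (y - fold_lon y (- h y) + 1/2)\<rfloor>)) F"
    using inj int by (auto simp: inj_on_def fold_lon_minus)
  moreover have "mono_on F (\<lambda>y. - h y)" using h by (auto simp: monotone_on_def)
  ultimately have "real (card F) \<le> n * (2 * - h (Max F) + lat_weight (Max F)) - n * (2 * - h (Min F) + lat_weight (Min F)) + 24"
    using F len by (intro card_cells_monotone_piece) auto
  then show ?thesis by (simp add: algebra_simps)
qed

section \<open>The projection on a base square\<close>

text \<open>
  A single formula that shows \<open>healpix_z\<close> to be continuous and strictly increasing across the seams \<open>\<bar>y\<bar> = 1/2\<close>.
\<close>

lemma healpix_z_eq:
  assumes "\<bar>y\<bar> \<le> 1"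
  shows "healpix_z y = 4/3 * (y - (max 0 (y - 1/2))\<^sup>2 + (max 0 (- y - 1/2))\<^sup>2)"
proof -
  consider "\<bar>y\<bar> \<le> 1/2" | "1/2 < y" | "y < - (1/2)" by linarith
  then show ?thesis
  proof cases
    case 1
    then have "max 0 (y - 1/2) = 0" "max 0 (- y - 1/2) = 0" by auto
    then show ?thesis using 1 by (simp add: healpix_z_def)
  next
    case 2
    then have "healpix_z y = 1 - 4/3 * (1 - y)\<^sup>2"
      using assms by (auto simp: healpix_z_def)
    moreover have "max 0 (y - 1/2) = y - 1/2" "max 0 (- y - 1/2) = 0" using 2 by auto
    ultimately show ?thesis by (simp add: power2_eq_square field_simps)
  next
    case 3
    then have "healpix_z y = 4/3 * (1 + y)\<^sup>2 - 1"
      using assms by (auto simp: healpix_z_def)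
    moreover have "max 0 (y - 1/2) = 0" "max 0 (- y - 1/2) = - y - 1/2" using 3 by auto
    ultimately show ?thesis by (simp add: power2_eq_square field_simps)
  qed
qed

lemma healpix_z_strict_mono:
  assumes "-1 \<le> x" "x < y" "y \<le> 1"
  shows "healpix_z x < healpix_z y"
proof -
  define M where "M = (\<lambda>y::real. max 0 (y - 1/2))"
  define L where "L = (\<lambda>y::real. max 0 (- y - 1/2))"
  have b: "0 \<le> M y - M x" "0 \<le> L x - L y" "(M y - M x) + (L x - L y) \<le> y - x"
    using assms by (auto simp: M_def L_def max_def)
  have s: "M y - M x = 0 \<or> M y + M x < 1" "L x - L y = 0 \<or> L y + L x < 1" "M y + M x \<le> 1" "L y + L x \<le> 1"
    using assms by (auto simp: M_def L_def max_def)
  have "(M y - M x) * (M y + M x) + (L x - L y) * (L x + L y) < y - x"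
  proof (cases "M y - M x = 0 \<and> L x - L y = 0")
    case True
    then show ?thesis using assms by simp
  next
    case False
    have "(M y - M x) * (M y + M x) \<le> (M y - M x) * 1" "(L x - L y) * (L x + L y) \<le> (L x - L y) * 1"
      using b(1,2) s(3,4) by (auto intro!: mult_left_mono simp only: add.commute)
    moreover have "(M y - M x) * (M y + M x) < (M y - M x) * 1 \<or> (L x - L y) * (L x + L y) < (L x - L y) * 1"
    proof -
      have "0 < M y - M x \<and> M y + M x < 1 \<or> 0 < L x - L y \<and> L x + L y < 1"
        using False b(1,2) s(1,2) by argo
      then show ?thesis using mult_strict_left_mono by blast
    qed
    ultimately show ?thesis using b(3) by argo
  qed
  then have "x - (M x)\<^sup>2 + (L x)\<^sup>2 < y - (M y)\<^sup>2 + (L y)\<^sup>2"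
    by (simp add: power2_eq_square algebra_simps)
  then show ?thesis using assms by (simp add: healpix_z_eq M_def L_def)
qed

lemma healpix_z_bounds:
  assumes "-1 < y" "y < 1"
  shows "-1 < healpix_z y" "healpix_z y < 1"
proof -
  have "healpix_z (-1) = -1" "healpix_z 1 = 1" by (simp_all add: healpix_z_def)
  then show "-1 < healpix_z y" "healpix_z y < 1"
    using healpix_z_strict_mono[of "-1" y] healpix_z_strict_mono[of y 1] assms by auto
qed

text \<open>
  Longitudes are measured in right angles, as in the plane.
\<close>

definition sphere_point :: "real \<Rightarrow> real \<Rightarrow> real ^ 3" where
  "sphere_point z h = vector [sqrt (1 - z\<^sup>2) * cos (pi/2 * h), sqrt (1 - z\<^sup>2) * sin (pi/2 * h), z]"

definition square_y :: "real \<times> real \<Rightarrow> real \<Rightarrow> real \<Rightarrow> real" where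
  "square_y a p q = snd a + (p + q) / 2"

text \<open>
  The centre line of a base square has longitude \<open>fst a\<close>; the same formula serves squares in the
  equatorial band, where \<open>shrink\<close> is 1.
\<close>

definition square_lon :: "real \<times> real \<Rightarrow> real \<Rightarrow> real \<Rightarrow> real" where
  "square_lon a p q = fst a + (p - q) / (2 * shrink (square_y a p q))"

definition square_point :: "real \<times> real \<Rightarrow> real \<Rightarrow> real \<Rightarrow> real ^ 3" where
  "square_point a p q = sphere_point (healpix_z (square_y a p q)) (square_lon a p q)"

lemma lowest_vertices_cases:
  assumes "a \<in> lowest_vertices"
  obtains k :: nat where "k < 4" "a = (real k + 1/2, 0)"
  | k :: nat where "k < 4" "a = (real k, - 1/2)"
  | k :: nat where "k < 4" "a = (real k + 1/2, - 1)"
  using assms unfolding lowest_vertices_def by blast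

lemma lowest_vertices_sum_diff:
  assumes "a \<in> lowest_vertices"
  obtains A B :: int where "fst a + snd a + 1/2 = of_int A" "snd a - fst a + 1/2 = of_int B"
    "0 \<le> fst a" "fst a < 4"
  using assms
proof (cases rule: lowest_vertices_cases)
  case (1 k) then show ?thesis by (intro that[of "int k + 1" "- int k"]) auto
next
  case (2 k) then show ?thesis by (intro that[of "int k" "- int k"]) auto
next
  case (3 k) then show ?thesis by (intro that[of "int k" "- int k - 1"]) auto
qed

lemma square_y_bounds:
  assumes "a \<in> lowest_vertices" "0 \<le> p" "p < 1" "0 \<le> q" "q < 1"
  shows "-1 \<le> square_y a p q" "square_y a p q < 1"
proof -
  have "-1 \<le> snd a" "snd a \<le> 0" using assms(1) by (cases rule: lowest_vertices_cases; simp)+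
  moreover have "0 \<le> (p + q) / 2" "(p + q) / 2 < 1" using assms(2-) by (simp_all add: field_simps)
  ultimately have "-1 \<le> square_y a p q \<and> square_y a p q < 1"
    unfolding square_y_def by linarith
  then show "-1 \<le> square_y a p q" "square_y a p q < 1" by auto
qed

lemma square_y_gt:
  assumes "a \<in> lowest_vertices" "0 \<le> p" "p < 1" "0 \<le> q" "q < 1" "snd a = -1 \<Longrightarrow> p + q > 0"
  shows "-1 < square_y a p q"
proof -
  have "snd a = -1 \<or> snd a \<ge> - (1/2)" using assms(1) by (cases rule: lowest_vertices_cases) simp_all
  then show ?thesis
  proof
    assume "snd a = -1"
    then show ?thesis unfolding square_y_def using assms(6) by simp
  next
    assume "snd a \<ge> - (1/2)"
    moreover have "0 \<le> (p + q) / 2" using assms(2-5) by simp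
    ultimately show ?thesis unfolding square_y_def by linarith
  qed
qed

text \<open>
  The part of a base square in a polar cap is the triangle of all points whose distance from the centre line
  is at most half a contracted parallel; so it fills exactly one sector.
\<close>

lemma square_polar:
  assumes "a \<in> lowest_vertices" "0 \<le> p" "p < 1" "0 \<le> q" "q < 1" "\<bar>square_y a p q\<bar> > 1/2"
  obtains k :: int where "fst a = of_int k + 1/2" "\<bar>p - q\<bar> \<le> shrink (square_y a p q)"
    "0 < p \<Longrightarrow> 0 < q \<Longrightarrow> \<bar>p - q\<bar> < shrink (square_y a p q)"
  using assms(1)
proof (cases rule: lowest_vertices_cases)
  case (1 k)
  then have "square_y a p q = (p + q) / 2" by (simp add: square_y_def)
  then have "shrink (square_y a p q) = 2 * (1 - (p + q) / 2)"
    using assms(2-) by (simp add: shrink_polar)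
  then have "shrink (square_y a p q) = 2 - p - q" by (simp add: field_simps)
  then show ?thesis using 1 assms(2-) by (intro that[of "int k"]) auto
next
  case (2 k)
  then have "square_y a p q < 1/2" "- (1/2) \<le> square_y a p q" using assms(2-5) by (auto simp: square_y_def)
  then show ?thesis using assms(6) by linarith
next
  case (3 k)
  then have "square_y a p q = (p + q) / 2 - 1" by (simp add: square_y_def)
  moreover from this have "square_y a p q \<le> 0" using assms(2-5) by (simp add: field_simps)
  ultimately have "shrink (square_y a p q) = 2 * (1 - (1 - (p + q) / 2))"
    using assms(6) by (simp add: shrink_polar)
  then have "shrink (square_y a p q) = p + q" by (simp add: field_simps)
  then show ?thesis using 3 assms(2-) by (intro that[of "int k"]) auto
qed

lemma inv_healpix_square:
  assumes a: "a \<in> lowest_vertices" and pq: "0 \<le> p" "p < 1" "0 \<le> q" "q < 1"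
  shows "inv_healpix (((p - q) / 2, (p + q) / 2) + a) = square_point a p q"
proof -
  define x where "x = fst a + (p - q) / 2"
  define y where "y = square_y a p q"
  have xy: "((p - q) / 2, (p + q) / 2) + a = (x, y)"
    by (simp add: x_def y_def square_y_def prod_eq_iff)
  have yb: "-1 \<le> y" "y < 1" using square_y_bounds[OF a pq] by (auto simp: y_def)
  show ?thesis
  proof (cases "y = -1")
    case True
    then show ?thesis
      unfolding xy square_point_def y_def[symmetric]
      by (simp add: inv_healpix_def sphere_point_def healpix_z_def)
  next
    case False
    have "healpix_phi x y = pi/2 * square_lon a p q"
    proof (cases "\<bar>y\<bar> \<le> 1/2")
      case True
      then show ?thesis
        by (simp add: healpix_phi_def square_lon_def y_def[symmetric] shrink_equator x_def)
    next
      case pol: False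
      have "\<bar>square_y a p q\<bar> > 1/2" using pol by (simp add: y_def)
      then obtain k :: int where k: "fst a = of_int k + 1/2" "\<bar>p - q\<bar> \<le> shrink y"
        using square_polar[OF a pq] unfolding y_def by metis
      have sh: "shrink y = 2 * (1 - \<bar>y\<bar>)" using pol by (simp add: shrink_polar)
      then have "\<bar>p - q\<bar> < 1" using k(2) pol by simp
      then have "\<bar>(p - q) / 2\<bar> < 1/2" by simp
      then have fl: "\<lfloor>x\<rfloor> = k" using k(1) unfolding x_def by linarith
      have "\<bar>y\<bar> < 1" using yb False by (simp add: abs_if)
      then have "healpix_phi x y = pi/2 * (fst a + (x - fst a) / shrink y)"
        using pol k(1) by (simp add: healpix_phi_def fl sh Let_def)
      also have "(x - fst a) / shrink y = (p - q) / (2 * shrink y)"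
        by (simp add: x_def)
      finally show ?thesis by (simp add: square_lon_def y_def)
    qed
    then show ?thesis
      unfolding xy square_point_def y_def[symmetric] inv_healpix_def sphere_point_def Let_def
      by (simp only: prod.case)
  qed
qed

text \<open>
  An interior point of a base square recovers its planar abscissa from its longitude, up to a number \<open>m\<close> of full turns.
\<close>

lemma fold_lon_square:
  assumes a: "a \<in> lowest_vertices" and pq: "0 < p" "p < 1" "0 < q" "q < 1"
  shows "fold_lon (square_y a p q) (square_lon a p q + 4 * of_int m) = fst a + (p - q) / 2 + 4 * of_int m"
    and "\<bar>square_y a p q\<bar> > 1/2 \<Longrightarrow> square_lon a p q + 4 * of_int m \<notin> \<int>"
proof -
  define y where "y = square_y a p q"
  define h where "h = square_lon a p q"
  have "fold_lon y (h + 4 * of_int m) = fst a + (p - q) / 2 + 4 * of_int m \<and> (\<bar>y\<bar> > 1/2 \<longrightarrow> h + 4 * of_int m \<notin> \<int>)"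
  proof (cases "\<bar>y\<bar> \<le> 1/2")
    case True
    then show ?thesis
      by (simp add: fold_lon_equator h_def square_lon_def y_def[symmetric] shrink_equator)
  next
    case False
    have "\<bar>square_y a p q\<bar> > 1/2" using False by (simp add: y_def)
    then obtain k :: int where k: "fst a = of_int k + 1/2" "\<bar>p - q\<bar> < shrink y"
      using square_polar[OF a, of p q] pq unfolding y_def by (metis less_imp_le)
    have h: "h = of_int k + 1/2 + (p - q) / (2 * shrink y)"
      using k by (simp add: h_def square_lon_def y_def)
    have sh: "0 < shrink y" using k(2) by linarith
    then have "\<bar>(p - q) / (2 * shrink y)\<bar> < 1/2" using k(2) by (simp add: divide_less_eq)
    then have "of_int (k + 4 * m) < h + 4 * of_int m \<and> h + 4 * of_int m < of_int (k + 4 * m) + 1"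
      unfolding h by linarith
    then have lt: "of_int (k + 4 * m) < h + 4 * of_int m" "h + 4 * of_int m < of_int (k + 4 * m) + 1" by auto
    then have fl: "\<lfloor>h + 4 * of_int m\<rfloor> = k + 4 * m" by (intro floor_unique) auto
    moreover have "h + 4 * of_int m \<notin> \<int>"
    proof
      assume "h + 4 * of_int m \<in> \<int>"
      then have "of_int \<lfloor>h + 4 * of_int m\<rfloor> = h + 4 * of_int m" by (auto elim!: Ints_cases)
      then show False using lt fl by simp
    qed
    ultimately show ?thesis using sh h k(1) by (simp add: fold_lon_def)
  qed
  then show "fold_lon (square_y a p q) (square_lon a p q + 4 * of_int m) = fst a + (p - q) / 2 + 4 * of_int m"
    and "\<bar>square_y a p q\<bar> > 1/2 \<Longrightarrow> square_lon a p q + 4 * of_int m \<notin> \<int>"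
    by (auto simp: y_def h_def)
qed

text \<open>
  In the grid coordinates \<open>y + x + 1/2\<close> and \<open>y - x + 1/2\<close> every base square is a unit square with integer
  corner \<open>(A, B)\<close>. The sum \<open>A + B\<close> gives the row of the square and \<open>A - B\<close> its column, so cells of
  different pixels are different, even after any number of full turns.
\<close>

lemma vertex_eq_if_cells_eq:
  fixes m m' :: int and i j i' j' n :: nat and p q p' q' :: real
  assumes a: "a \<in> lowest_vertices" "a' \<in> lowest_vertices"
    and p: "real i < n * p" "n * p < real i + 1" "i < n" and q: "real j < n * q" "n * q < real j + 1" "j < n"
    and p': "real i' < n * p'" "n * p' < real i' + 1" "i' < n" and q': "real j' < n * q'" "n * q' < real j' + 1" "j' < n"
    and u: "\<lfloor>n * (fst a + snd a + 1/2 + p + 4 * of_int m)\<rfloor> = \<lfloor>n * (fst a' + snd a' + 1/2 + p' + 4 * of_int m')\<rfloor>"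
    and v: "\<lfloor>n * (snd a - fst a + 1/2 + q - 4 * of_int m)\<rfloor> = \<lfloor>n * (snd a' - fst a' + 1/2 + q' - 4 * of_int m')\<rfloor>"
  shows "a = a' \<and> i = i' \<and> j = j' \<and> m = m'"
proof -
  obtain A B where AB: "fst a + snd a + 1/2 = of_int A" "snd a - fst a + 1/2 = of_int B" "0 \<le> fst a" "fst a < 4"
    using lowest_vertices_sum_diff[OF a(1)] .
  obtain A' B' where AB': "fst a' + snd a' + 1/2 = of_int A'" "snd a' - fst a' + 1/2 = of_int B'" "0 \<le> fst a'" "fst a' < 4"
    using lowest_vertices_sum_diff[OF a(2)] .
  have fl: "\<lfloor>real n * (of_int C + r)\<rfloor> = int n * C + int k" if "real k < n * r" "n * r < real k + 1" for C :: int and r :: real and k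
    using that by (intro floor_unique) (auto simp: algebra_simps)
  have div: "C = D \<and> k = l" if "int n * C + int k = int n * D + int l" "k < n" "l < n" for C D :: int and k l
  proof -
    have "C = (int n * C + int k) div int n" "D = (int n * D + int l) div int n" using that(2,3) by simp_all
    then show ?thesis using that by auto
  qed
  have "int n * (A + 4 * m) + int i = int n * (A' + 4 * m') + int i'"
    using u fl[OF p(1,2), of "A + 4 * m"] fl[OF p'(1,2), of "A' + 4 * m'"]
    by (simp add: AB AB' algebra_simps flip: AB(1) AB'(1))
  then have 1: "A + 4 * m = A' + 4 * m'" "i = i'" using div p(3) p'(3) by blast+
  have "int n * (B - 4 * m) + int j = int n * (B' - 4 * m') + int j'"
    using v fl[OF q(1,2), of "B - 4 * m"] fl[OF q'(1,2), of "B' - 4 * m'"]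
    by (simp add: AB AB' algebra_simps flip: AB(2) AB'(2))
  then have 2: "B - 4 * m = B' - 4 * m'" "j = j'" using div q(3) q'(3) by blast+
  have "real_of_int A + 4 * m = real_of_int A' + 4 * m'" "real_of_int B - 4 * m = real_of_int B' - 4 * m'"
    using 1(1) 2(1) by (metis of_int_add of_int_diff of_int_mult of_int_numeral)+
  then have 3: "snd a = snd a'" "fst a - fst a' = 4 * of_int (m' - m)" using AB AB' by (auto simp: algebra_simps)
  then have "real_of_int (m' - m) < 1" "real_of_int (m' - m) > -1" using AB(3,4) AB'(3,4) by auto
  then have "m = m'" by linarith
  then show ?thesis using 1 2 3 by (simp add: prod_eq_iff)
qed

section \<open>Circles on the sphere\<close>

text \<open>
  For \<open>e = w$3\<close> the ratio is the distance of \<open>w\<close> from the polar axis times the cosine of the relative longitude, on the circle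
  \<open>w \<bullet> x = c\<close> at height \<open>z\<close>. Its derivative has the sign of \<open>c * z - e\<close>, which is linear in \<open>z\<close>.
\<close>

lemma latitude_ratio_le:
  fixes c e z z' :: real
  assumes "-1 < z" "z \<le> z'" "z' < 1" "c * z - e \<ge> 0" "c * z' - e \<ge> 0"
  shows "(c - e * z) / sqrt (1 - z\<^sup>2) \<le> (c - e * z') / sqrt (1 - z'\<^sup>2)"
proof (rule DERIV_nonneg_imp_nondecreasing[OF assms(2)])
  fix x assume x: "z \<le> x" "x \<le> z'"
  then have "\<bar>x\<bar> < 1" using assms by (simp add: abs_if)
  then have pos: "1 - x\<^sup>2 > 0" by (simp add: abs_square_less_1)
  have D: "((\<lambda>x. (c - e * x) / sqrt (1 - x\<^sup>2)) has_real_derivative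
      (- e * sqrt (1 - x\<^sup>2) - (c - e * x) * (- x / sqrt (1 - x\<^sup>2))) / (1 - x\<^sup>2)) (at x)"
    using pos by (auto intro!: derivative_eq_intros simp: field_simps)
  have "c * x - e \<ge> 0"
  proof (cases "c \<ge> 0")
    case True
    then have "c * z \<le> c * x" using x by (simp add: mult_left_mono)
    then show ?thesis using assms by linarith
  next
    case False
    then have "c * z' \<le> c * x" using x by (simp add: mult_left_mono_neg)
    then show ?thesis using assms by linarith
  qed
  moreover have "- e * sqrt (1 - x\<^sup>2) - (c - e * x) * (- x / sqrt (1 - x\<^sup>2)) = (c * x - e) / sqrt (1 - x\<^sup>2)"
  proof -
    have "sqrt (1 - x\<^sup>2) = (1 - x\<^sup>2) / sqrt (1 - x\<^sup>2)" using pos by (simp add: real_div_sqrt)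
    then have "- e * sqrt (1 - x\<^sup>2) = - e * (1 - x\<^sup>2) / sqrt (1 - x\<^sup>2)" by (metis times_divide_eq_right)
    then show ?thesis by (simp add: algebra_simps power2_eq_square flip: add_divide_distrib diff_divide_distrib)
  qed
  ultimately have "(- e * sqrt (1 - x\<^sup>2) - (c - e * x) * (- x / sqrt (1 - x\<^sup>2))) / (1 - x\<^sup>2) \<ge> 0"
    using pos by simp
  with D show "\<exists>y. ((\<lambda>x. (c - e * x) / sqrt (1 - x\<^sup>2)) has_real_derivative y) (at x) \<and> 0 \<le> y" by blast
qed

lemma card_cells_piece:
  fixes F :: "real set" and h :: "real \<Rightarrow> real" and n :: nat
  assumes F: "finite F" "F \<noteq> {}" "F \<subseteq> {-1..1}" and h: "mono_on F h \<or> antimono_on F h"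
    and int: "\<And>y. y \<in> F \<Longrightarrow> \<bar>y\<bar> > 1/2 \<Longrightarrow> h y \<notin> \<int>"
    and inj: "inj_on (\<lambda>y. (\<lfloor>n * (y + fold_lon y (h y) + 1/2)\<rfloor>, \<lfloor>n * (y - fold_lon y (h y) + 1/2)\<rfloor>)) F"
    and len: "\<And>x y. x \<in> F \<Longrightarrow> y \<in> F \<Longrightarrow> \<bar>h x - h y\<bar> \<le> d" and d: "d \<le> 2"
  shows "real (card F) \<le> n * (2 * d + (lat_weight (Max F) - lat_weight (Min F))) + 24"
proof -
  have MF: "Max F \<in> F" "Min F \<in> F" using F by auto
  note l = len[OF MF]
  from h show ?thesis
  proof
    assume "mono_on F h"
    then have "real (card F) \<le> n * (2 * h (Max F) + lat_weight (Max F)) - n * (2 * h (Min F) + lat_weight (Min F)) + 24"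
      using F inj l d by (intro card_cells_monotone_piece) auto
    also have "\<dots> = n * (2 * (h (Max F) - h (Min F)) + (lat_weight (Max F) - lat_weight (Min F))) + 24"
      by (simp add: algebra_simps)
    also have "\<dots> \<le> n * (2 * d + (lat_weight (Max F) - lat_weight (Min F))) + 24"
      using l by (intro add_right_mono mult_left_mono) auto
    finally show ?thesis .
  next
    assume "antimono_on F h"
    then have "real (card F) \<le> n * (2 * (h (Min F) - h (Max F)) + (lat_weight (Max F) - lat_weight (Min F))) + 24"
      using F inj int l d by (intro card_cells_antimonotone_piece) auto
    also have "\<dots> \<le> n * (2 * d + (lat_weight (Max F) - lat_weight (Min F))) + 24"
      using l by (intro add_right_mono mult_left_mono) auto
    finally show ?thesis .
  qed
qed

lemma lat_weight_range: "x \<in> {-1..1} \<Longrightarrow> y \<in> {-1..1} \<Longrightarrow> lat_weight x - lat_weight y \<le> 8"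
  using monoD[OF mono_lat_weight, of x 1] monoD[OF mono_lat_weight, of "-1" y]
  by (auto simp: lat_weight_def)

text \<open>
  The cosine \<open>G\<close> of the relative longitude is increasing where \<open>c * z \<ge> e\<close> and decreasing elsewhere, so there are at most
  two monotone pieces. A single piece has longitude variation at most 2, in right angles. If both
  pieces occur, then \<open>\<bar>e\<bar> < \<bar>c\<bar>\<close>, \<open>G\<close> has constant sign and each piece has variation at most 1. Either way the
  total is \<open>n * (2 * 2 + 8)\<close>, as the pieces lie in disjoint ranges of latitude.
\<close>

lemma card_cells_branch:
  fixes F :: "real set" and n :: nat and c e r b :: real
  assumes F: "finite F" "F \<subseteq> {-1<..<1}" and "r > 0" and s: "s = 1 \<or> s = -1"
  defines "G \<equiv> \<lambda>y. (c - e * healpix_z y) / sqrt (1 - (healpix_z y)\<^sup>2) / r"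
  defines "H \<equiv> \<lambda>y. b + s * (2 / pi * arccos (G y))"
  assumes G: "\<And>y. y \<in> F \<Longrightarrow> \<bar>G y\<bar> \<le> 1"
    and int: "\<And>y. y \<in> F \<Longrightarrow> \<bar>y\<bar> > 1/2 \<Longrightarrow> H y \<notin> \<int>"
    and inj: "inj_on (\<lambda>y. (\<lfloor>n * (y + fold_lon y (H y) + 1/2)\<rfloor>, \<lfloor>n * (y - fold_lon y (H y) + 1/2)\<rfloor>)) F"
  shows "real (card F) \<le> 12 * n + 48"
proof -
  \<comment> \<open>the two pieces on which \<open>G\<close> is monotone\<close>
  define F1 where "F1 = {y\<in>F. c * healpix_z y - e \<ge> 0}"
  define F2 where "F2 = {y\<in>F. c * healpix_z y - e < 0}"
  have F12: "F = F1 \<union> F2" "F1 \<inter> F2 = {}" "finite F1" "finite F2" "F1 \<subseteq> F" "F2 \<subseteq> F"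
    using F by (auto simp: F1_def F2_def)
  have cardF: "card F = card F1 + card F2" using F12 card_Un_disjoint by metis
  have z_le: "healpix_z x \<le> healpix_z y" if "x \<in> F" "y \<in> F" "x \<le> y" for x y
    using healpix_z_strict_mono[of x y] that F by (cases "x = y") fastforce+
  have zb: "-1 < healpix_z y" "healpix_z y < 1" if "y \<in> F" for y
    using healpix_z_bounds[of y] that F by auto
  have acos: "\<bar>H x - H y\<bar> = 2/pi * \<bar>arccos (G x) - arccos (G y)\<bar>" for x y
  proof -
    have "H x - H y = s * (2/pi * (arccos (G x) - arccos (G y)))"
      by (simp add: H_def right_diff_distrib)
    then have "\<bar>H x - H y\<bar> = \<bar>s\<bar> * (\<bar>2/pi\<bar> * \<bar>arccos (G x) - arccos (G y)\<bar>)"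
      by (simp only: abs_mult)
    then show ?thesis using s by auto
  qed
  have mono_H: "mono_on S H \<or> antimono_on S H" if S: "S \<subseteq> F" "mono_on S G \<or> antimono_on S G" for S
  proof -
    have arc: "arccos (G y) \<le> arccos (G x)" if "x \<in> S" "y \<in> S" "G x \<le> G y" for x y
      using G[of x] G[of y] that S(1) by (intro arccos_le_arccos) auto
    have step: "(s = 1 \<longrightarrow> H y \<le> H x) \<and> (s = -1 \<longrightarrow> H x \<le> H y)" if "x \<in> S" "y \<in> S" "G x \<le> G y" for x y
    proof -
      have "2 / pi * arccos (G y) \<le> 2 / pi * arccos (G x)"
        using arc[OF that] by (intro mult_left_mono) auto
      then show ?thesis by (simp add: H_def)
    qed
    from S(2) show ?thesis
    proof
      assume m: "mono_on S G"
      have "(s = 1 \<longrightarrow> H y \<le> H x) \<and> (s = -1 \<longrightarrow> H x \<le> H y)" if "x \<in> S" "y \<in> S" "x \<le> y" for x y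
        using step[OF that(1,2) mono_onD[OF m that]] .
      then show ?thesis using s unfolding monotone_on_def by blast
    next
      assume m: "antimono_on S G"
      have "(s = 1 \<longrightarrow> H x \<le> H y) \<and> (s = -1 \<longrightarrow> H y \<le> H x)" if "x \<in> S" "y \<in> S" "x \<le> y" for x y
        using step[OF that(2,1) monotone_onD[OF m that]] .
      then show ?thesis using s unfolding monotone_on_def by blast
    qed
  qed
  have G1: "mono_on F1 G"
  proof (rule mono_onI)
    fix x y assume xy: "x \<in> F1" "y \<in> F1" "x \<le> y"
    have "(c - e * healpix_z x) / sqrt (1 - (healpix_z x)\<^sup>2) \<le> (c - e * healpix_z y) / sqrt (1 - (healpix_z y)\<^sup>2)"
      using xy zb z_le by (intro latitude_ratio_le) (auto simp: F1_def)
    then show "G x \<le> G y" using \<open>r > 0\<close> unfolding G_def by (intro divide_right_mono) auto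
  qed
  have G2: "antimono_on F2 G"
  proof (rule monotone_onI)
    fix x y assume xy: "x \<in> F2" "y \<in> F2" "x \<le> y"
    have "(- c - (- e) * healpix_z x) / sqrt (1 - (healpix_z x)\<^sup>2) \<le> (- c - (- e) * healpix_z y) / sqrt (1 - (healpix_z y)\<^sup>2)"
      using xy zb z_le by (intro latitude_ratio_le) (auto simp: F2_def)
    moreover have "(- c - (- e) * u) / v = - ((c - e * u) / v)" for u v :: real
      by (simp add: minus_divide_left)
    ultimately have "(c - e * healpix_z y) / sqrt (1 - (healpix_z y)\<^sup>2) \<le> (c - e * healpix_z x) / sqrt (1 - (healpix_z x)\<^sup>2)"
      by simp
    then show "G x \<ge> G y" using \<open>r > 0\<close> unfolding G_def by (intro divide_right_mono) auto
  qed
  have piece: "real (card S) \<le> n * (2 * d + (lat_weight (Max S) - lat_weight (Min S))) + 24"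
    if S: "S \<subseteq> F" "S \<noteq> {}" "mono_on S G \<or> antimono_on S G"
      and len: "\<And>x y. x \<in> S \<Longrightarrow> y \<in> S \<Longrightarrow> 2 / pi * \<bar>arccos (G x) - arccos (G y)\<bar> \<le> d" and "d \<le> 2" for S d
  proof (rule card_cells_piece)
    show "finite S" using S(1) F(1) by (rule finite_subset)
    show "S \<subseteq> {-1..1}" using S(1) F(2) by fastforce
    show "mono_on S H \<or> antimono_on S H" using mono_H S by blast
    show "inj_on (\<lambda>y. (\<lfloor>n * (y + fold_lon y (H y) + 1/2)\<rfloor>, \<lfloor>n * (y - fold_lon y (H y) + 1/2)\<rfloor>)) S"
      using inj S(1) by (rule inj_on_subset)
  qed (use S int len acos \<open>d \<le> 2\<close> in auto)
  have range2: "2 / pi * \<bar>arccos (G x) - arccos (G y)\<bar> \<le> 2" if "x \<in> F" "y \<in> F" for x y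
  proof -
    have "\<bar>arccos (G x) - arccos (G y)\<bar> \<le> pi"
      using arccos_bounded[of "G x"] arccos_bounded[of "G y"] G[OF that(1)] G[OF that(2)]
      by (auto simp: abs_le_iff)
    then show ?thesis by (simp add: divide_le_eq)
  qed
  have one: "real (card S) \<le> 12 * n + 24" if S: "S \<subseteq> F" "mono_on S G \<or> antimono_on S G" for S
  proof (cases "S = {}")
    case False
    have fin: "finite S" using S(1) F(1) by (rule finite_subset)
    have M: "Max S \<in> {-1..1}" "Min S \<in> {-1..1}" using Max_in[OF fin False] Min_in[OF fin False] S(1) F(2) by fastforce+
    have "real (card S) \<le> n * (2 * 2 + (lat_weight (Max S) - lat_weight (Min S))) + 24"
      using S False range2 by (intro piece) auto
    also have "\<dots> \<le> real n * (2 * 2 + 8) + 24"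
      using lat_weight_range[OF M] by (intro add_right_mono mult_left_mono) auto
    finally show ?thesis by simp
  qed simp
  show ?thesis
  proof (cases "F1 = {} \<or> F2 = {}")
    case True
    then show ?thesis using one[OF F12(5)] one[OF F12(6)] G1 G2 cardF by auto
  next
    case False
    then obtain y1 y2 where y: "y1 \<in> F1" "y2 \<in> F2" by auto
    have ce: "\<bar>e\<bar> < \<bar>c\<bar>"
    proof -
      have "c * healpix_z y1 \<ge> e" "c * healpix_z y2 < e" using y by (auto simp: F1_def F2_def)
      moreover have "c \<noteq> 0" using calculation by auto
      moreover have "\<bar>c * z\<bar> < \<bar>c\<bar>" if "\<bar>z\<bar> < 1" "c \<noteq> 0" for z :: real
        using that mult_strict_left_mono[of "\<bar>z\<bar>" 1 "\<bar>c\<bar>"] by (simp add: abs_mult)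
      moreover have "\<bar>healpix_z y1\<bar> < 1" "\<bar>healpix_z y2\<bar> < 1"
        using zb[of y1] zb[of y2] y F12(5,6) by (auto simp: abs_if)
      ultimately show ?thesis by (smt (verit))
    qed
    have sgn: "c > 0 \<Longrightarrow> 0 \<le> G y" "c < 0 \<Longrightarrow> G y \<le> 0" if "y \<in> F" for y
    proof -
      have "\<bar>healpix_z y\<bar> \<le> 1" using zb[OF that] by (auto simp: abs_if)
      then have "\<bar>e * healpix_z y\<bar> \<le> \<bar>e\<bar>" using mult_left_mono[of "\<bar>healpix_z y\<bar>" 1 "\<bar>e\<bar>"] by (simp add: abs_mult)
      then have 1: "c > 0 \<Longrightarrow> 0 \<le> c - e * healpix_z y" "c < 0 \<Longrightarrow> c - e * healpix_z y \<le> 0" using ce by auto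
      have 2: "0 \<le> sqrt (1 - (healpix_z y)\<^sup>2)" using zb[OF that] by (simp add: abs_square_le_1 abs_if)
      show "c > 0 \<Longrightarrow> 0 \<le> G y" "c < 0 \<Longrightarrow> G y \<le> 0"
        unfolding G_def using 1 2 \<open>r > 0\<close> by (auto intro!: divide_nonneg_nonneg divide_nonpos_nonneg)
    qed
    have c0: "c \<noteq> 0" using ce by auto
    have half: "2 / pi * \<bar>arccos (G x) - arccos (G y)\<bar> \<le> 1" if xy: "x \<in> F" "y \<in> F" for x y
    proof -
      have Gb: "-1 \<le> G x" "G x \<le> 1" "-1 \<le> G y" "G y \<le> 1" using G xy by (auto simp: abs_le_iff)
      have "\<bar>arccos (G x) - arccos (G y)\<bar> \<le> pi/2"
      proof (cases "c > 0")
        case True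
        then have "arccos (G x) \<le> arccos 0" "arccos (G y) \<le> arccos 0"
          using arccos_le_arccos[of 0 "G x"] arccos_le_arccos[of 0 "G y"] sgn xy Gb by simp_all
        then show ?thesis using arccos_bounded[OF Gb(1,2)] arccos_bounded[OF Gb(3,4)] arccos_0 by linarith
      next
        case False
        then have "arccos 0 \<le> arccos (G x)" "arccos 0 \<le> arccos (G y)"
          using arccos_le_arccos[of "G x" 0] arccos_le_arccos[of "G y" 0] sgn xy Gb c0 by simp_all
        then show ?thesis using arccos_bounded[OF Gb(1,2)] arccos_bounded[OF Gb(3,4)] arccos_0 by linarith
      qed
      then show ?thesis by (simp add: divide_le_eq)
    qed
    have MM: "Max F1 \<in> F1" "Min F1 \<in> F1" "Max F2 \<in> F2" "Min F2 \<in> F2"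
      using False F12(3,4) by auto
    have MI: "x \<in> F \<Longrightarrow> x \<in> {-1..1}" for x using F(2) by auto
    have z_lt: "x < y" if "healpix_z x < healpix_z y" "x \<in> F" "y \<in> F" for x y
      using that z_le[of y x] by force
    have W: "(lat_weight (Max F1) - lat_weight (Min F1)) + (lat_weight (Max F2) - lat_weight (Min F2)) \<le> 8"
    proof (cases "c > 0")
      case True
      have "c * healpix_z (Max F2) < c * healpix_z (Min F1)" using MM by (auto simp: F1_def F2_def)
      then have "healpix_z (Max F2) < healpix_z (Min F1)" using True by simp
      then have "Max F2 < Min F1" using z_lt MM F12(5,6) by blast
      then have "lat_weight (Max F2) \<le> lat_weight (Min F1)" using monoD[OF mono_lat_weight] by simp
      moreover have "lat_weight (Max F1) - lat_weight (Min F2) \<le> 8"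
        using MM F12(5,6) MI by (intro lat_weight_range) blast+
      ultimately show ?thesis by linarith
    next
      case False
      have "c * healpix_z (Min F2) < c * healpix_z (Max F1)" using MM by (auto simp: F1_def F2_def)
      then have "healpix_z (Max F1) < healpix_z (Min F2)" using False c0 by (simp add: mult_less_cancel_left)
      then have "Max F1 < Min F2" using z_lt MM F12(5,6) by blast
      then have "lat_weight (Max F1) \<le> lat_weight (Min F2)" using monoD[OF mono_lat_weight] by simp
      moreover have "lat_weight (Max F2) - lat_weight (Min F1) \<le> 8"
        using MM F12(5,6) MI by (intro lat_weight_range) blast+
      ultimately show ?thesis by linarith
    qed
    have "real (card F1) \<le> n * (2 * 1 + (lat_weight (Max F1) - lat_weight (Min F1))) + 24"
      using False F12(5) G1 half by (intro piece) auto
    moreover have "real (card F2) \<le> n * (2 * 1 + (lat_weight (Max F2) - lat_weight (Min F2))) + 24"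
      using False F12(6) G2 half by (intro piece) auto
    moreover have "real n * ((lat_weight (Max F1) - lat_weight (Min F1)) + (lat_weight (Max F2) - lat_weight (Min F2))) \<le> real n * 8"
      using W by (intro mult_left_mono) auto
    ultimately show ?thesis using cardF by (simp add: algebra_simps)
  qed
qed

section \<open>Pixels met by a circle\<close>

text \<open>
  A pixel is given by the lowest vertex of its base square and the two indices of its cell in the grid of mesh
  \<open>1 / n\<close> on that square.
\<close>

definition pixels :: "nat \<Rightarrow> ((real \<times> real) \<times> nat \<times> nat) set" where
  "pixels n = lowest_vertices \<times> {..<n} \<times> {..<n}"

lemma finite_lowest_vertices: "finite lowest_vertices"
  by (simp add: lowest_vertices_def)

lemma finite_pixels: "finite (pixels n)"
  by (simp add: pixels_def finite_lowest_vertices)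

lemma card_lowest_vertices: "card lowest_vertices = 12"
proof -
  define f :: "nat \<times> real \<times> real \<Rightarrow> real \<times> real" where "f = (\<lambda>(k, v). (real k + fst v, snd v))"
  define D where "D = {..<4::nat} \<times> {(1/2::real, 0::real), (0, - 1/2), (1/2, - 1)}"
  have "lowest_vertices = f ` D"
  proof (intro equalityI subsetI)
    fix x assume "x \<in> lowest_vertices"
    then obtain k where k: "k < 4" "x = (real k + 1/2, 0) \<or> x = (real k, - 1/2) \<or> x = (real k + 1/2, - 1)"
      unfolding lowest_vertices_def by blast
    then have "x = f (k, (1/2, 0)) \<or> x = f (k, (0, - 1/2)) \<or> x = f (k, (1/2, - 1))" by (simp add: f_def)
    with k(1) show "x \<in> f ` D" unfolding D_def by blast
  next
    fix x assume "x \<in> f ` D"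
    then obtain k v where "k < 4" "v \<in> {(1/2::real, 0::real), (0, - 1/2), (1/2, - 1)}" "x = f (k, v)"
      unfolding D_def by blast
    then show "x \<in> lowest_vertices" unfolding lowest_vertices_def f_def by auto
  qed
  moreover have "inj_on f D"
    unfolding D_def f_def by (rule inj_onI) auto
  ultimately have "card lowest_vertices = card D" by (metis card_image)
  also have "card D = 12" unfolding D_def card_cartesian_product by simp
  finally show ?thesis .
qed

lemma card_pixels: "card (pixels n) = 12 * n\<^sup>2"
  by (simp add: pixels_def card_cartesian_product card_lowest_vertices power2_eq_square)

definition in_open_cell :: "nat \<Rightarrow> nat \<Rightarrow> nat \<Rightarrow> real \<Rightarrow> real \<Rightarrow> bool" where
  "in_open_cell n i j p q \<longleftrightarrow> real i < n * p \<and> n * p < real i + 1 \<and> real j < n * q \<and> n * q < real j + 1"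

definition in_cell :: "nat \<Rightarrow> nat \<Rightarrow> nat \<Rightarrow> real \<Rightarrow> real \<Rightarrow> bool" where
  "in_cell n i j p q \<longleftrightarrow> real i \<le> n * p \<and> n * p < real i + 1 \<and> real j \<le> n * q \<and> n * q < real j + 1"

lemma in_cell_bounds:
  assumes "in_cell n i j p q" "i < n" "j < n"
  shows "0 \<le> p" "p < 1" "0 \<le> q" "q < 1"
proof -
  have n: "real n > 0" using assms by simp
  have "real i + 1 \<le> n" "real j + 1 \<le> n" using assms by auto
  then have "real n * 0 \<le> n * p \<and> real n * p < n * (1::real) \<and> real n * 0 \<le> n * q \<and> real n * q < n * (1::real)"
    using assms(1) unfolding in_cell_def mult_1_right mult_zero_right by linarith
  then show "0 \<le> p" "p < 1" "0 \<le> q" "q < 1"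
    using n by (simp_all only: mult_less_cancel_left_pos mult_le_cancel_left_pos)
qed

lemma in_cell_if_in_open_cell: "in_open_cell n i j p q \<Longrightarrow> in_cell n i j p q"
  by (simp add: in_cell_def in_open_cell_def)

lemma in_open_cell_bounds:
  assumes "in_open_cell n i j p q" "i < n" "j < n"
  shows "0 < p" "p < 1" "0 < q" "q < 1"
proof -
  have n: "real n > 0" using assms by simp
  have "real i + 1 \<le> n" "real j + 1 \<le> n" using assms by auto
  then have "real n * 0 < n * p \<and> real n * p < n * (1::real) \<and> real n * 0 < n * q \<and> real n * q < n * (1::real)"
    using assms(1) unfolding in_open_cell_def mult_1_right mult_zero_right by linarith
  then show "0 < p" "p < 1" "0 < q" "q < 1" using n by (simp_all only: mult_less_cancel_left_pos)
qed

lemma square_coords_inj: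
  fixes m m' :: int
  assumes a: "a \<in> lowest_vertices" "a' \<in> lowest_vertices"
    and c: "in_open_cell n i j p q" "i < n" "j < n" and c': "in_open_cell n i' j' p' q'" "i' < n" "j' < n"
    and y: "square_y a p q = square_y a' p' q'"
    and h: "square_lon a p q + 4 * of_int m = square_lon a' p' q' + 4 * of_int m'"
  shows "a = a' \<and> i = i' \<and> j = j' \<and> p = p' \<and> q = q'"
proof -
  note bd = in_open_cell_bounds[OF c] and bd' = in_open_cell_bounds[OF c']
  have x: "fst a + (p - q) / 2 + 4 * of_int m = fst a' + (p' - q') / 2 + 4 * of_int m'"
    using fold_lon_square(1)[OF a(1) bd] fold_lon_square(1)[OF a(2) bd'] y h by metis
  have u: "fst a + snd a + 1/2 + p + 4 * of_int m = fst a' + snd a' + 1/2 + p' + 4 * of_int m'"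
    using x y by (simp add: square_y_def field_simps)
  have v: "snd a - fst a + 1/2 + q - 4 * of_int m = snd a' - fst a' + 1/2 + q' - 4 * of_int m'"
    using x y by (simp add: square_y_def field_simps)
  have "a = a' \<and> i = i' \<and> j = j' \<and> m = m'"
    using c c' arg_cong[OF u, of "\<lambda>x. \<lfloor>n * x\<rfloor>"] arg_cong[OF v, of "\<lambda>x. \<lfloor>n * x\<rfloor>"]
    unfolding in_open_cell_def by (intro vertex_eq_if_cells_eq[OF a]) blast+
  then show ?thesis using u v by auto
qed

lemma inner_sphere_point:
  "w \<bullet> sphere_point z h = sqrt (1 - z\<^sup>2) * (w$1 * cos (pi/2 * h) + w$2 * sin (pi/2 * h)) + w$3 * z"
  by (simp add: sphere_point_def inner_vec_def sum_3 algebra_simps)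

text \<open>
  Solving \<open>w \<bullet> x = c\<close> for the longitude gives two branches, up to full turns. A pixel meeting the circle is
  assigned to a branch through one of its points on it, and on a fixed branch the latitude determines the point.
\<close>

lemma card_pixels_meeting_circle:
  fixes w :: "real^3" and c :: real and n :: nat
  assumes w: "w$1 \<noteq> 0" and R: "R \<subseteq> pixels n"
    and zero: "\<And>a i j. (a, i, j) \<in> R \<Longrightarrow> \<exists>p q. in_open_cell n i j p q \<and> w \<bullet> square_point a p q = c"
  shows "real (card R) \<le> 24 * n + 96"
proof -
  define r where "r = sqrt ((w$1)\<^sup>2 + (w$2)\<^sup>2)"
  have r: "r > 0" "r\<^sup>2 = (w$1)\<^sup>2 + (w$2)\<^sup>2" using w by (auto simp: r_def add_pos_nonneg)
  have "(w$1 / r)\<^sup>2 + (w$2 / r)\<^sup>2 = 1" unfolding power_divide add_divide_distrib[symmetric] r(2)[symmetric] using r(1) by simp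
  then obtain t where t: "w$1 / r = cos t" "w$2 / r = sin t" using sincos_total_2pi by metis
  then have wt: "w$1 = r * cos t" "w$2 = r * sin t" using r(1) by (auto simp: field_simps)
  define G where "G = (\<lambda>y. (c - w$3 * healpix_z y) / sqrt (1 - (healpix_z y)\<^sup>2) / r)"
  define H where "H = (\<lambda>s y. 2 / pi * t + s * (2 / pi * arccos (G y)))"
  have finR: "finite R" using R finite_pixels by (rule finite_subset)
  have ex: "\<exists>p q m s. in_open_cell n i j p q \<and> \<bar>G (square_y a p q)\<bar> \<le> 1 \<and> (s = 1 \<or> s = -1)
      \<and> H s (square_y a p q) = square_lon a p q + 4 * of_int m" if aij: "(a, i, j) \<in> R" for a i j
  proof -
    obtain p q where pq: "in_open_cell n i j p q" "w \<bullet> square_point a p q = c" using zero[OF aij] by blast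
    have mem: "a \<in> lowest_vertices" "i < n" "j < n" using aij R by (auto simp: pixels_def)
    note bd = in_open_cell_bounds[OF pq(1) mem(2,3)]
    define y where "y = square_y a p q"
    define h where "h = square_lon a p q"
    have "-1 < y" "y < 1" using square_y_gt[OF mem(1)] square_y_bounds[OF mem(1)] bd by (auto simp: y_def)
    then have z: "\<bar>healpix_z y\<bar> < 1" using healpix_z_bounds[of y] by (auto simp: abs_if)
    then have sq: "sqrt (1 - (healpix_z y)\<^sup>2) > 0" by (simp add: abs_square_less_1)
    have "c = sqrt (1 - (healpix_z y)\<^sup>2) * (r * cos t * cos (pi/2 * h) + r * sin t * sin (pi/2 * h)) + w$3 * healpix_z y"
      using pq(2) by (simp add: square_point_def inner_sphere_point wt y_def h_def)
    also have "\<dots> = sqrt (1 - (healpix_z y)\<^sup>2) * (r * cos (pi/2 * h - t)) + w$3 * healpix_z y"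
      by (simp add: cos_diff algebra_simps)
    finally have "cos (pi/2 * h - t) = G y" using sq r(1) by (simp add: G_def field_simps)
    then have 1: "-1 \<le> G y" "G y \<le> 1" and "\<exists>k::int. pi/2 * h - t = arccos (G y) + 2 * of_int k * pi \<or> pi/2 * h - t = - arccos (G y) + 2 * of_int k * pi"
      unfolding cos_eq_arccos_Ex by auto
    then obtain k :: int where "pi/2 * h - t = arccos (G y) + 2 * of_int k * pi \<or> pi/2 * h - t = - arccos (G y) + 2 * of_int k * pi" by blast
    then have "\<exists>s::real. (s = 1 \<or> s = -1) \<and> pi/2 * h - t = s * arccos (G y) + 2 * of_int k * pi"
      by (elim disjE) (rule exI[of _ 1] exI[of _ "-1"]; simp)+
    then obtain s :: real where k: "s = 1 \<or> s = -1" "pi/2 * h - t = s * arccos (G y) + 2 * of_int k * pi" by blast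
    have "h = 2 / pi * (pi / 2 * h)" by simp
    also have "pi / 2 * h = t + s * arccos (G y) + 2 * of_int k * pi" using k(2) by linarith
    also have "2 / pi * (t + s * arccos (G y) + 2 * of_int k * pi) = H s y + 4 * of_int k"
      by (simp add: H_def distrib_left)
    finally have "H s y = h + 4 * of_int (- k)" by simp
    then have "in_open_cell n i j p q \<and> \<bar>G y\<bar> \<le> 1 \<and> (s = 1 \<or> s = -1) \<and> H s y = h + 4 * of_int (- k)"
      using pq(1) 1 k(1) by (simp add: abs_le_iff)
    then show ?thesis unfolding y_def h_def by blast
  qed
  define good where "good = (\<lambda>(a, i, j) (p, q, m, s). in_open_cell n i j p q \<and> \<bar>G (square_y a p q)\<bar> \<le> 1
      \<and> (s = 1 \<or> s = -1) \<and> H s (square_y a p q) = square_lon a p q + 4 * of_int m)"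
  have "\<forall>P\<in>R. \<exists>v. good P v"
    unfolding good_def using ex by fastforce
  then obtain f where f: "\<And>P. P \<in> R \<Longrightarrow> good P (f P)" unfolding bchoice_iff by blast
  define p where "p = (\<lambda>P. fst (f P))"
  define q where "q = (\<lambda>P. fst (snd (f P)))"
  define m where "m = (\<lambda>P. fst (snd (snd (f P))))"
  define s where "s = (\<lambda>P. snd (snd (snd (f P))))"
  have pqms: "in_open_cell n i j (p (a,i,j)) (q (a,i,j))
      \<and> \<bar>G (square_y a (p (a,i,j)) (q (a,i,j)))\<bar> \<le> 1 \<and> (s (a,i,j) = 1 \<or> s (a,i,j) = (-1::real))
      \<and> H (s (a,i,j)) (square_y a (p (a,i,j)) (q (a,i,j))) = square_lon a (p (a,i,j)) (q (a,i,j)) + 4 * of_int (m (a,i,j))"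
    if "(a, i, j) \<in> R" for a i j
    using f[OF that] by (simp add: good_def p_def q_def m_def s_def case_prod_unfold)
  define Y where "Y = (\<lambda>P. square_y (fst P) (p P) (q P))"
  have branch: "real (card {P\<in>R. s P = \<sigma>}) \<le> 12 * n + 48" if \<sigma>: "\<sigma> = 1 \<or> \<sigma> = -1" for \<sigma> :: real
  proof -
    define S where "S = {P\<in>R. s P = \<sigma>}"
    define cell where "cell = (\<lambda>y. (\<lfloor>n * (y + fold_lon y (H \<sigma> y) + 1/2)\<rfloor>, \<lfloor>n * (y - fold_lon y (H \<sigma> y) + 1/2)\<rfloor>))"
    have S: "a \<in> lowest_vertices" "i < n" "j < n" "in_open_cell n i j (p (a,i,j)) (q (a,i,j))"
      "\<bar>G (Y (a,i,j))\<bar> \<le> 1" "H \<sigma> (Y (a,i,j)) = square_lon a (p (a,i,j)) (q (a,i,j)) + 4 * of_int (m (a,i,j))"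
      if "(a, i, j) \<in> S" for a i j
      using pqms[of a i j] that R by (auto simp: S_def Y_def pixels_def)
    have cellS: "cell (Y (a,i,j)) =
        (\<lfloor>n * (fst a + snd a + 1/2 + p (a,i,j) + 4 * of_int (m (a,i,j)))\<rfloor>,
         \<lfloor>n * (snd a - fst a + 1/2 + q (a,i,j) - 4 * of_int (m (a,i,j)))\<rfloor>)" if "(a, i, j) \<in> S" for a i j
    proof -
      note bd = in_open_cell_bounds[OF S(4,2,3)[OF that]]
      have X: "fold_lon (Y (a,i,j)) (H \<sigma> (Y (a,i,j))) = fst a + (p (a,i,j) - q (a,i,j)) / 2 + 4 * of_int (m (a,i,j))"
        unfolding S(6)[OF that] using fold_lon_square(1)[OF S(1)[OF that] bd] by (simp add: Y_def)
      have "Y (a,i,j) + fold_lon (Y (a,i,j)) (H \<sigma> (Y (a,i,j))) + 1/2 = fst a + snd a + 1/2 + p (a,i,j) + 4 * of_int (m (a,i,j))"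
        unfolding X by (simp add: Y_def square_y_def field_simps)
      moreover have "Y (a,i,j) - fold_lon (Y (a,i,j)) (H \<sigma> (Y (a,i,j))) + 1/2 = snd a - fst a + 1/2 + q (a,i,j) - 4 * of_int (m (a,i,j))"
        unfolding X by (simp add: Y_def square_y_def field_simps)
      ultimately show ?thesis unfolding cell_def by (simp only: )
    qed
    have inj: "P = P'" if PP: "P \<in> S" "P' \<in> S" "cell (Y P) = cell (Y P')" for P P'
    proof -
      obtain a i j where P: "P = (a, i, j)" by (cases P)
      obtain a' i' j' where P': "P' = (a', i', j')" by (cases P')
      have mem: "(a, i, j) \<in> S" "(a', i', j') \<in> S" using PP P P' by auto
      have "a = a' \<and> i = i' \<and> j = j' \<and> m P = m P'"
        using PP(3) S(2-4)[OF mem(1)] S(2-4)[OF mem(2)] cellS[OF mem(1)] cellS[OF mem(2)]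
        unfolding P P' in_open_cell_def
        by (intro vertex_eq_if_cells_eq[OF S(1)[OF mem(1)] S(1)[OF mem(2)]]) auto
      then show ?thesis using P P' by simp
    qed
    have injY: "inj_on Y S" by (rule inj_onI) (use inj in metis)
    have injc: "inj_on cell (Y ` S)"
    proof (rule inj_onI)
      fix y y' assume "y \<in> Y ` S" "y' \<in> Y ` S" "cell y = cell y'"
      then obtain P P' where "P \<in> S" "P' \<in> S" "y = Y P" "y' = Y P'" by blast
      then show "y = y'" using inj \<open>cell y = cell y'\<close> by metis
    qed
    have "real (card (Y ` S)) \<le> 12 * n + 48"
    proof (rule card_cells_branch[where c = c and e = "w$3" and r = r and s = \<sigma> and b = "2 / pi * t"])
      show "finite (Y ` S)" using finR by (simp add: S_def)
      show "Y ` S \<subseteq> {-1<..<1}"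
      proof
        fix y assume "y \<in> Y ` S"
        then obtain a i j where aij: "(a, i, j) \<in> S" "y = Y (a, i, j)" by auto
        note bd = in_open_cell_bounds[OF S(4,2,3)[OF aij(1)]]
        show "y \<in> {-1<..<1}" using square_y_gt[OF S(1)[OF aij(1)]] square_y_bounds[OF S(1)[OF aij(1)]] bd aij(2)
          by (auto simp: Y_def)
      qed
      show "r > 0" by fact
      show "\<sigma> = 1 \<or> \<sigma> = -1" by fact
      fix y assume "y \<in> Y ` S"
      then obtain a i j where aij: "(a, i, j) \<in> S" "y = Y (a, i, j)" by auto
      show "\<bar>(c - w$3 * healpix_z y) / sqrt (1 - (healpix_z y)\<^sup>2) / r\<bar> \<le> 1"
        using S(5)[OF aij(1)] by (simp add: aij(2) G_def)
      assume "1/2 < \<bar>y\<bar>"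
      then have "H \<sigma> y \<notin> \<int>"
        using fold_lon_square(2)[OF S(1)[OF aij(1)] in_open_cell_bounds[OF S(4,2,3)[OF aij(1)]]]
        unfolding aij(2) S(6)[OF aij(1)] by (simp add: Y_def)
      then show "2 / pi * t + \<sigma> * (2 / pi * arccos ((c - w$3 * healpix_z y) / sqrt (1 - (healpix_z y)\<^sup>2) / r)) \<notin> \<int>"
        by (simp add: H_def G_def)
    qed (use injc in \<open>simp add: cell_def H_def G_def\<close>)
    then show ?thesis using card_image[OF injY] by (simp add: S_def)
  qed
  have "s P = 1 \<or> s P = -1" if "P \<in> R" for P
    using pqms[of "fst P" "fst (snd P)" "snd (snd P)"] that by simp
  then have "{P\<in>R. s P = 1} \<union> {P\<in>R. s P = -1} = R" by blast
  then have "card R \<le> card {P\<in>R. s P = 1} + card {P\<in>R. s P = -1}"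
    using card_Un_le[of "{P\<in>R. s P = 1}" "{P\<in>R. s P = -1}"] by simp
  then show ?thesis using branch[of 1] branch[of "-1"] by linarith
qed

section \<open>Pixels cut by the boundary of a cap\<close>

lemma continuous_on_healpix_z: "continuous_on {-1..1} healpix_z"
proof -
  have "continuous_on {-1..1} (\<lambda>y::real. 4/3 * (y - (max 0 (y - 1/2))\<^sup>2 + (max 0 (- y - 1/2))\<^sup>2))"
    by (intro continuous_intros)
  then show ?thesis
  proof (rule continuous_on_eq)
    fix y :: real assume "y \<in> {-1..1}"
    then have "\<bar>y\<bar> \<le> 1" by auto
    then show "4/3 * (y - (max 0 (y - 1/2))\<^sup>2 + (max 0 (- y - 1/2))\<^sup>2) = healpix_z y"
      by (rule healpix_z_eq[symmetric])
  qed
qed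

lemma healpix_z_abs_le: "\<bar>y\<bar> \<le> 1 \<Longrightarrow> \<bar>healpix_z y\<bar> \<le> 1"
proof -
  assume y: "\<bar>y\<bar> \<le> 1"
  have "healpix_z (-1) = -1" "healpix_z 1 = 1" by (simp_all add: healpix_z_def)
  moreover have "y = -1 \<or> y = 1 \<or> -1 < y \<and> y < 1" using y by linarith
  ultimately show ?thesis using healpix_z_bounds[of y] by (auto simp: abs_le_iff)
qed

lemma norm_sphere_point: "\<bar>z\<bar> \<le> 1 \<Longrightarrow> norm (sphere_point z h) = 1"
proof -
  assume "\<bar>z\<bar> \<le> 1"
  then have "z\<^sup>2 \<le> 1" by (simp add: abs_square_le_1)
  then have sq: "(sqrt (1 - z\<^sup>2))\<^sup>2 = 1 - z\<^sup>2" by simp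
  have "x * c * (x * c) + x * s * (x * s) + z * z = x\<^sup>2 * (c\<^sup>2 + s\<^sup>2) + z\<^sup>2" for x c s :: real
    by (simp add: power2_eq_square algebra_simps)
  then have "sphere_point z h \<bullet> sphere_point z h
      = (sqrt (1 - z\<^sup>2))\<^sup>2 * ((cos (pi/2 * h))\<^sup>2 + (sin (pi/2 * h))\<^sup>2) + z\<^sup>2"
    by (simp only: sphere_point_def inner_vec_def sum_3 vector_3 inner_real_def)
  then have "sphere_point z h \<bullet> sphere_point z h = 1" unfolding sq by simp
  then show ?thesis by (simp add: norm_eq_sqrt_inner)
qed

lemma norm_square_point:
  assumes "a \<in> lowest_vertices" "0 \<le> p" "p < 1" "0 \<le> q" "q < 1"
  shows "norm (square_point a p q) = 1"
  unfolding square_point_def using square_y_bounds[OF assms]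
  by (intro norm_sphere_point healpix_z_abs_le) (auto simp: abs_le_iff)

lemma continuous_on_square_point:
  fixes P Q :: "real \<Rightarrow> real"
  assumes "continuous_on T P" "continuous_on T Q" and y: "\<And>t. t \<in> T \<Longrightarrow> \<bar>square_y a (P t) (Q t)\<bar> < 1"
  shows "continuous_on T (\<lambda>t. w \<bullet> square_point a (P t) (Q t))"
proof -
  have cy: "continuous_on T (\<lambda>t. square_y a (P t) (Q t))"
    unfolding square_y_def by (intro continuous_intros assms(1,2)) auto
  have cz: "continuous_on T (\<lambda>t. healpix_z (square_y a (P t) (Q t)))"
    using y by (intro continuous_on_compose2[OF continuous_on_healpix_z cy]) (auto simp: abs_less_iff less_imp_le)
  have sh: "shrink (square_y a (P t) (Q t)) > 0" if "t \<in> T" for t using y[OF that] by (simp add: shrink_def)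
  have cs: "continuous_on T (\<lambda>t. shrink (square_y a (P t) (Q t)))"
    unfolding shrink_def by (intro continuous_intros cy)
  have ch: "continuous_on T (\<lambda>t. square_lon a (P t) (Q t))"
  proof -
    have "\<forall>t\<in>T. 2 * shrink (square_y a (P t) (Q t)) \<noteq> 0" using sh by fastforce
    then show ?thesis unfolding square_lon_def by (intro continuous_intros cs assms(1,2))
  qed
  show ?thesis unfolding square_point_def inner_sphere_point by (intro continuous_intros cz ch)
qed

text \<open>
  On a segment from a point of the half-open cell to the centre of the cell, all points but the starting
  point are interior; one of the two segments carries a change of sign. The cells at the south
  pole are excluded because the longitude is discontinuous there.
\<close>

lemma open_cell_zero:
  assumes a: "a \<in> lowest_vertices" and ij: "i < n" "j < n" and notpole: "snd a = -1 \<Longrightarrow> (i, j) \<noteq> (0, 0)"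
    and X: "in_cell n i j p q" "w \<bullet> square_point a p q > c"
    and Y: "in_cell n i j p' q'" "w \<bullet> square_point a p' q' < c"
  shows "\<exists>p q. in_open_cell n i j p q \<and> w \<bullet> square_point a p q = c"
proof -
  have n: "real n > 0" using ij by simp
  define u v where "u = (real i + 1/2) / n" and "v = (real j + 1/2) / n"
  have uv: "n * u = real i + 1/2" "n * v = real j + 1/2" using n by (auto simp: u_def v_def)
  have y_in: "\<bar>square_y a p q\<bar> < 1" if "in_cell n i j p q" for p q
  proof -
    note b = in_cell_bounds[OF that ij]
    have "p + q > 0" if "snd a = -1"
    proof -
      have "i > 0 \<or> j > 0" using notpole[OF that] by auto
      then have "n * p > 0 \<or> n * q > 0" using \<open>in_cell n i j p q\<close> by (auto simp: in_cell_def)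
      then have "p > 0 \<or> q > 0" using n by (auto simp: zero_less_mult_iff)
      then show ?thesis using b by linarith
    qed
    then show ?thesis using square_y_gt[OF a b] square_y_bounds[OF a b] by (auto simp: abs_less_iff)
  qed
  define L where "L = (\<lambda>s r t::real. (1 - t) * s + t * r)"
  have conv: "real k \<le> n * L s r t \<and> n * L s r t < real k + 1 \<and> (0 < t \<longrightarrow> real k < n * L s r t)"
    if "real k \<le> n * s" "n * s < real k + 1" "n * r = real k + 1/2" "0 \<le> t" "t \<le> 1" for k and s r t :: real
  proof -
    have eq: "n * L s r t = real k + ((1 - t) * (n * s - real k) + t * (1/2))"
    proof -
      have "n * L s r t = (1 - t) * (n * s) + t * (n * r)" by (simp add: L_def algebra_simps)
      then show ?thesis unfolding that(3) by (simp add: algebra_simps)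
    qed
    have "(1 - t) * (n * s - real k) \<ge> 0" using that by (intro mult_nonneg_nonneg) auto
    moreover have "(1 - t) * (n * s - real k) + t * (1/2) < 1"
    proof (cases "t = 1")
      case False
      then have "(1 - t) * (n * s - real k) < (1 - t) * 1" using that by (intro mult_strict_left_mono) auto
      then have "(1 - t) * (n * s - real k) < 1 - t" by simp
      then show ?thesis using that(4,5) by argo
    qed simp
    ultimately show ?thesis unfolding eq using that(4) by (auto intro: add_nonneg_pos add_nonneg_nonneg)
  qed
  have seg: "\<exists>p q. in_open_cell n i j p q \<and> w \<bullet> square_point a p q = c"
    if Z: "in_cell n i j s r" "w \<bullet> square_point a s r \<noteq> c"
      and sgn: "w \<bullet> square_point a s r \<le> c \<and> c \<le> w \<bullet> square_point a u v
        \<or> w \<bullet> square_point a u v \<le> c \<and> c \<le> w \<bullet> square_point a s r" for s r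
  proof -
    define f where "f = (\<lambda>t. w \<bullet> square_point a (L s u t) (L r v t))"
    have cell: "in_cell n i j (L s u t) (L r v t)" if "0 \<le> t" "t \<le> 1" for t
      using conv[of i s u t] conv[of j r v t] Z(1) uv that by (auto simp: in_cell_def)
    have cont: "continuous_on {0..1} f"
      unfolding f_def
    proof (rule continuous_on_square_point)
      show "continuous_on {0..1} (L s u)" "continuous_on {0..1} (L r v)"
        unfolding L_def by (intro continuous_intros)+
    qed (use cell y_in in auto)
    have ends: "f 0 = w \<bullet> square_point a s r" "f 1 = w \<bullet> square_point a u v"
      by (auto simp: f_def L_def)
    have "\<exists>t. 0 \<le> t \<and> t \<le> 1 \<and> f t = c"
      using sgn
    proof
      assume "w \<bullet> square_point a s r \<le> c \<and> c \<le> w \<bullet> square_point a u v"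
      then show ?thesis using IVT'[of f 0 c 1] cont ends by auto
    next
      assume "w \<bullet> square_point a u v \<le> c \<and> c \<le> w \<bullet> square_point a s r"
      then show ?thesis using IVT2'[of f 1 c 0] cont ends by auto
    qed
    then obtain t where t: "0 \<le> t" "t \<le> 1" "f t = c" by blast
    then have "0 < t" using ends(1) Z(2) by (cases "t = 0") auto
    then have "in_open_cell n i j (L s u t) (L r v t)"
      using conv[of i s u t] conv[of j r v t] Z(1) uv t by (auto simp: in_cell_def in_open_cell_def)
    then show ?thesis using t(3) unfolding f_def by blast
  qed
  show ?thesis
  proof (cases "w \<bullet> square_point a u v \<le> c")
    case True
    then show ?thesis using seg[OF X(1)] X(2) by auto
  next
    case False
    then show ?thesis using seg[OF Y(1)] Y(2) by auto
  qed
qed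

text \<open>
  A cut pixel may meet the circle \<open>w \<bullet> x = c\<close> only on its boundary. The two sign conditions are finitely many inequalities,
  so lowering \<open>c\<close> slightly makes all of them strict; they survive a further small change of \<open>w\<close>, which
  serves to move \<open>w\<close> off the axis. For the new circle every cut pixel has an interior point on it, except
  perhaps the (at most 12) pixels at lowest vertices.
\<close>

lemma card_cut_pixels:
  fixes w :: "real^3" and c :: real and n :: nat
  assumes R: "R \<subseteq> pixels n"
    and X: "\<And>a i j. (a, i, j) \<in> R \<Longrightarrow> \<exists>p q. in_cell n i j p q \<and> w \<bullet> square_point a p q \<ge> c"
    and Y: "\<And>a i j. (a, i, j) \<in> R \<Longrightarrow> \<exists>p q. in_cell n i j p q \<and> w \<bullet> square_point a p q < c"
  shows "real (card R) \<le> 24 * n + 108"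
proof -
  define E where "E = lowest_vertices \<times> {0::nat} \<times> {0::nat}"
  have finR: "finite R" using R finite_pixels by (rule finite_subset)
  have cardE: "card E \<le> 12" "finite E"
    by (simp_all add: E_def card_cartesian_product card_lowest_vertices finite_lowest_vertices)
  define S where "S = R - E"
  have S: "S \<subseteq> R" "finite S" using finR by (auto simp: S_def)
  define good where "good = (\<lambda>(a, i, j) (p, q). in_cell n i j p q \<and> w \<bullet> square_point a p q < c)"
  have "\<forall>P\<in>S. \<exists>v. good P v"
  proof
    fix P assume "P \<in> S"
    then have "(fst P, fst (snd P), snd (snd P)) \<in> R" using S(1) by auto
    from Y[OF this] obtain p q where "in_cell n (fst (snd P)) (snd (snd P)) p q \<and> w \<bullet> square_point (fst P) p q < c"
      by blast
    then have "good P (p, q)" by (simp add: good_def case_prod_unfold)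
    then show "\<exists>v. good P v" ..
  qed
  then obtain f where f: "\<And>P. P \<in> S \<Longrightarrow> good P (f P)" unfolding bchoice_iff by blast
  define v where "v = (\<lambda>P. w \<bullet> square_point (fst P) (fst (f P)) (snd (f P)))"
  \<comment> \<open>a common margin in the strict inequalities; the 1 only keeps the set nonempty\<close>
  define g where "g = Min (insert 1 ((\<lambda>P. c - v P) ` S))"
  have "g \<in> insert 1 ((\<lambda>P. c - v P) ` S)" unfolding g_def using S by (intro Min_in) auto
  moreover have "c - v P > 0" if "P \<in> S" for P
    using f[OF that] by (simp add: good_def v_def case_prod_unfold)
  ultimately have g0: "g > 0" by fastforce
  have gv: "v P + g \<le> c" if "P \<in> S" for P
  proof -
    have "g \<le> c - v P" unfolding g_def using S that by (intro Min_le) auto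
    then show ?thesis by simp
  qed
  define e where "e = (if w$1 = 0 then g / 4 else 0)"
  have e: "0 \<le> e" "e < g / 2" using g0 by (auto simp: e_def)
  define w' where "w' = w + e *\<^sub>R axis 1 1"
  have w'1: "w' $ 1 \<noteq> 0" using g0 by (auto simp: w'_def e_def axis_def)
  have w': "\<bar>w' \<bullet> x - w \<bullet> x\<bar> \<le> e" if "norm x = 1" for x
  proof -
    have "w' \<bullet> x - w \<bullet> x = e * x $ 1" by (simp add: w'_def inner_add_left inner_axis')
    moreover have "\<bar>x $ 1\<bar> \<le> 1" using component_le_norm_cart[of x 1] that by simp
    ultimately show ?thesis using e by (simp add: abs_mult mult_left_le)
  qed
  have "real (card S) \<le> 24 * n + 96"
  proof (rule card_pixels_meeting_circle[OF w'1])
    show "S \<subseteq> pixels n" using S R by blast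
    fix a i j assume aij: "(a, i, j) \<in> S"
    then have mem: "a \<in> lowest_vertices" "i < n" "j < n" "(a, i, j) \<in> R" using S R by (auto simp: pixels_def)
    obtain p q where pq: "in_cell n i j p q" "w \<bullet> square_point a p q \<ge> c" using X[OF mem(4)] by blast
    obtain p' q' where pq': "f (a, i, j) = (p', q')" by (cases "f (a, i, j)")
    have Y': "in_cell n i j p' q'" "w \<bullet> square_point a p' q' + g \<le> c"
      using f[OF aij] gv[OF aij] by (auto simp: good_def v_def pq')
    show "\<exists>p q. in_open_cell n i j p q \<and> w' \<bullet> square_point a p q = c - g / 2"
    proof (rule open_cell_zero[OF mem(1-3)])
      show "(i, j) \<noteq> (0, 0)" using aij mem by (auto simp: S_def E_def)
      show "in_cell n i j p q" "in_cell n i j p' q'" by fact+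
      show "c - g / 2 < w' \<bullet> square_point a p q"
        using w'[OF norm_square_point[OF mem(1) in_cell_bounds[OF pq(1) mem(2,3)]]] pq(2) e by linarith
      show "w' \<bullet> square_point a p' q' < c - g / 2"
        using w'[OF norm_square_point[OF mem(1) in_cell_bounds[OF Y'(1) mem(2,3)]]] Y'(2) e by linarith
    qed
  qed
  moreover have "card R \<le> card S + card E"
  proof -
    have "card R \<le> card (S \<union> E)" using S(2) cardE(2) by (intro card_mono) (auto simp: S_def)
    then show ?thesis using card_Un_le[of S E] by linarith
  qed
  ultimately show ?thesis using cardE by linarith
qed

section \<open>The area of a pixel\<close>

text \<open>
  Height gives the ordinate, and the longitude is determined modulo a full turn.
\<close>

lemma square_point_inj:
  assumes a: "a \<in> lowest_vertices" "a' \<in> lowest_vertices"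
    and c: "in_open_cell n i j p q" "i < n" "j < n" and c': "in_open_cell n i' j' p' q'" "i' < n" "j' < n"
    and eq: "square_point a p q = square_point a' p' q'"
  shows "a = a' \<and> i = i' \<and> j = j' \<and> p = p' \<and> q = q'"
proof -
  note b = in_open_cell_bounds[OF c] and b' = in_open_cell_bounds[OF c']
  define y y' where "y = square_y a p q" and "y' = square_y a' p' q'"
  have yb: "-1 < y" "y < 1" "-1 < y'" "y' < 1"
    using square_y_gt[OF a(1)] square_y_bounds[OF a(1)] b square_y_gt[OF a(2)] square_y_bounds[OF a(2)] b'
    by (auto simp: y_def y'_def)
  have comp: "square_point a p q $ k = square_point a' p' q' $ k" for k using eq by simp
  have z: "healpix_z y = healpix_z y'"
    using comp[of 3] by (simp add: square_point_def sphere_point_def y_def y'_def)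
  have yy: "y = y'"
    using healpix_z_strict_mono[of y y'] healpix_z_strict_mono[of y' y] yb z by (cases y y' rule: linorder_cases) auto
  have "\<bar>healpix_z y\<bar> < 1" using healpix_z_bounds[of y] yb by (auto simp: abs_if)
  then have sq: "sqrt (1 - (healpix_z y)\<^sup>2) \<noteq> 0" by (simp add: abs_square_eq_1)
  have "sin (pi/2 * square_lon a p q) = sin (pi/2 * square_lon a' p' q') \<and>
        cos (pi/2 * square_lon a p q) = cos (pi/2 * square_lon a' p' q')"
    using comp[of 1] comp[of 2] sq z by (simp add: square_point_def sphere_point_def flip: y_def y'_def)
  then obtain k :: int where "pi/2 * square_lon a p q = pi/2 * square_lon a' p' q' + 2 * pi * of_int k"
    unfolding sin_cos_eq_iff by auto
  then have "pi * square_lon a p q = pi * (square_lon a' p' q' + 4 * of_int k)" by (simp add: algebra_simps)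
  then have "square_lon a p q + 4 * of_int 0 = square_lon a' p' q' + 4 * of_int k" by simp
  then show ?thesis using yy unfolding y_def y'_def by (intro square_coords_inj[OF a c c'])
qed

text \<open>
  The derivative of \<open>healpix_z\<close> is proportional to \<open>shrink\<close>, that is to the contraction of the parallels. This is why the projection
  preserves areas.
\<close>

lemma healpix_z_derivative:
  assumes "\<bar>y\<bar> < 1" "\<bar>y\<bar> \<noteq> 1/2"
  shows "(healpix_z has_real_derivative (4/3 * shrink y)) (at y)"
    and "\<exists>d. (shrink has_real_derivative d) (at y)"
proof -
  consider "\<bar>y\<bar> < 1/2" | "1/2 < y" "y < 1" | "-1 < y" "y < - (1/2)" using assms by linarith
  then have "(healpix_z has_real_derivative (4/3 * shrink y)) (at y) \<and> (\<exists>d. (shrink has_real_derivative d) (at y))"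
  proof cases
    case 1
    have D: "((\<lambda>y. 4/3 * y) has_real_derivative 4/3 * shrink y) (at y)"
      using 1 by (auto intro!: derivative_eq_intros simp: shrink_equator)
    have E: "((\<lambda>y::real. 1::real) has_real_derivative 0) (at y)" by simp
    have S: "open {- (1/2)<..<1/2::real}" "y \<in> {- (1/2)<..<1/2}" using 1 by auto
    have "(healpix_z has_real_derivative (4/3 * shrink y)) (at y)"
      by (rule has_field_derivative_transform_within_open[OF D S]) (auto simp: healpix_z_def)
    moreover have "(shrink has_real_derivative 0) (at y)"
      by (rule has_field_derivative_transform_within_open[OF E S]) (auto simp: shrink_def)
    ultimately show ?thesis by blast
  next
    case 2
    have D: "((\<lambda>y. 1 - 4/3 * (1 - y)\<^sup>2) has_real_derivative 4/3 * shrink y) (at y)"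
      using 2 by (auto intro!: derivative_eq_intros simp: shrink_polar field_simps)
    have E: "((\<lambda>y::real. 2 * (1 - y)) has_real_derivative -2) (at y)" by (auto intro!: derivative_eq_intros)
    have S: "open {1/2<..<1::real}" "y \<in> {1/2<..<1}" using 2 by auto
    have "(healpix_z has_real_derivative (4/3 * shrink y)) (at y)"
      by (rule has_field_derivative_transform_within_open[OF D S]) (auto simp: healpix_z_def)
    moreover have "(shrink has_real_derivative -2) (at y)"
      by (rule has_field_derivative_transform_within_open[OF E S]) (auto simp: shrink_def)
    ultimately show ?thesis by blast
  next
    case 3
    have D: "((\<lambda>y. - (1 - 4/3 * (1 + y)\<^sup>2)) has_real_derivative 4/3 * shrink y) (at y)"
      using 3 by (auto intro!: derivative_eq_intros simp: shrink_polar field_simps)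
    have E: "((\<lambda>y::real. 2 * (1 + y)) has_real_derivative 2) (at y)" by (auto intro!: derivative_eq_intros)
    have S: "open {-1<..<- (1/2)::real}" "y \<in> {-1<..<- (1/2)}" using 3 by auto
    have "(healpix_z has_real_derivative (4/3 * shrink y)) (at y)"
      by (rule has_field_derivative_transform_within_open[OF D S]) (auto simp: healpix_z_def)
    moreover have "(shrink has_real_derivative 2) (at y)"
      by (rule has_field_derivative_transform_within_open[OF E S]) (auto simp: shrink_def)
    ultimately show ?thesis by blast
  qed
  then show "(healpix_z has_real_derivative (4/3 * shrink y)) (at y)"
    and "\<exists>d. (shrink has_real_derivative d) (at y)" by auto
qed

text \<open>
  The cube root turns the radial factor \<open>r\<^sup>2\<close> of the volume element into a constant, so that the map
  of the whole prism has constant Jacobian.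
\<close>

definition cone_map :: "real \<times> real \<Rightarrow> real^3 \<Rightarrow> real^3" where
  "cone_map a v = root 3 (v$1) *\<^sub>R square_point a (v$2) (v$3)"

lemma has_derivative_vector_3:
  assumes "(f has_derivative f') F" "(g has_derivative g') F" "(h has_derivative h') F"
  shows "((\<lambda>x. vector [f x, g x, h x] :: real^3) has_derivative (\<lambda>x. vector [f' x, g' x, h' x])) F"
proof -
  have eq: "(vector [a, b, c] :: real^3) = a *\<^sub>R axis 1 1 + b *\<^sub>R axis 2 1 + c *\<^sub>R axis 3 1" for a b c
    by (simp add: vec_eq_iff forall_3 axis_def)
  show ?thesis unfolding eq by (intro derivative_intros assms)
qed

text \<open>
  The Jacobian determinant of spherical coordinates (radius, height, longitude), composed with a plane map with partial
  derivatives \<open>zp\<close>, \<open>zq\<close> of the height and \<open>fp\<close>, \<open>fq\<close> of the longitude; here \<open>s\<close> is the distance from the axis, \<open>- t\<close> its derivative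
  with respect to the height, and \<open>C\<close>, \<open>S\<close> are cosine and sine of the longitude.
\<close>

lemma det_spherical:
  fixes s t z C S :: real
  assumes "s * t = z" "s\<^sup>2 + z\<^sup>2 = 1" "C\<^sup>2 + S\<^sup>2 = 1"
  shows "(r' * (s * C)) * (r * (- t * zp * S + s * C * fp)) * (r * zq)
       + (r * (- t * zp * C - s * S * fp)) * (r * (- t * zq * S + s * C * fq)) * (r' * z)
       + (r * (- t * zq * C - s * S * fq)) * (r' * (s * S)) * (r * zp)
       - (r' * (s * C)) * (r * (- t * zq * S + s * C * fq)) * (r * zp)
       - (r * (- t * zp * C - s * S * fp)) * (r' * (s * S)) * (r * zq)
       - (r * (- t * zq * C - s * S * fq)) * (r * (- t * zp * S + s * C * fp)) * (r' * z)
       = r' * r\<^sup>2 * (fp * zq - zp * fq)" (is "?L = ?R")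
proof -
  have "?L = r' * r\<^sup>2 * (fp * zq - zp * fq) * ((s\<^sup>2 + s * t * z) * (C\<^sup>2 + S\<^sup>2))"
    by (simp add: algebra_simps power2_eq_square)
  also have "s\<^sup>2 + s * t * z = 1" using assms by (simp add: power2_eq_square)
  finally show ?thesis using assms by simp
qed

text \<open>
  Both partial derivatives of the height are \<open>2/3 * \<sigma>\<close>, those of the longitude differ by \<open>pi / (2 * \<sigma>)\<close>, and the
  unknown derivative of \<open>shrink\<close> cancels; hence the determinant is \<open>1/3 * pi/3\<close>.
\<close>

lemma cone_map_derivative:
  assumes u: "0 < v$1" and y: "\<bar>square_y a (v$2) (v$3)\<bar> < 1" "\<bar>square_y a (v$2) (v$3)\<bar> \<noteq> 1/2"
  shows "\<exists>f'. (cone_map a has_derivative f') (at v) \<and> \<bar>det (matrix f')\<bar> = pi / 9"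
proof -
  define p q y z h where "p = v$2" and "q = v$3" and "y = square_y a p q" and "z = healpix_z y" and "h = square_lon a p q"
  define \<sigma> r s C S where "\<sigma> = shrink y" and "r = root 3 (v$1)" and "s = sqrt (1 - z\<^sup>2)" and "C = cos (pi/2 * h)" and "S = sin (pi/2 * h)"
  have ylt: "\<bar>y\<bar> < 1" "\<bar>y\<bar> \<noteq> 1/2" using y by (auto simp: y_def p_def q_def)
  then have zlt: "\<bar>z\<bar> < 1" using healpix_z_bounds[of y] by (auto simp: z_def abs_if split: if_splits)
  then have z1: "1 - z\<^sup>2 > 0" by (simp add: abs_square_less_1)
  then have s: "s > 0" "s\<^sup>2 + z\<^sup>2 = 1" by (auto simp: s_def)
  have \<sigma>: "\<sigma> > 0" using ylt by (simp add: \<sigma>_def shrink_def)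
  have r: "r > 0" using u by (simp add: r_def)
  obtain d where d: "(shrink has_real_derivative d) (at y)" using healpix_z_derivative(2)[OF ylt] by blast
  have dv: "((\<lambda>v::real^3. v$k) has_derivative (\<lambda>x. x$k)) (at v)" for k
    by (rule bounded_linear_imp_has_derivative[OF bounded_linear_vec_nth])
  have dr: "((\<lambda>v::real^3. root 3 (v$1)) has_derivative (\<lambda>x. inverse (3 * r\<^sup>2) * x$1)) (at v)"
  proof -
    have "DERIV (root 3) (v$1) :> inverse (real 3 * root 3 (v$1) ^ (3 - Suc 0))"
      using u by (intro DERIV_real_root) auto
    from DERIV_compose_FDERIV[OF this dv[of 1]] show ?thesis by (simp add: r_def mult.commute numeral_2_eq_2)
  qed
  have dy: "((\<lambda>v::real^3. square_y a (v$2) (v$3)) has_derivative (\<lambda>x. (x$2 + x$3) / 2)) (at v)"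
    unfolding square_y_def by (auto intro!: derivative_eq_intros dv)
  have Dz: "(healpix_z has_real_derivative 4/3 * \<sigma>) (at (square_y a (v$2) (v$3)))"
    using healpix_z_derivative(1)[OF ylt] by (simp only: y_def p_def q_def \<sigma>_def)
  have D\<sigma>: "(shrink has_real_derivative d) (at (square_y a (v$2) (v$3)))"
    using d by (simp only: y_def p_def q_def)
  note d\<sigma> = DERIV_compose_FDERIV[OF D\<sigma> dy]
  define fp fq where "fp = pi/2 * (1 / (2 * \<sigma>) - (p - q) * d / (4 * \<sigma>\<^sup>2))"
    and "fq = pi/2 * (- 1 / (2 * \<sigma>) - (p - q) * d / (4 * \<sigma>\<^sup>2))"
  have dh: "((\<lambda>v::real^3. pi/2 * square_lon a (v$2) (v$3)) has_derivative (\<lambda>x. x$2 * fp + x$3 * fq)) (at v)"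
    unfolding square_lon_def using \<sigma>
    by (auto intro!: derivative_eq_intros dv d\<sigma> simp: fp_def fq_def p_def q_def y_def \<sigma>_def field_simps power2_eq_square)
  define t where "t = z / s"
  have st: "s * t = z" using s by (simp add: t_def)
  define zp where "zp = 2/3 * \<sigma>"
  have dz': "((\<lambda>v::real^3. healpix_z (square_y a (v$2) (v$3))) has_derivative (\<lambda>x. (x$2 + x$3) * zp)) (at v)"
    by (rule has_derivative_eq_rhs[OF DERIV_compose_FDERIV[OF Dz dy]]) (simp add: zp_def fun_eq_iff)
  have ds: "((\<lambda>v::real^3. sqrt (1 - (healpix_z (square_y a (v$2) (v$3)))\<^sup>2)) has_derivative (\<lambda>x. - t * ((x$2 + x$3) * zp))) (at v)"
  proof -
    have "((\<lambda>z. sqrt (1 - z\<^sup>2)) has_real_derivative - t) (at z)"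
      using z1 by (auto intro!: derivative_eq_intros simp: t_def s_def field_simps)
    then have "((\<lambda>z. sqrt (1 - z\<^sup>2)) has_real_derivative - t) (at (healpix_z (square_y a (v$2) (v$3))))"
      by (simp only: z_def y_def p_def q_def)
    from DERIV_compose_FDERIV[OF this dz'] show ?thesis by (simp only: mult.commute)
  qed
  have dC: "((\<lambda>v::real^3. cos (pi/2 * square_lon a (v$2) (v$3))) has_derivative (\<lambda>x. - S * (x$2 * fp + x$3 * fq))) (at v)"
    using DERIV_compose_FDERIV[OF DERIV_cos dh] by (simp only: S_def h_def p_def q_def mult.commute)
  have dS: "((\<lambda>v::real^3. sin (pi/2 * square_lon a (v$2) (v$3))) has_derivative (\<lambda>x. C * (x$2 * fp + x$3 * fq))) (at v)"
    using DERIV_compose_FDERIV[OF DERIV_sin dh] by (simp only: C_def h_def p_def q_def mult.commute)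
  define r' where "r' = inverse (3 * r\<^sup>2)"
  define f' where "f' = (\<lambda>x::real^3. vector
    [r * (s * (- S * (x$2 * fp + x$3 * fq)) + - t * ((x$2 + x$3) * zp) * C) + (r' * x$1) * (s * C),
     r * (s * (C * (x$2 * fp + x$3 * fq)) + - t * ((x$2 + x$3) * zp) * S) + (r' * x$1) * (s * S),
     r * ((x$2 + x$3) * zp) + (r' * x$1) * z] :: real^3)"
  have map_eq: "cone_map a = (\<lambda>v. vector
     [root 3 (v$1) * (sqrt (1 - (healpix_z (square_y a (v$2) (v$3)))\<^sup>2) * cos (pi/2 * square_lon a (v$2) (v$3))),
      root 3 (v$1) * (sqrt (1 - (healpix_z (square_y a (v$2) (v$3)))\<^sup>2) * sin (pi/2 * square_lon a (v$2) (v$3))),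
      root 3 (v$1) * healpix_z (square_y a (v$2) (v$3))])"
    by (auto simp: cone_map_def square_point_def sphere_point_def vec_eq_iff forall_3)
  have "(cone_map a has_derivative f') (at v)"
    unfolding map_eq f'_def
  proof (rule has_derivative_vector_3)
    note m = has_derivative_mult
    show "((\<lambda>v::real^3. root 3 (v$1) * (sqrt (1 - (healpix_z (square_y a (v$2) (v$3)))\<^sup>2) * cos (pi/2 * square_lon a (v$2) (v$3))))
       has_derivative (\<lambda>x. r * (s * (- S * (x$2 * fp + x$3 * fq)) + - t * ((x$2 + x$3) * zp) * C) + (r' * x$1) * (s * C))) (at v)"
      using m[OF dr m[OF ds dC]] by (simp only: r_def r'_def s_def C_def z_def y_def h_def p_def q_def)
    show "((\<lambda>v::real^3. root 3 (v$1) * (sqrt (1 - (healpix_z (square_y a (v$2) (v$3)))\<^sup>2) * sin (pi/2 * square_lon a (v$2) (v$3))))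
       has_derivative (\<lambda>x. r * (s * (C * (x$2 * fp + x$3 * fq)) + - t * ((x$2 + x$3) * zp) * S) + (r' * x$1) * (s * S))) (at v)"
      using m[OF dr m[OF ds dS]] by (simp only: r_def r'_def s_def S_def z_def y_def h_def p_def q_def)
    show "((\<lambda>v::real^3. root 3 (v$1) * healpix_z (square_y a (v$2) (v$3)))
       has_derivative (\<lambda>x. r * ((x$2 + x$3) * zp) + (r' * x$1) * z)) (at v)"
      using m[OF dr dz'] by (simp only: r_def r'_def z_def y_def p_def q_def)
  qed
  moreover have "\<bar>det (matrix f')\<bar> = pi / 9"
  proof -
    have "det (matrix f') = r' * r\<^sup>2 * (fp * zp - zp * fq)"
      using det_spherical[OF st s(2), of C S r' r zp fp zp fq]
      by (simp add: det_3 matrix_def f'_def axis_def C_def S_def algebra_simps)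
    also have "\<dots> = (r' * r\<^sup>2) * (zp * (fp - fq))" by (simp add: algebra_simps)
    also have "r' * r\<^sup>2 = 1/3" using r by (simp add: r'_def)
    also have "fp - fq = pi / (2 * \<sigma>)" by (simp add: fp_def fq_def algebra_simps)
    also have "zp * (pi / (2 * \<sigma>)) = pi / 3" using \<sigma> by (simp add: zp_def)
    finally have "det (matrix f') = pi / 9" by simp
    then show ?thesis using pi_gt_zero by linarith
  qed
  ultimately show ?thesis by blast
qed

text \<open>
  The projection is not differentiable at \<open>\<bar>y\<bar> = 1/2\<close>; these two planes are removed, at the cost of a null set.
\<close>

definition cell_prism :: "real \<times> real \<Rightarrow> nat \<Rightarrow> nat \<Rightarrow> nat \<Rightarrow> (real^3) set" where
  "cell_prism a n i j = {v. 0 < v$1 \<and> v$1 < 1 \<and> in_open_cell n i j (v$2) (v$3) \<and> \<bar>square_y a (v$2) (v$3)\<bar> \<noteq> 1/2}"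

lemma measure_cell_prism:
  assumes n: "n > 0"
  shows "cell_prism a n i j \<in> lmeasurable" "measure lebesgue (cell_prism a n i j) = 1 / (real n)\<^sup>2"
proof -
  define l u :: "real^3" where "l = vector [0, real i / n, real j / n]" and "u = vector [1, (real i + 1) / n, (real j + 1) / n]"
  define H where "H = (\<lambda>b. {v::real^3. vector [0, 1, 1] \<bullet> v = b})"
  have box: "v \<in> box l u \<longleftrightarrow> 0 < v$1 \<and> v$1 < 1 \<and> in_open_cell n i j (v$2) (v$3)" for v :: "real^3"
    using n by (auto simp: mem_box_cart forall_3 l_def u_def in_open_cell_def field_simps)
  have y: "\<bar>square_y a (v$2) (v$3)\<bar> = 1/2 \<longleftrightarrow> v \<in> H (1 - 2 * snd a) \<union> H (- 1 - 2 * snd a)" for v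
  proof -
    have "\<bar>square_y a (v$2) (v$3)\<bar> = 1/2 \<longleftrightarrow> square_y a (v$2) (v$3) = 1/2 \<or> square_y a (v$2) (v$3) = - (1/2)" by linarith
    then show ?thesis by (auto simp: H_def inner_vec_def sum_3 square_y_def field_simps)
  qed
  have eq: "cell_prism a n i j = box l u - (H (1 - 2 * snd a) \<union> H (- 1 - 2 * snd a))"
    unfolding cell_prism_def set_eq_iff Diff_iff box using y by blast
  have "vector [0, 1, 1] \<noteq> (0::real^3)" by (auto simp: vec_eq_iff forall_3)
  then have neg: "negligible (H b)" for b unfolding H_def by (intro negligible_hyperplane) auto
  have cl: "closed (H b)" for b unfolding H_def by (rule closed_hyperplane)
  show "cell_prism a n i j \<in> lmeasurable" unfolding eq
    by (intro lmeasurable_open bounded_diff bounded_box open_Diff open_box closed_Un cl)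
  have "measure lebesgue (cell_prism a n i j) = measure lebesgue (box l u)"
    unfolding eq by (rule measure_negligible_symdiff[OF lmeasurable_box])
       (rule negligible_subset[OF negligible_Un[OF neg neg]], auto)
  also have "\<dots> = (\<Prod>k\<in>UNIV. u$k - l$k)"
  proof -
    have "cbox l u \<noteq> {}" using n by (auto simp: interval_ne_empty_cart forall_3 l_def u_def divide_right_mono)
    then have "measure lborel (cbox l u) = (\<Prod>k\<in>UNIV. u$k - l$k)" by (rule content_cbox_cart)
    moreover have "measure lborel (box l u) = measure lborel (cbox l u)" by (simp add: measure_lborel_box_eq measure_lborel_cbox_eq)
    ultimately show ?thesis by simp
  qed
  also have "\<dots> = 1 / (real n)\<^sup>2"
  proof -
    have "u$1 - l$1 = 1" "u$2 - l$2 = 1 / n" "u$3 - l$3 = 1 / n"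
      by (simp_all add: l_def u_def diff_divide_distrib[symmetric])
    then show ?thesis unfolding UNIV_3 by (simp add: power2_eq_square)
  qed
  finally show "measure lebesgue (cell_prism a n i j) = 1 / (real n)\<^sup>2" .
qed

lemma cell_prism_square_point:
  assumes a: "a \<in> lowest_vertices" and ij: "i < n" "j < n" and v: "v \<in> cell_prism a n i j"
  shows "norm (cone_map a v) = root 3 (v$1)" "0 < norm (cone_map a v)" "norm (cone_map a v) < 1"
    "cone_map a v /\<^sub>R norm (cone_map a v) = square_point a (v$2) (v$3)"
proof -
  have o: "in_open_cell n i j (v$2) (v$3)" "0 < v$1" "v$1 < 1" using v by (auto simp: cell_prism_def)
  note b = in_open_cell_bounds[OF o(1) ij]
  have r: "0 < root 3 (v$1)" "root 3 (v$1) < 1" using o by auto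
  show nrm: "norm (cone_map a v) = root 3 (v$1)"
    using norm_square_point[OF a] b r by (simp add: cone_map_def)
  show "0 < norm (cone_map a v)" "norm (cone_map a v) < 1" unfolding nrm using r by auto
  show "cone_map a v /\<^sub>R norm (cone_map a v) = square_point a (v$2) (v$3)"
    unfolding nrm using r by (simp add: cone_map_def)
qed

text \<open>
  The value is \<open>1 / (12 * n\<^sup>2)\<close> of the volume \<open>4/3 * pi\<close> of the ball.
\<close>

lemma measure_cone_over_cell:
  assumes a: "a \<in> lowest_vertices" and ij: "i < n" "j < n"
  defines "T \<equiv> cone_map a ` cell_prism a n i j"
  shows "T \<in> lmeasurable" "measure lebesgue T = pi / 9 / (real n)\<^sup>2"
proof -
  have n: "n > 0" using ij by simp
  note m = measure_cell_prism[OF n, of a i j]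
  have "\<exists>f'. (cone_map a has_derivative f') (at v) \<and> \<bar>det (matrix f')\<bar> = pi / 9" if v: "v \<in> cell_prism a n i j" for v
  proof -
    have o: "in_open_cell n i j (v$2) (v$3)" using v by (auto simp: cell_prism_def)
    note b = in_open_cell_bounds[OF o ij]
    show ?thesis
      using square_y_gt[OF a] square_y_bounds[OF a] b v by (intro cone_map_derivative) (auto simp: cell_prism_def abs_less_iff)
  qed
  then obtain f' where f': "\<And>v. v \<in> cell_prism a n i j \<Longrightarrow> (cone_map a has_derivative f' v) (at v)"
    "\<And>v. v \<in> cell_prism a n i j \<Longrightarrow> \<bar>det (matrix (f' v))\<bar> = pi / 9" by metis
  have inj: "inj_on (cone_map a) (cell_prism a n i j)"
  proof (rule inj_onI)
    fix v v' assume vv: "v \<in> cell_prism a n i j" "v' \<in> cell_prism a n i j" "cone_map a v = cone_map a v'"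
    note c = cell_prism_square_point[OF a ij vv(1)] and c' = cell_prism_square_point[OF a ij vv(2)]
    have "root 3 (v$1) = root 3 (v'$1)" using c(1) c'(1) vv(3) by simp
    then have 1: "v$1 = v'$1" by simp
    have o: "in_open_cell n i j (v$2) (v$3)" "in_open_cell n i j (v'$2) (v'$3)"
      using vv by (auto simp: cell_prism_def)
    have "square_point a (v$2) (v$3) = square_point a (v'$2) (v'$3)" using c(4) c'(4) vv(3) by simp
    from square_point_inj[OF a a o(1) ij o(2) ij this] 1 show "v = v'" by (simp add: vec_eq_iff forall_3)
  qed
  have S: "cell_prism a n i j \<in> sets lebesgue" using m(1) by (simp add: fmeasurableD)
  have der: "\<And>v. v \<in> cell_prism a n i j \<Longrightarrow> (cone_map a has_derivative f' v) (at v within cell_prism a n i j)"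
    using f'(1) has_derivative_at_withinI by blast
  have int: "(\<lambda>v. \<bar>det (matrix (f' v))\<bar>) integrable_on cell_prism a n i j"
  proof -
    have "(\<lambda>v. pi / 9) integrable_on cell_prism a n i j" using m(1) by (rule integrable_on_const)
    then show ?thesis by (rule integrable_eq) (simp add: f'(2))
  qed
  show "T \<in> lmeasurable" unfolding T_def using measurable_differentiable_image_eq[OF S der inj] int by simp
  have "measure lebesgue T = integral (cell_prism a n i j) (\<lambda>v. \<bar>det (matrix (f' v))\<bar>)"
    unfolding T_def by (rule measure_differentiable_image_eq[OF S der inj int])
  also have "\<dots> = integral (cell_prism a n i j) (\<lambda>v. pi / 9 * 1)"
    by (intro integral_cong) (simp add: f'(2))
  also have "\<dots> = pi / 9 * measure lebesgue (cell_prism a n i j)"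
    using lmeasure_integral[OF m(1)] by (simp only: integral_mult_right)
  finally show "measure lebesgue T = pi / 9 / (real n)\<^sup>2" using m(2) by simp
qed

text \<open>
  Measures on the sphere become volumes of cones, to which the change of variables formula applies.
\<close>

lemma sphere_measure_eq:
  assumes A: "A \<in> sets borel"
  shows "measure sphere_measure A = measure lebesgue {x \<in> cball 0 1 - {0}. x /\<^sub>R norm x \<in> A} / (4/3 * pi)"
    "{x \<in> cball 0 1 - {0::real^3}. x /\<^sub>R norm x \<in> A} \<in> lmeasurable"
proof -
  define B :: "(real^3) set" where "B = cball 0 1 - {0}"
  define N where "N = (\<lambda>x::real^3. x /\<^sub>R norm x)"
  have B: "B \<in> sets borel" unfolding B_def by auto
  have N: "N \<in> borel_measurable borel" unfolding N_def by measurable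
  have NA: "N -` A \<in> sets borel" using measurable_sets[OF N A] by simp
  have set_eq: "{x \<in> cball 0 1 - {0}. x /\<^sub>R norm x \<in> A} = B \<inter> N -` A" by (auto simp: B_def N_def)
  have "bounded B" unfolding B_def by (rule bounded_subset[OF bounded_cball]) auto
  then have "B \<inter> N -` A \<in> lmeasurable"
    using B NA by (intro bounded_set_imp_lmeasurable bounded_Int) (auto simp: sets_completionI_sets)
  then show "{x \<in> cball 0 1 - {0::real^3}. x /\<^sub>R norm x \<in> A} \<in> lmeasurable" unfolding set_eq .
  have cB: "measure lborel B = 4/3 * pi" "emeasure lborel B = ennreal (4/3 * pi)"
  proof -
    have "emeasure lborel B = emeasure lborel (cball (0::real^3) 1)"
      unfolding B_def by (rule emeasure_Diff_null_set) auto
    then show "emeasure lborel B = ennreal (4/3 * pi)"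
      by (simp add: emeasure_cball unit_ball_vol_3)
    then show "measure lborel B = 4/3 * pi" by (simp add: measure_def)
  qed
  have "measure sphere_measure A = measure (uniform_measure lborel B) (N -` A)"
    unfolding sphere_measure_def B_def[symmetric] N_def[symmetric]
    using N A by (subst measure_distr) auto
  also have "\<dots> = measure lborel (B \<inter> N -` A) / measure lborel B"
    using B NA cB by (intro measure_uniform_measure) auto
  finally show "measure sphere_measure A = measure lebesgue {x \<in> cball 0 1 - {0}. x /\<^sub>R norm x \<in> A} / (4/3 * pi)"
    unfolding set_eq using B NA cB by simp
qed

lemma sphere_measure_UNIV: "measure sphere_measure UNIV = 1"
proof -
  have "{x \<in> cball 0 1 - {0::real^3}. x /\<^sub>R norm x \<in> UNIV} = cball 0 1 - {0}" by auto
  moreover have "measure lebesgue (cball 0 1 - {0::real^3}) = 4/3 * pi"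
  proof -
    have "measure lebesgue (cball 0 1 - {0::real^3}) = measure lebesgue (cball 0 (1::real) :: (real^3) set)"
      by (intro measure_negligible_symdiff) (auto intro: negligible_subset[of "{0}"])
    then show ?thesis by (simp add: content_cball unit_ball_vol_3)
  qed
  ultimately show ?thesis using sphere_measure_eq(1)[of UNIV] by simp
qed

lemma finite_measure_sphere_measure: "finite_measure sphere_measure"
proof
  have "emeasure sphere_measure UNIV \<noteq> \<infinity>"
    using sphere_measure_UNIV by (auto simp: measure_def)
  then show "emeasure sphere_measure (space sphere_measure) \<noteq> \<infinity>" by (simp add: sphere_measure_def)
qed

text \<open>
  The cones over the given pixels are disjoint and lie in the cone over \<open>A\<close>.
\<close>

lemma sphere_measure_ge_pixels:
  assumes A: "A \<in> sets borel" and I: "I \<subseteq> pixels n" and n: "n > 0"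
    and inner: "\<And>a i j p q. (a, i, j) \<in> I \<Longrightarrow> in_open_cell n i j p q \<Longrightarrow> square_point a p q \<in> A"
  shows "real (card I) \<le> 12 * (real n)\<^sup>2 * measure sphere_measure A"
proof -
  define B where "B = {x \<in> cball 0 1 - {0::real^3}. x /\<^sub>R norm x \<in> A}"
  define T where "T = (\<lambda>(a, i, j). cone_map a ` cell_prism a n i j)"
  have mem: "a \<in> lowest_vertices" "i < n" "j < n" if "(a, i, j) \<in> I" for a i j using that I by (auto simp: pixels_def)
  have Tm: "T P \<in> lmeasurable" "measure lebesgue (T P) = pi / 9 / (real n)\<^sup>2" if "P \<in> I" for P
    using measure_cone_over_cell mem that by (auto simp: T_def split: prod.split)
  have TB: "T P \<subseteq> B" if "P \<in> I" for P
  proof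
    fix x assume x: "x \<in> T P"
    obtain a i j where P: "P = (a, i, j)" by (cases P)
    then obtain v where v: "v \<in> cell_prism a n i j" "x = cone_map a v" using x by (auto simp: T_def)
    note c = cell_prism_square_point[OF mem[OF that[unfolded P]] v(1)]
    have "square_point a (v$2) (v$3) \<in> A" using inner[OF that[unfolded P]] v(1) by (auto simp: cell_prism_def)
    then show "x \<in> B" using c(2-4) by (auto simp: B_def v(2))
  qed
  have disj: "disjoint_family_on T I"
    unfolding disjoint_family_on_def
  proof (intro ballI impI, rule ccontr)
    fix P P' assume PP: "P \<in> I" "P' \<in> I" "P \<noteq> P'" "T P \<inter> T P' \<noteq> {}"
    obtain a i j a' i' j' where P: "P = (a, i, j)" "P' = (a', i', j')" by (cases P, cases P')
    obtain v v' where v: "v \<in> cell_prism a n i j" "v' \<in> cell_prism a' n i' j'" "cone_map a v = cone_map a' v'"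
      using PP(4) by (auto simp: T_def P)
    note m = mem[OF PP(1)[unfolded P]] and m' = mem[OF PP(2)[unfolded P]]
    have "square_point a (v$2) (v$3) = square_point a' (v'$2) (v'$3)"
      using cell_prism_square_point(4)[OF m v(1)] cell_prism_square_point(4)[OF m' v(2)] v(3) by simp
    moreover have "in_open_cell n i j (v$2) (v$3)" "in_open_cell n i' j' (v'$2) (v'$3)"
      using v by (auto simp: cell_prism_def)
    ultimately show False using square_point_inj[OF m(1) m'(1)] m m' PP(3) P by blast
  qed
  have finI: "finite I" using I finite_pixels by (rule finite_subset)
  have "real (card I) * (pi / 9 / (real n)\<^sup>2) = (\<Sum>P\<in>I. measure lebesgue (T P))"
    using Tm(2) by simp
  also have "\<dots> = measure lebesgue (\<Union>P\<in>I. T P)"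
  proof (rule measure_finite_Union[OF finI _ disj, symmetric])
    show "T ` I \<subseteq> sets lebesgue" using Tm(1) fmeasurableD by blast
    show "emeasure lebesgue (T P) \<noteq> \<infinity>" if "P \<in> I" for P
      using fmeasurableD2[OF Tm(1)[OF that]] by (simp only: infinity_ennreal_def not_False_eq_True)
  qed
  also have "\<dots> \<le> measure lebesgue B"
  proof (rule measure_mono_fmeasurable)
    show "(\<Union>P\<in>I. T P) \<subseteq> B" using TB by blast
    show "(\<Union>P\<in>I. T P) \<in> sets lebesgue" using Tm(1) by (intro sets.finite_UN finI) (rule fmeasurableD)
    show "B \<in> lmeasurable" using sphere_measure_eq(2)[OF A] by (simp only: B_def)
  qed
  also have "\<dots> = 4/3 * pi * measure sphere_measure A"
    using sphere_measure_eq(1)[OF A] by (simp add: B_def)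
  finally have "pi * real (card I) \<le> pi * (12 * (real n)\<^sup>2 * measure sphere_measure A)"
    using n by (simp add: field_simps)
  then show ?thesis by simp
qed

text \<open>
  The previous bound, applied to the complement of \<open>A\<close>.
\<close>

lemma sphere_measure_le_pixels:
  assumes A: "A \<in> sets borel" and I: "I \<subseteq> pixels n" and n: "n > 0"
    and outer: "\<And>a i j p q. (a, i, j) \<in> I \<Longrightarrow> in_open_cell n i j p q \<Longrightarrow> square_point a p q \<notin> A"
  shows "12 * (real n)\<^sup>2 * measure sphere_measure A \<le> 12 * (real n)\<^sup>2 - card I"
proof -
  interpret finite_measure sphere_measure by (rule finite_measure_sphere_measure)
  have sp: "space sphere_measure = UNIV" by (simp add: sphere_measure_def)
  have "A \<in> sets sphere_measure" using A by (simp add: sphere_measure_def)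
  then have "measure sphere_measure (space sphere_measure - A) = 1 - measure sphere_measure A"
    using finite_measure_compl[of A] sphere_measure_UNIV by (simp add: sp)
  moreover note sp
  moreover have "real (card I) \<le> 12 * (real n)\<^sup>2 * measure sphere_measure (UNIV - A)"
    using A I n outer by (intro sphere_measure_ge_pixels) auto
  ultimately have "real (card I) \<le> 12 * (real n)\<^sup>2 * (1 - measure sphere_measure A)" by simp
  then show ?thesis by (simp only: right_diff_distrib mult_1_right)
qed

section \<open>Discrepancy of a family with one point in each pixel\<close>

lemma mem_cap_iff:
  assumes "norm w = 1" "norm x = 1" "0 < t"
  shows "x \<in> {x \<in> sphere 0 1. dist w x \<le> t} \<longleftrightarrow> w \<bullet> x \<ge> 1 - t\<^sup>2 / 2"
proof -
  have "(dist w x)\<^sup>2 = 2 - 2 * (w \<bullet> x)"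
    using assms by (simp add: dist_norm power2_norm_eq_inner inner_diff inner_commute norm_eq_1)
  moreover have "dist w x \<le> t \<longleftrightarrow> (dist w x)\<^sup>2 \<le> t\<^sup>2" using assms(3) by (simp add: abs_le_square_iff[symmetric])
  ultimately show ?thesis using assms(2) by auto
qed

lemma sum_indicator_healpix_G:
  assumes "0 \<le> fst x" "fst x < 1" "0 \<le> snd x" "snd x < 1"
  shows "(\<Sum>y\<in>#healpix_G x. indicator A y :: real) = (\<Sum>a\<in>lowest_vertices. indicator A (square_point a (fst x) (snd x)))"
proof -
  have "(\<Sum>y\<in>#healpix_G x. indicator A y :: real) = (\<Sum>a\<in>lowest_vertices. indicator A (inv_healpix (((fst x - snd x) / 2, (fst x + snd x) / 2) + a)))"
    unfolding healpix_G_def healpix_gamma_def by (simp add: image_mset.compositionality sum_unfold_sum_mset comp_def)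
  also have "\<dots> = (\<Sum>a\<in>lowest_vertices. indicator A (square_point a (fst x) (snd x)))"
    using assms by (intro sum.cong refl) (simp add: inv_healpix_square)
  finally show ?thesis .
qed

definition local_discrepancy :: "(real^3) set \<Rightarrow> real \<times> real \<Rightarrow> real" where
  "local_discrepancy A x = (\<Sum>y\<in>#healpix_G x. indicator A y) - 12 * measure sphere_measure A"

text \<open>
  Let \<open>I\<close> be the set of pixels inside the cap and \<open>U\<close> the set of pixels that meet it. Both the number of
  points in the cap and \<open>12 * n\<^sup>2\<close> times its measure lie between \<open>card I\<close> and \<open>card U\<close>, and \<open>U - I\<close> consists of cut pixels.
\<close>

lemma block_discrepancy:
  fixes x :: "nat \<Rightarrow> real \<times> real" and c1 c2 :: "nat \<Rightarrow> nat"
  assumes n: "n > 0" and w: "norm w = 1" and t: "t > 0"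
    and bij: "bij_betw (\<lambda>k. (c1 k, c2 k)) J ({..<n} \<times> {..<n})"
    and cell: "\<And>k. k \<in> J \<Longrightarrow> in_cell n (c1 k) (c2 k) (fst (x k)) (snd (x k))"
  defines "A \<equiv> {x \<in> sphere2. dist w x \<le> t}"
  shows "\<bar>\<Sum>k\<in>J. local_discrepancy A (x k)\<bar> \<le> 24 * real n + 108"
proof -
  define c where "c = 1 - t\<^sup>2 / 2"
  have lt: "c1 k < n" "c2 k < n" if "k \<in> J" for k using bij_betwE[OF bij] that by auto
  have inA: "square_point a p q \<in> A \<longleftrightarrow> w \<bullet> square_point a p q \<ge> c"
    if "a \<in> lowest_vertices" "in_cell n i j p q" "i < n" "j < n" for a i j p q
    unfolding A_def c_def using mem_cap_iff[OF w norm_square_point[OF that(1) in_cell_bounds[OF that(2-4)]] t] .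
  have A: "A \<in> sets borel"
  proof -
    have "A = sphere 0 1 \<inter> cball w t" by (auto simp: A_def)
    then show ?thesis by simp
  qed
  define I where "I = {(a, i, j) \<in> pixels n. \<forall>p q. in_cell n i j p q \<longrightarrow> square_point a p q \<in> A}"
  define U where "U = {(a, i, j) \<in> pixels n. \<exists>p q. in_cell n i j p q \<and> square_point a p q \<in> A}"
  define M where "M = {(a, k). a \<in> lowest_vertices \<and> k \<in> J \<and> square_point a (fst (x k)) (snd (x k)) \<in> A}"
  define g where "g = (\<lambda>(a::real \<times> real, k). (a, c1 k, c2 k))"
  have finJ: "finite J" using bij_betw_finite[OF bij] by simp
  have cardJ: "card J = n\<^sup>2" using bij_betw_same_card[OF bij] by (simp add: card_cartesian_product power2_eq_square)
  have finM: "finite M"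
    by (rule finite_subset[of _ "lowest_vertices \<times> J"]) (auto simp: M_def finJ finite_lowest_vertices)
  have gM: "inj_on g M"
    using bij_betw_imp_inj_on[OF bij] by (auto simp: inj_on_def g_def M_def)
  have "g ` M \<subseteq> U"
    using cell lt by (auto simp: g_def M_def U_def pixels_def)
  moreover have "I \<subseteq> g ` M"
  proof
    fix P assume P: "P \<in> I"
    obtain a i j where aij: "P = (a, i, j)" by (cases P)
    then have mem: "a \<in> lowest_vertices" "i < n" "j < n" using P by (auto simp: I_def pixels_def)
    then have "(i, j) \<in> (\<lambda>k. (c1 k, c2 k)) ` J" using bij_betw_imp_surj_on[OF bij] by auto
    then obtain k where k: "k \<in> J" "i = c1 k" "j = c2 k" by auto
    then have "(a, k) \<in> M" using P aij cell[OF k(1)] mem by (auto simp: I_def M_def)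
    then show "P \<in> g ` M" using k aij by (force simp: g_def)
  qed
  moreover have fins: "finite U" "finite I" using finite_pixels by (auto simp: U_def I_def intro: finite_subset)
  ultimately have M: "card I \<le> card M" "card M \<le> card U" "I \<subseteq> U"
    using card_mono[of U "g ` M"] card_mono[of "g ` M" I] finM card_image[OF gM] by auto
  have "(\<Sum>k\<in>J. \<Sum>y\<in>#healpix_G (x k). indicator A y :: real) = (\<Sum>k\<in>J. \<Sum>a\<in>lowest_vertices. indicator A (square_point a (fst (x k)) (snd (x k))))"
    using in_cell_bounds[OF cell lt] by (intro sum.cong refl sum_indicator_healpix_G) auto
  also have "\<dots> = (\<Sum>(a, k)\<in>lowest_vertices \<times> J. indicator A (square_point a (fst (x k)) (snd (x k))))"
    by (subst sum.swap) (simp add: sum.cartesian_product)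
  also have "\<dots> = (\<Sum>(a, k)\<in>lowest_vertices \<times> J. of_bool ((a, k) \<in> M))"
    by (intro sum.cong) (auto simp: M_def indicator_def)
  also have "\<dots> = real (card M)"
  proof -
    have "M \<subseteq> lowest_vertices \<times> J" by (auto simp: M_def)
    then show ?thesis using finJ finite_lowest_vertices by (simp add: case_prod_unfold sum_of_bool_eq Int_absorb1)
  qed
  finally have sum: "(\<Sum>k\<in>J. local_discrepancy A (x k)) = real (card M) - 12 * (real n)\<^sup>2 * measure sphere_measure A"
    using cardJ by (simp add: local_discrepancy_def sum_subtractf)
  have lower: "real (card I) \<le> 12 * (real n)\<^sup>2 * measure sphere_measure A"
    using in_cell_if_in_open_cell by (intro sphere_measure_ge_pixels[OF A _ n]) (auto simp: I_def)
  have upper: "12 * (real n)\<^sup>2 * measure sphere_measure A \<le> real (card U)"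
  proof -
    have "12 * (real n)\<^sup>2 * measure sphere_measure A \<le> 12 * (real n)\<^sup>2 - card (pixels n - U)"
      using in_cell_if_in_open_cell by (intro sphere_measure_le_pixels[OF A _ n]) (auto simp: U_def)
    moreover have "card (pixels n - U) = card (pixels n) - card U" "card U \<le> card (pixels n)"
      using fins finite_pixels by (auto simp: U_def intro!: card_Diff_subset card_mono)
    ultimately show ?thesis by (simp add: card_pixels of_nat_diff)
  qed
  have "real (card (U - I)) \<le> 24 * n + 108"
  proof (rule card_cut_pixels[where w = w and c = c])
    show "U - I \<subseteq> pixels n" by (auto simp: U_def)
    fix a i j assume aij: "(a, i, j) \<in> U - I"
    then have mem: "a \<in> lowest_vertices" "i < n" "j < n" by (auto simp: U_def pixels_def)
    show "\<exists>p q. in_cell n i j p q \<and> c \<le> w \<bullet> square_point a p q"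
      using aij inA[OF mem(1) _ mem(2,3)] by (auto simp: U_def)
    show "\<exists>p q. in_cell n i j p q \<and> w \<bullet> square_point a p q < c"
      using aij inA[OF mem(1) _ mem(2,3)] by (auto simp: U_def I_def not_le)
  qed
  moreover have "card (U - I) = card U - card I" "card I \<le> card U"
    using M(3) fins by (auto intro!: card_Diff_subset card_mono)
  ultimately have "real (card U) - real (card I) \<le> 24 * real n + 108" by (simp add: of_nat_diff)
  moreover have "real (card I) \<le> real (card M)" "real (card M) \<le> real (card U)" using M by auto
  ultimately show ?thesis unfolding sum using lower upper by linarith
qed

section \<open>Blocks of the planar sequence\<close>

text \<open>
  The recursion halves the mesh: the new binary digit of the two coordinates is the corner \<open>H (\<pi> m k)\<close> of the unit square (the origin for
  \<open>k = 0\<close>), and the four corners are distinct.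
\<close>

lemma S22_grid:
  assumes H: "bij_betw H {1..3} ({0, 1} \<times> {0, 1} - {(0::real, 0::real)})" and \<pi>: "\<And>m. \<pi> m permutes {1..3::nat}"
    and s0: "s 0 = (0, 0)"
    and rec: "\<And>m k i. k \<in> {1..3} \<Longrightarrow> i < 4 ^ m \<Longrightarrow> s (k * 4 ^ m + i) = (1 / 2 ^ (m + 1)) *\<^sub>R H (\<pi> m k) + s i"
  shows "(\<forall>i < 4 ^ m. \<exists>a b::nat. a < 2 ^ m \<and> b < 2 ^ m \<and> s i = (real a / 2 ^ m, real b / 2 ^ m)) \<and> inj_on s {..<4 ^ m}"
proof (induction m)
  case 0
  then show ?case by (auto simp: s0 inj_on_def)
next
  case (Suc m)
  \<comment> \<open>with the origin for \<open>k = 0\<close>, the recursion covers all four quarters of the block\<close>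
  define h where "h = (\<lambda>k. if k = 0 then (0, 0) else H (\<pi> m k))"
  have \<pi>k: "\<pi> m k \<in> {1..3}" if "k \<in> {1..3}" for k using permutes_in_image[OF \<pi>, of m k] that by simp
  have Hk: "H (\<pi> m k) \<in> {0, 1} \<times> {0, 1} - {(0, 0)}" if "k \<in> {1..3}" for k
    using bij_betwE[OF H] \<pi>k[OF that] by blast
  have h01: "\<exists>a b::nat. h k = (real a, real b) \<and> a \<le> 1 \<and> b \<le> 1" if "k < 4" for k
  proof (cases "k = 0")
    case True
    then show ?thesis by (intro exI[of _ 0]) (simp add: h_def)
  next
    case False
    then have "h k \<in> {0, 1} \<times> {0, 1}" using Hk[of k] that by (auto simp: h_def)
    then obtain u v where "h k = (u, v)" "u = real 0 \<or> u = real 1" "v = real 0 \<or> v = real 1" by auto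
    then show ?thesis by (metis le_numeral_extra(4) zero_le_one)
  qed
  have h_inj: "k = l" if "k < 4" "l < 4" "h k = h l" for k l
  proof -
    have "k = 0 \<longleftrightarrow> l = 0" using Hk[of k] Hk[of l] that by (auto simp: h_def split: if_splits)
    moreover have "k = l" if "k \<noteq> 0" "l \<noteq> 0"
    proof -
      have kl: "k \<in> {1..3}" "l \<in> {1..3}" using that \<open>k < 4\<close> \<open>l < 4\<close> by auto
      have "H (\<pi> m k) = H (\<pi> m l)" using \<open>h k = h l\<close> that by (simp add: h_def)
      then have "\<pi> m k = \<pi> m l" using bij_betw_imp_inj_on[OF H] \<pi>k kl by (auto simp: inj_on_def)
      then show ?thesis using permutes_inj[OF \<pi>, of m] by (auto simp: inj_on_def)
    qed
    ultimately show ?thesis by auto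
  qed
  have step: "s (k * 4 ^ m + i) = (1 / 2 ^ (m + 1)) *\<^sub>R h k + s i" if "k < 4" "i < 4 ^ m" for k i
    using rec[of k i m] that by (cases "k = 0") (auto simp: h_def zero_prod_def[symmetric])
  have decomp: "\<exists>k i. k < 4 \<and> i < 4 ^ m \<and> N = k * 4 ^ m + i" if "N < 4 ^ Suc m" for N :: nat
  proof (intro exI conjI)
    show "N = (N div 4 ^ m) * 4 ^ m + N mod 4 ^ m" by (rule div_mult_mod_eq[symmetric])
    show "N div 4 ^ m < 4" using that by (simp add: less_mult_imp_div_less)
  qed simp
  have num: "\<exists>a b u v::nat. a < 2 ^ m \<and> b < 2 ^ m \<and> u \<le> 1 \<and> v \<le> 1 \<and> s i = (real a / 2 ^ m, real b / 2 ^ m) \<and> h k = (real u, real v)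
      \<and> s (k * 4 ^ m + i) = (real (2 * a + u) / 2 ^ Suc m, real (2 * b + v) / 2 ^ Suc m)" if ki: "k < 4" "i < 4 ^ m" for k i
  proof -
    obtain a b :: nat where ab: "a < 2 ^ m" "b < 2 ^ m" "s i = (real a / 2 ^ m, real b / 2 ^ m)" using Suc.IH ki by blast
    obtain u v :: nat where uv: "h k = (real u, real v)" "u \<le> 1" "v \<le> 1" using h01[OF ki(1)] by blast
    have "s (k * 4 ^ m + i) = (real (2 * a + u) / 2 ^ Suc m, real (2 * b + v) / 2 ^ Suc m)"
      unfolding step[OF ki] ab(3) uv(1) by (simp add: field_simps)
    then show ?thesis using ab uv by blast
  qed
  show ?case
  proof (intro conjI allI impI inj_onI)
    fix N :: nat assume "N < 4 ^ Suc m"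
    then obtain k i where ki: "k < 4" "i < 4 ^ m" "N = k * 4 ^ m + i" using decomp by blast
    obtain a b u v :: nat where "a < 2 ^ m" "b < 2 ^ m" "u \<le> 1" "v \<le> 1"
      "s N = (real (2 * a + u) / 2 ^ Suc m, real (2 * b + v) / 2 ^ Suc m)" using num[OF ki(1,2)] ki(3) by blast
    then show "\<exists>a b::nat. a < 2 ^ Suc m \<and> b < 2 ^ Suc m \<and> s N = (real a / 2 ^ Suc m, real b / 2 ^ Suc m)"
      by (intro exI[of _ "2 * a + u"] exI[of _ "2 * b + v"]) auto
  next
    fix N N' :: nat assume NN: "N \<in> {..<4 ^ Suc m}" "N' \<in> {..<4 ^ Suc m}" "s N = s N'"
    obtain k i where ki: "k < 4" "i < 4 ^ m" "N = k * 4 ^ m + i" using decomp[of N] NN by auto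
    obtain l j where lj: "l < 4" "j < 4 ^ m" "N' = l * 4 ^ m + j" using decomp[of N'] NN by auto
    obtain a b u v :: nat where 1: "u \<le> 1" "v \<le> 1" "s i = (real a / 2 ^ m, real b / 2 ^ m)" "h k = (real u, real v)"
      "s N = (real (2 * a + u) / 2 ^ Suc m, real (2 * b + v) / 2 ^ Suc m)" using num[OF ki(1,2)] ki(3) by blast
    obtain a' b' u' v' :: nat where 2: "u' \<le> 1" "v' \<le> 1" "s j = (real a' / 2 ^ m, real b' / 2 ^ m)" "h l = (real u', real v')"
      "s N' = (real (2 * a' + u') / 2 ^ Suc m, real (2 * b' + v') / 2 ^ Suc m)" using num[OF lj(1,2)] lj(3) by blast
    have "real (2 * a + u) = real (2 * a' + u')" "real (2 * b + v) = real (2 * b' + v')"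
      using NN(3) unfolding 1(5) 2(5) by (auto simp only: prod.inject divide_cancel_right power_not_zero zero_neq_numeral)
    then have "2 * a + u = 2 * a' + u'" "2 * b + v = 2 * b' + v'" by linarith+
    then have "a = a'" "u = u'" "b = b'" "v = v'" using 1(1,2) 2(1,2) by presburger+
    then have "h k = h l" "s i = s j" using 1 2 by auto
    then have "k = l" "i = j" using h_inj ki lj Suc.IH by (auto simp: inj_on_def)
    then show "N = N'" using ki lj by simp
  qed
qed

text \<open>
  The base 4 digits of the index from position \<open>m\<close> on contribute binary digits of the coordinates beyond the \<open>m\<close>-th, which move the point by
  less than one mesh width.
\<close>

lemma S22_offset:
  assumes H: "bij_betw H {1..3} ({0, 1} \<times> {0, 1} - {(0::real, 0::real)})" and \<pi>: "\<And>m. \<pi> m permutes {1..3::nat}"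
    and rec: "\<And>m k i. k \<in> {1..3} \<Longrightarrow> i < 4 ^ m \<Longrightarrow> s (k * 4 ^ m + i) = (1 / 2 ^ (m + 1)) *\<^sub>R H (\<pi> m k) + s i"
    and "m \<le> L" "N < 4 ^ L"
  shows "\<exists>u v. s N = (u, v) + s (N mod 4 ^ m) \<and> 0 \<le> u \<and> u \<le> 1 / 2 ^ m - 1 / 2 ^ L \<and> 0 \<le> v \<and> v \<le> 1 / 2 ^ m - 1 / 2 ^ L"
  using assms(4,5)
proof (induction L arbitrary: N rule: dec_induct)
  case base
  then show ?case by (intro exI[of _ 0]) (simp add: zero_prod_def[symmetric])
next
  case (step L)
  define k j where "k = N div 4 ^ L" and "j = N mod 4 ^ L"
  have N: "N = k * 4 ^ L + j" "j < 4 ^ L"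
    unfolding k_def j_def by (rule div_mult_mod_eq[symmetric]) simp
  have k: "k < 4" using step.prems by (simp add: k_def less_mult_imp_div_less)
  have jm: "j mod 4 ^ m = N mod 4 ^ m" using step.hyps by (simp add: j_def mod_mod_cancel le_imp_power_dvd)
  obtain u v where uv: "s j = (u, v) + s (N mod 4 ^ m)" "0 \<le> u" "u \<le> 1 / 2 ^ m - 1 / 2 ^ L" "0 \<le> v" "v \<le> 1 / 2 ^ m - 1 / 2 ^ L"
    using step.IH[OF N(2)] jm by auto
  have half: "(1::real) / 2 ^ L = 1 / 2 ^ Suc L + 1 / 2 ^ Suc L" by simp
  have pos: "(0::real) \<le> 1 / 2 ^ Suc L" by simp
  show ?case
  proof (cases "k = 0")
    case True
    then have "N = j" using N by simp
    moreover have "u \<le> 1 / 2 ^ m - 1 / 2 ^ Suc L" "v \<le> 1 / 2 ^ m - 1 / 2 ^ Suc L"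
      using uv(3,5) half pos by linarith+
    ultimately show ?thesis using uv(1,2,4) by blast
  next
    case False
    then have kk: "k \<in> {1..3}" using k by auto
    have "\<pi> L k \<in> {1..3}" using permutes_in_image[OF \<pi>, of L k] kk by simp
    then have "H (\<pi> L k) \<in> {0, 1} \<times> {0, 1} - {(0, 0)}" using bij_betwE[OF H] by blast
    then obtain x y where xy: "H (\<pi> L k) = (x, y)" "x = 0 \<or> x = 1" "y = 0 \<or> y = 1" by auto
    have "s N = (1 / 2 ^ Suc L * x + u, 1 / 2 ^ Suc L * y + v) + s (N mod 4 ^ m)"
      using rec[OF kk N(2)] N(1) uv(1) xy(1) by (simp add: prod_eq_iff)
    moreover have digit: "0 \<le> 1 / 2 ^ Suc L * z + r \<and> 1 / 2 ^ Suc L * z + r \<le> 1 / 2 ^ m - 1 / 2 ^ Suc L"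
      if "z = 0 \<or> z = 1" "0 \<le> r" "r \<le> 1 / 2 ^ m - 1 / 2 ^ L" for z r :: real
      using that(1)
    proof
      assume "z = 0"
      show ?thesis unfolding \<open>z = 0\<close> mult_zero_right add_0 using that(2,3) half pos by (intro conjI; linarith)
    next
      assume "z = 1"
      show ?thesis unfolding \<open>z = 1\<close> mult_1_right using that(2,3) half pos by (intro conjI; linarith)
    qed
    ultimately show ?thesis using digit[OF xy(2) uv(2,3)] digit[OF xy(3) uv(4,5)] by blast
  qed
qed

text \<open>
  The cell of \<open>s k\<close> is the one whose corner is the grid point \<open>s (k mod 4 ^ m)\<close>.
\<close>

lemma S22_block_cells:
  assumes s: "S22_sequence s"
  obtains c1 c2 where "bij_betw (\<lambda>k. (c1 k, c2 k)) {B * 4 ^ m..<Suc B * 4 ^ m} ({..<2 ^ m} \<times> {..<2 ^ m})"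
    "\<And>k. k \<in> {B * 4 ^ m..<Suc B * 4 ^ m} \<Longrightarrow> in_cell (2 ^ m) (c1 k) (c2 k) (fst (s k)) (snd (s k))"
proof -
  obtain H \<pi> where H: "bij_betw H {1..3} ({0, 1} \<times> {0, 1} - {(0::real, 0::real)})" and \<pi>: "\<And>m. \<pi> m permutes {1..3::nat}"
    and s0: "s 0 = (0, 0)"
    and rec: "\<And>m k i. k \<in> {1..3} \<Longrightarrow> i < 4 ^ m \<Longrightarrow> s (k * 4 ^ m + i) = (1 / 2 ^ (m + 1)) *\<^sub>R H (\<pi> m k) + s i"
    using s unfolding S22_sequence_def by blast
  note grid = S22_grid[OF H \<pi> s0 rec, of m]
  then obtain a b :: "nat \<Rightarrow> nat" where ab: "\<And>i. i < 4 ^ m \<Longrightarrow> a i < 2 ^ m \<and> b i < 2 ^ m \<and> s i = (real (a i) / 2 ^ m, real (b i) / 2 ^ m)"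
    by metis
  define r where "r = (\<lambda>k::nat. k mod 4 ^ m)"
  have r: "r k < 4 ^ m" for k by (simp add: r_def)
  define J where "J = {B * 4 ^ m..<Suc B * 4 ^ m}"
  have inj_r: "k = l" if "k \<in> J" "l \<in> J" "r k = r l" for k l
  proof -
    have "k div 4 ^ m = B" "l div 4 ^ m = B" using that(1,2) by (auto simp: J_def mult.commute intro!: div_nat_eqI)
    then show ?thesis using that(3) unfolding r_def by (metis div_mult_mod_eq)
  qed
  have inj: "inj_on (\<lambda>k. (a (r k), b (r k))) J"
  proof (rule inj_onI)
    fix k l assume kl: "k \<in> J" "l \<in> J" "(a (r k), b (r k)) = (a (r l), b (r l))"
    then have "s (r k) = s (r l)" using ab[OF r, of k] ab[OF r, of l] by simp
    then have "r k = r l" using grid r by (auto simp: inj_on_def)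
    then show "k = l" using inj_r kl by blast
  qed
  have "(\<lambda>k. (a (r k), b (r k))) ` J = {..<2 ^ m} \<times> {..<2 ^ m}"
  proof (rule card_subset_eq)
    show "(\<lambda>k. (a (r k), b (r k))) ` J \<subseteq> {..<2 ^ m} \<times> {..<2 ^ m}" using ab r by auto
    have "card ((\<lambda>k. (a (r k), b (r k))) ` J) = card J" using inj by (rule card_image)
    also have "\<dots> = 4 ^ m" by (simp add: J_def)
    also have "\<dots> = card ({..<2 ^ m :: nat} \<times> {..<2 ^ m :: nat})"
      by (simp add: card_cartesian_product flip: power_mult_distrib)
    finally show "card ((\<lambda>k. (a (r k), b (r k))) ` J) = card ({..<2 ^ m :: nat} \<times> {..<2 ^ m :: nat})" .
  qed simp
  then have bij: "bij_betw (\<lambda>k. (a (r k), b (r k))) J ({..<2 ^ m} \<times> {..<2 ^ m})"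
    using inj by (simp add: bij_betw_def)
  have cell: "in_cell (2 ^ m) (a (r k)) (b (r k)) (fst (s k)) (snd (s k))" for k
  proof -
    have "k < 4 ^ max m k"
    proof -
      have "k < 4 ^ k" by (induction k) auto
      also have "(4::nat) ^ k \<le> 4 ^ max m k" by (intro power_increasing) auto
      finally show ?thesis .
    qed
    then obtain u v where uv: "s k = (u, v) + s (r k)" "0 \<le> u" "u \<le> 1 / 2 ^ m - 1 / 2 ^ max m k" "0 \<le> v" "v \<le> 1 / 2 ^ m - 1 / 2 ^ max m k"
      using S22_offset[OF H \<pi> rec, of m "max m k" k] unfolding r_def by auto
    have "(0::real) < 1 / 2 ^ max m k" by simp
    then have "u < 1 / 2 ^ m" "v < 1 / 2 ^ m" using uv by linarith+
    then have "0 \<le> 2 ^ m * u" "2 ^ m * u < 1" "0 \<le> 2 ^ m * v" "2 ^ m * v < 1" using uv by (auto simp: field_simps)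
    then show ?thesis using uv(1) ab[OF r, of k] by (simp add: in_cell_def distrib_left)
  qed
  show ?thesis by (rule that[OF bij[unfolded J_def] cell])
qed

section \<open>Splitting along base 4 digits\<close>

lemma abs_sum_consecutive_blocks_le:
  fixes e :: "nat \<Rightarrow> real"
  assumes "\<And>b. \<bar>sum e {b * l..<Suc b * l}\<bar> \<le> C"
  shows "\<bar>sum e {b * l..<(b + r) * l}\<bar> \<le> real r * C"
proof (induction r)
  case (Suc r)
  have "sum e {b * l..<(b + Suc r) * l} = sum e {b * l..<(b + r) * l} + sum e {(b + r) * l..<Suc (b + r) * l}"
    by (subst sum.atLeastLessThan_concat) auto
  then show ?case using Suc assms[of "b + r"] by (simp add: algebra_simps)
qed simp

lemma abs_sum_digits_le:
  fixes e :: "nat \<Rightarrow> real" and C :: "nat \<Rightarrow> real" and \<epsilon> :: "nat \<Rightarrow> nat"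
  assumes blk: "\<And>m b. \<bar>sum e {b * 4 ^ m..<Suc b * 4 ^ m}\<bar> \<le> C m"
  shows "\<bar>sum e {b * 4 ^ \<kappa>..<b * 4 ^ \<kappa> + (\<Sum>j<\<kappa>. \<epsilon> j * 4 ^ j)}\<bar> \<le> (\<Sum>j<\<kappa>. real (\<epsilon> j) * C j)"
proof (induction \<kappa> arbitrary: b)
  case (Suc \<kappa>)
  define K where "K = (\<Sum>j<\<kappa>. \<epsilon> j * 4 ^ j)"
  define b' where "b' = 4 * b"
  have T: "b * 4 ^ Suc \<kappa> = b' * 4 ^ \<kappa>" by (simp add: b'_def)
  have "sum e {b' * 4 ^ \<kappa>..<b' * 4 ^ \<kappa> + (K + \<epsilon> \<kappa> * 4 ^ \<kappa>)}
      = sum e {b' * 4 ^ \<kappa>..<(b' + \<epsilon> \<kappa>) * 4 ^ \<kappa>} + sum e {(b' + \<epsilon> \<kappa>) * 4 ^ \<kappa>..<(b' + \<epsilon> \<kappa>) * 4 ^ \<kappa> + K}"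
    by (subst sum.atLeastLessThan_concat) (auto simp: algebra_simps)
  then show ?case
    unfolding T using Suc.IH[of "b' + \<epsilon> \<kappa>"] abs_sum_consecutive_blocks_le[of e "4 ^ \<kappa>" "C \<kappa>" b' "\<epsilon> \<kappa>", OF blk]
    by (simp add: K_def)
qed simp

lemma sum_digits_less:
  fixes \<epsilon> :: "nat \<Rightarrow> nat"
  assumes "\<And>j. j < \<kappa> \<Longrightarrow> \<epsilon> j \<le> 3"
  shows "(\<Sum>j<\<kappa>. \<epsilon> j * 4 ^ j) < 4 ^ \<kappa>"
  using assms
proof (induction \<kappa>)
  case (Suc \<kappa>)
  have "(\<Sum>j<\<kappa>. \<epsilon> j * 4 ^ j) < 4 ^ \<kappa>" using Suc by simp
  moreover have "\<epsilon> \<kappa> * 4 ^ \<kappa> \<le> 3 * 4 ^ \<kappa>" using Suc.prems by (intro mult_right_mono) auto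
  ultimately have "(\<Sum>j<\<kappa>. \<epsilon> j * 4 ^ j) + \<epsilon> \<kappa> * 4 ^ \<kappa> < 4 ^ \<kappa> + 3 * 4 ^ \<kappa>" by (rule add_less_le_mono)
  then show ?case by simp
qed simp

text \<open>
  Filling \<open>K\<close> up to the next power of 4 takes \<open>3 - \<epsilon> j\<close> blocks of each length \<open>4 ^ j\<close> and one single element.
\<close>

lemma abs_sum_digit_complement_le:
  fixes e :: "nat \<Rightarrow> real" and C :: "nat \<Rightarrow> real" and \<epsilon> :: "nat \<Rightarrow> nat"
  assumes blk: "\<And>m b. \<bar>sum e {b * 4 ^ m..<Suc b * 4 ^ m}\<bar> \<le> C m"
    and \<epsilon>: "\<And>j. j < \<kappa> \<Longrightarrow> \<epsilon> j \<le> 3"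
  shows "\<bar>sum e {b * 4 ^ \<kappa> + (\<Sum>j<\<kappa>. \<epsilon> j * 4 ^ j)..<Suc b * 4 ^ \<kappa>}\<bar> \<le> (\<Sum>j<\<kappa>. (3 - real (\<epsilon> j)) * C j) + C 0"
  using \<epsilon>
proof (induction \<kappa> arbitrary: b)
  case 0
  then show ?case using blk[of b 0] by simp
next
  case (Suc \<kappa>)
  define K where "K = (\<Sum>j<\<kappa>. \<epsilon> j * 4 ^ j)"
  define b' where "b' = 4 * b + \<epsilon> \<kappa>"
  have \<epsilon>\<kappa>: "\<epsilon> \<kappa> \<le> 3" using Suc.prems by simp
  have K: "K \<le> 4 ^ \<kappa>"
    unfolding K_def using Suc.prems by (intro less_imp_le[OF sum_digits_less]) simp
  have T: "b * 4 ^ Suc \<kappa> + (\<Sum>j<Suc \<kappa>. \<epsilon> j * 4 ^ j) = b' * 4 ^ \<kappa> + K"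
    by (simp add: b'_def K_def algebra_simps)
  have E: "Suc b * 4 ^ Suc \<kappa> = (Suc b' + (3 - \<epsilon> \<kappa>)) * 4 ^ \<kappa>" using \<epsilon>\<kappa> by (simp add: b'_def algebra_simps)
  have "sum e {b' * 4 ^ \<kappa> + K..<(Suc b' + (3 - \<epsilon> \<kappa>)) * 4 ^ \<kappa>}
      = sum e {b' * 4 ^ \<kappa> + K..<Suc b' * 4 ^ \<kappa>} + sum e {Suc b' * 4 ^ \<kappa>..<(Suc b' + (3 - \<epsilon> \<kappa>)) * 4 ^ \<kappa>}"
    using K by (subst sum.atLeastLessThan_concat) auto
  moreover have "\<bar>sum e {b' * 4 ^ \<kappa> + K..<Suc b' * 4 ^ \<kappa>}\<bar> \<le> (\<Sum>j<\<kappa>. (3 - real (\<epsilon> j)) * C j) + C 0"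
    unfolding K_def using Suc.prems by (intro Suc.IH) auto
  moreover have "\<bar>sum e {Suc b' * 4 ^ \<kappa>..<(Suc b' + (3 - \<epsilon> \<kappa>)) * 4 ^ \<kappa>}\<bar> \<le> real (3 - \<epsilon> \<kappa>) * C \<kappa>"
    by (rule abs_sum_consecutive_blocks_le) (rule blk)
  ultimately show ?case
    unfolding T E using \<epsilon>\<kappa> by (simp add: of_nat_diff)
qed

text \<open>
  For the second entry of the minimum, the blocks of the complement and the full block cost
  \<open>\<beta> * (3 * (2 ^ (\<kappa> + 1) - 1) - S + 1 + 2 ^ (\<kappa> + 1)) \<le> \<beta> * (2 ^ (\<kappa> + 3) - S)\<close>.
\<close>

lemma abs_sum_digits_le_min:
  fixes e :: "nat \<Rightarrow> real" and \<epsilon> :: "nat \<Rightarrow> nat" and \<beta> D :: real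
  assumes blk: "\<And>m b. \<bar>sum e {b * 4 ^ m..<Suc b * 4 ^ m}\<bar> \<le> \<beta> * 2 ^ m + D"
    and \<epsilon>: "\<And>j. j \<le> \<kappa> \<Longrightarrow> \<epsilon> j \<le> 3" and D: "0 \<le> D" "0 \<le> \<beta>" and K: "K = (\<Sum>j\<le>\<kappa>. \<epsilon> j * 4 ^ j)"
  defines "S \<equiv> (\<Sum>j\<le>\<kappa>. real (\<epsilon> j) * 2 ^ j)"
  shows "\<bar>sum e {..<K}\<bar> \<le> \<beta> * min S (2 ^ (\<kappa> + 3) - S) + D * (3 * real \<kappa> + 5)"
proof -
  have K': "K = (\<Sum>j<Suc \<kappa>. \<epsilon> j * 4 ^ j)" and S': "S = (\<Sum>j<Suc \<kappa>. real (\<epsilon> j) * 2 ^ j)"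
    unfolding K S_def by (simp_all add: lessThan_Suc_atMost)
  have cnt: "(\<Sum>j<Suc \<kappa>. real (\<epsilon> j)) \<le> 3 * (real \<kappa> + 1)"
    using sum_bounded_above[of "{..<Suc \<kappa>}" "\<lambda>j. real (\<epsilon> j)" 3] \<epsilon> by (simp add: less_Suc_eq_le)
  have cnt': "(\<Sum>j<Suc \<kappa>. 3 - real (\<epsilon> j)) \<le> 3 * (real \<kappa> + 1)"
    using sum_bounded_above[of "{..<Suc \<kappa>}" "\<lambda>j. 3 - real (\<epsilon> j)" 3] by simp
  have geo: "(\<Sum>j<Suc \<kappa>. (2::real) ^ j) = 2 ^ Suc \<kappa> - 1" by (simp add: geometric_sum)
  have "\<bar>sum e {..<K}\<bar> \<le> (\<Sum>j<Suc \<kappa>. real (\<epsilon> j) * (\<beta> * 2 ^ j + D))"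
    using abs_sum_digits_le[OF blk, of 0 "Suc \<kappa>" \<epsilon>] by (simp add: K' atLeast0LessThan)
  also have "\<dots> = \<beta> * S + D * (\<Sum>j<Suc \<kappa>. real (\<epsilon> j))"
    unfolding S' sum_distrib_left sum.distrib[symmetric] by (intro sum.cong) (auto simp: algebra_simps)
  also have "D * (\<Sum>j<Suc \<kappa>. real (\<epsilon> j)) \<le> D * (3 * real \<kappa> + 5)"
    using D cnt by (intro mult_left_mono) auto
  finally have 1: "\<bar>sum e {..<K}\<bar> \<le> \<beta> * S + D * (3 * real \<kappa> + 5)" by simp
  have "\<bar>sum e {K..<4 ^ Suc \<kappa>}\<bar> \<le> (\<Sum>j<Suc \<kappa>. (3 - real (\<epsilon> j)) * (\<beta> * 2 ^ j + D)) + (\<beta> * 2 ^ 0 + D)"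
    using abs_sum_digit_complement_le[OF blk, of "Suc \<kappa>" \<epsilon> 0] \<epsilon> by (simp add: K' less_Suc_eq_le)
  also have "(\<Sum>j<Suc \<kappa>. (3 - real (\<epsilon> j)) * (\<beta> * 2 ^ j + D)) = \<beta> * (3 * (\<Sum>j<Suc \<kappa>. 2 ^ j) - S) + D * (\<Sum>j<Suc \<kappa>. 3 - real (\<epsilon> j))"
    unfolding S' sum_distrib_left sum.distrib[symmetric] sum_subtractf[symmetric] by (intro sum.cong) (auto simp: algebra_simps)
  also have "\<dots> \<le> \<beta> * (3 * (2 ^ Suc \<kappa> - 1) - S) + D * (3 * (real \<kappa> + 1))"
    unfolding geo using D cnt' by (intro add_left_mono mult_left_mono) auto
  finally have compl: "\<bar>sum e {K..<4 ^ Suc \<kappa>}\<bar> \<le> \<beta> * (3 * (2 ^ Suc \<kappa> - 1) - S) + D * (3 * (real \<kappa> + 1)) + (\<beta> + D)" by simp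
  have "K \<le> 4 ^ Suc \<kappa>"
    unfolding K' using \<epsilon> by (intro less_imp_le[OF sum_digits_less]) simp
  then have "sum e {..<4 ^ Suc \<kappa>} = sum e {..<K} + sum e {K..<4 ^ Suc \<kappa>}"
    by (simp add: sum.atLeastLessThan_concat flip: atLeast0LessThan)
  moreover have "\<bar>sum e {..<4 ^ Suc \<kappa>}\<bar> \<le> \<beta> * 2 ^ Suc \<kappa> + D" using blk[of 0 "Suc \<kappa>"] by (simp add: atLeast0LessThan)
  ultimately have "\<bar>sum e {..<K}\<bar> \<le> \<beta> * 2 ^ Suc \<kappa> + D + (\<beta> * (3 * (2 ^ Suc \<kappa> - 1) - S) + D * (3 * (real \<kappa> + 1)) + (\<beta> + D))"
    using compl by linarith
  also have "\<dots> = \<beta> * (2 ^ (\<kappa> + 3) - S) + D * (3 * real \<kappa> + 5) - 2 * \<beta>"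
    by (simp add: power_add algebra_simps)
  also have "\<dots> \<le> \<beta> * (2 ^ (\<kappa> + 3) - S) + D * (3 * real \<kappa> + 5)" using D by simp
  finally show ?thesis using 1 by (simp add: min_def)
qed

section \<open>The discrepancy bound\<close>

text \<open>
  The last \<open>k\<close> points come from an incomplete image \<open>healpix_G (s K)\<close>; together with their share of the measure
  they change the count by less than 12.
\<close>

lemma cap_discrepancy_initial_le:
  assumes s: "S22_sequence s" and Z: "Z \<in> G_sequences s" and N: "N = 12 * K + k" "k < 12" "N > 0"
    and \<epsilon>: "\<And>j. j \<le> \<kappa> \<Longrightarrow> \<epsilon> j \<le> 3" and K: "K = (\<Sum>j\<le>\<kappa>. \<epsilon> j * 4 ^ j)"
  defines "S \<equiv> (\<Sum>j\<le>\<kappa>. real (\<epsilon> j) * 2 ^ j)"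
  shows "cap_discrepancy (initial_mset Z N) \<le> (24 * min S (2 ^ (\<kappa> + 3) - S) + 108 * (3 * real \<kappa> + 5) + 12) / N"
proof -
  define X where "X = 24 * min S (2 ^ (\<kappa> + 3) - S) + 108 * (3 * real \<kappa> + 5) + 12"
  have size: "size (initial_mset Z N) = N" by (simp add: initial_mset_def)
  have cap: "\<bar>(\<Sum>x\<in>#initial_mset Z N. indicator A x) - real N * measure sphere_measure A\<bar> \<le> X" if "A \<in> spherical_caps" for A
  proof -
    obtain w t where A: "A = {x \<in> sphere2. dist w x \<le> t}" and w: "norm w = 1" and t: "0 < t"
      using \<open>A \<in> spherical_caps\<close> by (auto simp: spherical_caps_def)
    define e where "e = (\<lambda>i. local_discrepancy A (s i))"
    define \<mu> where "\<mu> = measure sphere_measure A"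
    have \<mu>: "0 \<le> \<mu>" "\<mu> \<le> 1"
    proof -
      interpret finite_measure sphere_measure by (rule finite_measure_sphere_measure)
      show "\<mu> \<le> 1" unfolding \<mu>_def using bounded_measure[of A] sphere_measure_UNIV by (simp add: sphere_measure_def)
      show "0 \<le> \<mu>" by (simp add: \<mu>_def)
    qed
    have blk: "\<bar>sum e {b * 4 ^ m..<Suc b * 4 ^ m}\<bar> \<le> 24 * 2 ^ m + 108" for m b
    proof -
      obtain c1 c2 where c: "bij_betw (\<lambda>k. (c1 k, c2 k)) {b * 4 ^ m..<Suc b * 4 ^ m} ({..<2 ^ m} \<times> {..<2 ^ m})"
        "\<And>k. k \<in> {b * 4 ^ m..<Suc b * 4 ^ m} \<Longrightarrow> in_cell (2 ^ m) (c1 k) (c2 k) (fst (s k)) (snd (s k))"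
        using S22_block_cells[OF s, of b m] by blast
      show ?thesis using block_discrepancy[OF _ w t c] unfolding e_def A by simp
    qed
    have blocks: "(\<Sum>i\<in>{n * 12..<n * 12 + 12}. indicator A (Z i)) = e n + 12 * \<mu>" for n
    proof -
      have "image_mset Z (mset_set {12 * n..<12 * n + 12}) = healpix_G (s n)" using Z by (simp add: G_sequences_def)
      then have "(\<Sum>y\<in>#healpix_G (s n). indicator A y :: real) = (\<Sum>i\<in>{12 * n..<12 * n + 12}. indicator A (Z i))"
        by (metis (no_types, lifting) image_mset.compositionality comp_def sum_unfold_sum_mset sum.cong)
      then show ?thesis by (simp add: e_def local_discrepancy_def \<mu>_def mult.commute)
    qed
    have "(\<Sum>x\<in>#initial_mset Z N. indicator A x :: real) = (\<Sum>i<N. indicator A (Z i))"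
      by (simp add: initial_mset_def image_mset.compositionality comp_def sum_unfold_sum_mset)
    also have "\<dots> = (\<Sum>i<K * 12. indicator A (Z i)) + (\<Sum>i\<in>{K * 12..<N}. indicator A (Z i))"
      using N by (simp add: sum.atLeastLessThan_concat flip: atLeast0LessThan)
    also have "(\<Sum>i<K * 12. indicator A (Z i)) = (\<Sum>n<K. \<Sum>i\<in>{n * 12..<n * 12 + 12}. indicator A (Z i))"
      by (rule sum.nat_group[symmetric])
    also have "\<dots> = sum e {..<K} + 12 * K * \<mu>" unfolding blocks by (simp add: sum.distrib)
    finally have "(\<Sum>x\<in>#initial_mset Z N. indicator A x) - real N * \<mu> = sum e {..<K} + ((\<Sum>i\<in>{K * 12..<N}. indicator A (Z i)) - k * \<mu>)"
      using N(1) by (simp add: algebra_simps)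
    moreover have "\<bar>(\<Sum>i\<in>{K * 12..<N}. indicator A (Z i)) - k * \<mu>\<bar> \<le> 12"
    proof -
      have "(\<Sum>i\<in>{K * 12..<N}. indicator A (Z i) :: real) \<le> real (card {K * 12..<N}) * 1"
        by (rule sum_bounded_above) (simp add: indicator_def)
      moreover have "0 \<le> (\<Sum>i\<in>{K * 12..<N}. indicator A (Z i) :: real)" by (simp add: sum_nonneg)
      moreover have "0 \<le> real k * \<mu>" "real k * \<mu> \<le> real k" using \<mu> by (auto intro: mult_left_le)
      ultimately show ?thesis using N by auto
    qed
    moreover have "\<bar>sum e {..<K}\<bar> \<le> 24 * min S (2 ^ (\<kappa> + 3) - S) + 108 * (3 * real \<kappa> + 5)"
      unfolding S_def by (rule abs_sum_digits_le_min[OF blk \<epsilon> _ _ K]) auto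
    ultimately show ?thesis unfolding X_def \<mu>_def by linarith
  qed
  have "spherical_caps \<noteq> {}"
  proof -
    have "axis 1 1 \<in> sphere2" "- axis 1 1 \<in> sphere2" by auto
    then have "dist (axis 1 1 :: real^3) (- axis 1 1) \<le> diameter sphere2"
      by (intro diameter_bounded_bound) auto
    moreover have "axis 1 1 \<noteq> (- axis 1 1 :: real^3)" by (simp add: vec_eq_iff axis_def) 
    ultimately have "0 < diameter sphere2" by (smt (verit) zero_less_dist_iff)
    then have "{x \<in> sphere2. dist (axis 1 1) x \<le> diameter sphere2 / 2} \<in> spherical_caps"
      unfolding spherical_caps_def using \<open>axis 1 1 \<in> sphere2\<close> by (auto intro!: exI[of _ "axis 1 1"] exI[of _ "diameter sphere2 / 2"])
    then show ?thesis by blast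
  qed
  then have "(SUP A\<in>spherical_caps. \<bar>(\<Sum>x\<in>#initial_mset Z N. indicator A x) - real N * measure sphere_measure A\<bar>) \<le> X"
    using cap by (intro cSUP_least)
  then show ?thesis unfolding cap_discrepancy_def size X_def[symmetric] using N(3) by (simp add: divide_right_mono)
qed

theorem theorem7:
  "\<exists>C'::real. \<forall>Z\<in>GS22_sequences. \<forall>(N::nat) (K::nat) (k::nat) (\<kappa>::nat) (\<epsilon> :: nat \<Rightarrow> nat).
     K \<ge> 1 \<longrightarrow> k < 12 \<longrightarrow> N = 12 * K + k \<longrightarrow>
     int \<kappa> = \<lfloor>ln (real K) / ln 4\<rfloor> \<longrightarrow>
     (\<forall>j\<le>\<kappa>. \<epsilon> j \<in> {0, 1, 2, 3}) \<longrightarrow>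
     K = (\<Sum>j\<le>\<kappa>. \<epsilon> j * 2 ^ (2 * j)) \<longrightarrow>
       cap_discrepancy (initial_mset Z N)
         \<le> 4 * ((5 + sqrt 2) / real N) *
             min (\<Sum>j\<le>\<kappa>. real (\<epsilon> j) * 2 ^ j)
                 (2 ^ (\<kappa> + 3) - (\<Sum>j\<le>\<kappa>. real (\<epsilon> j) * 2 ^ j))
           + C' / real N * ln (real N) \<and>
       4 * ((5 + sqrt 2) / real N) *
           min (\<Sum>j\<le>\<kappa>. real (\<epsilon> j) * 2 ^ j)
               (2 ^ (\<kappa> + 3) - (\<Sum>j\<le>\<kappa>. real (\<epsilon> j) * 2 ^ j))
         + C' / real N * ln (real N)
         \<le> 8 / sqrt 3 * ((5 + sqrt 2) / sqrt (real N)) + C' / real N * ln (real N)"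
\<comment> \<open>\<open>108 * (3 * \<kappa> + 5) + 12 \<le> 876 * ln N\<close>, as \<open>\<kappa> \<le> ln N\<close> and \<open>1 \<le> ln N\<close>\<close>
proof (rule exI[of _ 876], intro ballI allI impI conjI)
  fix Z and N K k \<kappa> :: nat and \<epsilon> :: "nat \<Rightarrow> nat"
  assume Z: "Z \<in> GS22_sequences" and K1: "K \<ge> 1" and k: "k < 12" and N: "N = 12 * K + k"
    and \<kappa>: "int \<kappa> = \<lfloor>ln (real K) / ln 4\<rfloor>" and \<epsilon>: "\<forall>j\<le>\<kappa>. \<epsilon> j \<in> {0, 1, 2, 3}"
    and K: "K = (\<Sum>j\<le>\<kappa>. \<epsilon> j * 2 ^ (2 * j))"
  define S where "S = (\<Sum>j\<le>\<kappa>. real (\<epsilon> j) * 2 ^ j)"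
  define M where "M = min S (2 ^ (\<kappa> + 3) - S)"
  obtain s where s: "S22_sequence s" "Z \<in> G_sequences s" using Z by (auto simp: GS22_sequences_def)
  have \<epsilon>3: "\<epsilon> j \<le> 3" if "j \<le> \<kappa>" for j using \<epsilon> that by fastforce
  have N12: "N \<ge> 12" "N > 0" using N K1 by auto
  have K4: "K = (\<Sum>j\<le>\<kappa>. \<epsilon> j * 4 ^ j)" using K by (simp add: power_mult)
  have k_le: "real \<kappa> \<le> ln K / ln 4" using \<kappa> by linarith
  have ln4: "ln 4 \<ge> (1::real)"
  proof -
    have "exp 1 \<le> (4::real)" using exp_le by linarith
    then show ?thesis by (simp add: ln_ge_iff)
  qed
  have "4 ^ \<kappa> \<le> real K"
  proof -
    have "ln (4 ^ \<kappa>) \<le> ln (real K)" using k_le ln4 by (simp add: ln_realpow field_simps)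
    then show ?thesis using K1 by simp
  qed
  have S0: "S \<ge> 0" by (simp add: S_def sum_nonneg)
  have M0: "M \<ge> 0"
  proof -
    have "S \<le> (\<Sum>j\<le>\<kappa>. 3 * 2 ^ j)" unfolding S_def using \<epsilon>3 by (intro sum_mono mult_right_mono) auto
    also have "\<dots> = 3 * (2 ^ Suc \<kappa> - 1)"
      by (simp add: sum_distrib_left[symmetric] geometric_sum flip: lessThan_Suc_atMost)
    also have "\<dots> \<le> 2 ^ (\<kappa> + 3)"
    proof -
      have "3 * (2 * x - 1) \<le> 8 * x" if "0 \<le> x" for x :: real using that by simp
      from this[of "2 ^ \<kappa>"] show ?thesis by (simp add: power_add)
    qed
    finally show ?thesis using S0 by (simp add: M_def)
  qed
  have lnN: "real \<kappa> \<le> ln N" "1 \<le> ln N"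
  proof -
    have "0 \<le> ln (real K)" using K1 by simp
    then have "ln (real K) / ln 4 \<le> ln K" using ln4 by (simp add: divide_le_eq mult_le_cancel_left1)
    also have "\<dots> \<le> ln N" using K1 N by simp
    finally show "real \<kappa> \<le> ln N" using k_le by linarith
    have "exp 1 \<le> real N" using exp_le N12 by linarith
    then show "1 \<le> ln N" using N12 by (simp add: ln_ge_iff)
  qed
  have "cap_discrepancy (initial_mset Z N) \<le> (24 * M + 108 * (3 * real \<kappa> + 5) + 12) / N"
    unfolding M_def S_def by (rule cap_discrepancy_initial_le[OF s N k N12(2) \<epsilon>3 K4])
  also have "\<dots> \<le> (4 * (5 + sqrt 2) * M + 876 * ln N) / N"
  proof (rule divide_right_mono)
    have "108 * (3 * x + 5) + 12 \<le> 876 * y" if "x \<le> y" "1 \<le> y" for x y :: real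
      using that by (simp add: distrib_left)
    from this[OF lnN] have "108 * (3 * real \<kappa> + 5) + 12 \<le> 876 * ln N" .
    moreover have "24 * M \<le> 4 * (5 + sqrt 2) * M" using M0 by (intro mult_right_mono) auto
    ultimately show "24 * M + 108 * (3 * real \<kappa> + 5) + 12 \<le> 4 * (5 + sqrt 2) * M + 876 * ln N" by argo
  qed simp
  also have "\<dots> = 4 * ((5 + sqrt 2) / real N) * M + 876 / real N * ln (real N)"
    unfolding add_divide_distrib[of "4 * (5 + sqrt 2) * M"]
    by (simp only: times_divide_eq_right times_divide_eq_left)
  finally show "cap_discrepancy (initial_mset Z N)
         \<le> 4 * ((5 + sqrt 2) / real N) *
             min (\<Sum>j\<le>\<kappa>. real (\<epsilon> j) * 2 ^ j)
                 (2 ^ (\<kappa> + 3) - (\<Sum>j\<le>\<kappa>. real (\<epsilon> j) * 2 ^ j))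
           + 876 / real N * ln (real N)"
    by (simp add: M_def S_def)
  \<comment> \<open>the minimum is at most the mean of its entries, and \<open>12 * 4 ^ \<kappa> \<le> N\<close>\<close>
  have "M \<le> 4 * 2 ^ \<kappa>" by (simp add: M_def min_def power_add)
  moreover have "sqrt 12 * 2 ^ \<kappa> \<le> sqrt N"
  proof -
    have "sqrt 12 * 2 ^ \<kappa> = sqrt (12 * 4 ^ \<kappa>)"
      by (simp add: real_sqrt_mult real_sqrt_power)
    also have "\<dots> \<le> sqrt N"
    proof (rule real_sqrt_le_mono)
      have "real N = 12 * real K + real k" by (simp add: N)
      then show "12 * 4 ^ \<kappa> \<le> real N" using \<open>4 ^ \<kappa> \<le> real K\<close> by linarith
    qed
    finally show ?thesis .
  qed
  moreover have "sqrt 12 = 2 * sqrt (3::real)" using real_sqrt_mult[of 4 3] by simp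
  ultimately have "M * sqrt 3 \<le> 2 * sqrt N"
  proof -
    assume a: "M \<le> 4 * 2 ^ \<kappa>" "sqrt 12 * 2 ^ \<kappa> \<le> sqrt N" "sqrt 12 = 2 * sqrt (3::real)"
    have "M * sqrt 3 \<le> 4 * 2 ^ \<kappa> * sqrt 3" using a(1) by (rule mult_right_mono) simp
    also have "\<dots> = 2 * (sqrt 12 * 2 ^ \<kappa>)" unfolding a(3) by simp
    finally show ?thesis using a(2) by linarith
  qed
  then have "M \<le> 2 * sqrt N / sqrt 3" by (simp add: pos_le_divide_eq)
  then have "M / N \<le> 2 * sqrt N / sqrt 3 / N" by (rule divide_right_mono) simp
  also have "\<dots> = 2 / sqrt 3 / sqrt N"
  proof -
    have "sqrt N * sqrt N = N" by simp
    then show ?thesis using N12(2) by (simp add: field_simps)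
  qed
  finally have "M / N \<le> 2 / sqrt 3 / sqrt N" .
  then have "4 * (5 + sqrt 2) * (M / N) \<le> 4 * (5 + sqrt 2) * (2 / sqrt 3 / sqrt N)"
    by (intro mult_left_mono) auto
  then show "4 * ((5 + sqrt 2) / real N) *
           min (\<Sum>j\<le>\<kappa>. real (\<epsilon> j) * 2 ^ j)
               (2 ^ (\<kappa> + 3) - (\<Sum>j\<le>\<kappa>. real (\<epsilon> j) * 2 ^ j))
         + 876 / real N * ln (real N)
         \<le> 8 / sqrt 3 * ((5 + sqrt 2) / sqrt (real N)) + 876 / real N * ln (real N)"
    by (simp add: M_def S_def)
qed

end
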